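(* For any ergodic invertible measure-preserving transformations $T_1,T_2$ on some probability space $(X,\mu)$ and for any measurable $A\subseteq X$ with $\mu(A)>0$, $$\lim_{N\to\infty}\frac1N\sum_{n=1}^N\mu\big(A\cap T_1^{-n}A\cap T_2^{-\Omega(n)}A\big)\geq\mu(A)^3.$$ In particular, for any $\varepsilon>0$, $$\overline d\big(\{n\in\mathbb{N}:\mu(A\cap T_1^{-n}A\cap T_2^{-\Omega(n)}A)\geq\mu(A)^3-\varepsilon\}\big)>0.$$
   Context: $\mathbb{N}=\{1,2,\dots\}$. Every probability space $(X,\mu)$ is assumed regular: $X$ is a compact metric space with its Borel $\sigma$-algebra. $\Omega(n)$ is the number of prime factors of $n$ counted with multiplicity. For $E\subseteq\mathbb{N}$, $\overline d(E)=\limsup_{N\to\infty}\frac{|E\cap[1,N]|}{N}$ is the upper density. $T_1$ and $T_2$ are not assumed to commute. *)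

theory Defs
  imports "HOL-Probability.Probability" "HOL-Computational_Algebra.Primes"
begin

text \<open>
  A regular probability space: the underlying set \<open>space M\<close> is a compact subset of an ambient
  metric space, and the \<open>\<sigma>\<close>-algebra is that of its Borel sets in the subspace topology. Taking a
  subset rather than the whole type costs nothing and avoids one type per space.
\<close>

definition regular_prob_space :: "'a::metric_space measure \<Rightarrow> bool" where
  "regular_prob_space M \<longleftrightarrow>
     prob_space M \<and> compact (space M) \<and> sets M = sets (restrict_space borel (space M))"

definition measure_preserving_map :: "'a measure \<Rightarrow> ('a \<Rightarrow> 'a) \<Rightarrow> bool" where
  "measure_preserving_map M T \<longleftrightarrow>
     T \<in> measurable M M \<and> (\<forall>A\<in>sets M. emeasure M (T -` A \<inter> space M) = emeasure M A)"

text \<open>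
  Invertibility is meant everywhere on the space, not just almost everywhere. The inverse is
  then automatically measure preserving. Values of \<open>T\<close> outside \<open>space M\<close> are irrelevant.
\<close>

definition invertible_mpt :: "'a measure \<Rightarrow> ('a \<Rightarrow> 'a) \<Rightarrow> bool" where
  "invertible_mpt M T \<longleftrightarrow>
     measure_preserving_map M T \<and> bij_betw T (space M) (space M) \<and>
     the_inv_into (space M) T \<in> measurable M M"

definition ergodic_map :: "'a measure \<Rightarrow> ('a \<Rightarrow> 'a) \<Rightarrow> bool" where
  "ergodic_map M T \<longleftrightarrow>
     (\<forall>A\<in>sets M. T -` A \<inter> space M = A \<longrightarrow> measure M A = 0 \<or> measure M A = 1)"

definition Omega :: "nat \<Rightarrow> nat" where
  "Omega n = size (prime_factorization n)"

text \<open>The preimage \<open>T\<^sup>-\<^sup>k A\<close> within the space.\<close>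

definition preimage_pow :: "'a measure \<Rightarrow> ('a \<Rightarrow> 'a) \<Rightarrow> nat \<Rightarrow> 'a set \<Rightarrow> 'a set" where
  "preimage_pow M T k A = (T ^^ k) -` A \<inter> space M"

text \<open>
  The limit superior is taken in the extended reals only because \<open>limsup\<close> needs a complete
  lattice; all terms lie in \<open>[0, 1]\<close>, and the term at \<open>N = 0\<close> is \<open>0\<close> by convention.
\<close>

definition upper_density :: "nat set \<Rightarrow> ereal" where
  "upper_density E = limsup (\<lambda>N. ereal (real (card (E \<inter> {1..N})) / real N))"

end

theory Submission
  imports Defs "HOL-Number_Theory.Number_Theory"
begin

text \<open>
  The limit is in fact equal to \<open>\<mu>(A)\<^sup>3\<close>. Write \<open>1\<^sub>A = F + f\<close>, where \<open>F\<close> is invariant under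
  \<open>T\<^sub>1\<^sup>K\<close> and \<open>f\<close> is almost orthogonal to the functions invariant under any power of \<open>T\<^sub>1\<close>, and
  replace the last factor \<open>1\<^sub>A\<close> by its mean plus \<open>g\<close>. The mean contributes \<open>\<mu>(A)\<^sup>3\<close> by the mean
  ergodic theorem. The terms \<open>f(T\<^sub>1\<^sup>n x) g(T\<^sub>2\<^bsup>\<Omega>(n)\<^esup> x)\<close> average out because, by Turan-Kubilius, \<open>n\<close> may be
  replaced by \<open>pm\<close> for an average prime \<open>p\<close>, where \<open>\<Omega>(pm) = \<Omega>(m) + 1\<close> does not depend on \<open>p\<close>. The terms
  with \<open>F\<close> only involve \<open>n\<close> modulo \<open>K\<close>, so they average out once the distribution of \<open>\<Omega>(n)\<close>, for
  \<open>n \<le> x\<close> in a fixed residue class, is asymptotically invariant under translation by \<open>1\<close>.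

  This last fact contains the prime number theorem in arithmetic progressions. Following Richter's
  elementary proof of the prime number theorem, one compares Turan-Kubilius averages over two
  sets of primes matched at a small but nonzero logarithmic distance, which shows that the
  averages vary slowly with \<open>x\<close>; hence a single prime \<open>p\<close> translates the distribution by \<open>1\<close> while
  dividing the residue class by \<open>p\<close>. It remains to find two products of such primes that are
  congruent to \<open>1\<close> and have consecutive lengths. If there were none, the lengths would define a
  nontrivial character \<open>\<chi>\<close> modulo \<open>K\<close> with \<open>\<chi>(p) = \<zeta>\<close> for almost all primes, a fixed root of
  unity, and this is incompatible with the behaviour of \<open>L(s, \<chi>)\<close> as \<open>s\<close> decreases to \<open>1\<close>.
\<close>

section \<open>Chebyshev and Mertens estimates\<close>

text \<open>Only real \<open>s > 1\<close> enter the argument on \<open>L\<close>: nothing is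
  continued analytically and no logarithm of \<open>L\<close> is taken. Any \<open>l\<close>-th root
  of unity other than 1 would turn lengths modulo \<open>l\<close> into a nontrivial character. The
  root is taken with negative real part because the Euler product then forces \<open>L\<close> to
  vanish at 1 instead of blowing up. Vanishing to a fractional order contradicts Lipschitz
  continuity, and the remaining value -1 makes the character real, where positivity of divisor sums
  decides. All asymptotic statements about averages of \<open>b (Omega n)\<close> are uniform over
  the sequences \<open>b\<close> bounded by 1. The application rests on this: there \<open>b\<close>
  is the orbit \<open>m \<mapsto> g ((T2 ^^ m) x)\<close>, for all points \<open>x\<close> at once.
  The second map acts only through \<open>Omega n\<close>, which is how the lack of commutation is
  circumvented.\<close>

lemma prod_distinct_primes_dvd:
  fixes n :: nat
  assumes "finite P" "\<And>p. p \<in> P \<Longrightarrow> prime p \<and> p dvd n"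
  shows "\<Prod>P dvd n"
  using assms
proof (induction P rule: finite_induct)
  case (insert p P)
  have "coprime p (\<Prod>P)"
    using insert by (intro prod_coprime_right) (metis insertCI primes_coprime)
  then show ?case using insert by (auto intro: divides_mult)
qed simp

text \<open>Each prime in \<open>(z, z + m]\<close> divides \<open>(z + m)!\<close> but neither
  \<open>z!\<close> nor, because of \<open>m \<le> z\<close>, \<open>m!\<close>; so it survives in
  the binomial coefficient. The case of \<open>m\<close> near \<open>z\<close> gives Chebyshev's
  bound, the case of \<open>m\<close> much smaller than \<open>z\<close> the bound for short
  intervals.\<close>

lemma sum_ln_primes_le_ln_binomial:
  assumes "m \<le> z"
  shows "(\<Sum>p | prime p \<and> z < p \<and> p \<le> z + m. ln (real p)) \<le> ln (real (z + m choose m))"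
proof -
  let ?P = "{p. prime p \<and> z < p \<and> p \<le> z + m}"
  have fin: "finite ?P" by (rule finite_subset[of _ "{..z+m}"]) auto
  have "p dvd (z + m choose m)" if p: "p \<in> ?P" for p
  proof -
    have "fact m * fact z * (z + m choose m) = (fact (z + m) :: nat)"
      using binomial_fact_lemma[of m "z+m"] by simp
    moreover have "p dvd (fact (z + m) :: nat)" using p by (auto simp: prime_dvd_fact_iff)
    moreover have "\<not> p dvd (fact m :: nat)" "\<not> p dvd (fact z :: nat)"
      using p assms by (auto simp: prime_dvd_fact_iff)
    ultimately show ?thesis using p by (metis (no_types, lifting) mem_Collect_eq prime_dvd_mult_iff)
  qed
  then have "\<Prod>?P dvd (z + m choose m)" by (intro prod_distinct_primes_dvd fin) auto
  then have "\<Prod>?P \<le> (z + m choose m)" by (intro dvd_imp_le) auto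
  then have "real (\<Prod>?P) \<le> real (z + m choose m)" by linarith
  moreover have "(\<Prod>p\<in>?P. real p) > 0" by (intro prod_pos) (auto simp: prime_gt_0_nat)
  ultimately have "ln (\<Prod>p\<in>?P. real p) \<le> ln (real (z + m choose m))" by simp
  also have "ln (\<Prod>p\<in>?P. real p) = (\<Sum>p\<in>?P. ln (real p))"
    using fin by (subst ln_prod) (auto simp: prime_gt_0_nat)
  finally show ?thesis .
qed

lemma finite_primes_le [simp]: "finite {p::nat. prime p \<and> p \<le> n}"
  by (rule finite_subset[of _ "{..n}"]) auto

lemma finite_primes_between [simp]: "finite {p::nat. prime p \<and> z < p \<and> p \<le> n}"
  by (rule finite_subset[of _ "{..n}"]) auto

lemma sum_primes_split:
  assumes "z \<le> n"
  shows "(\<Sum>p | prime p \<and> p \<le> n. f p) =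
    (\<Sum>p | prime p \<and> p \<le> z. f p) + (\<Sum>p::nat | prime p \<and> z < p \<and> p \<le> n. f p :: real)"
proof -
  have "{p. prime p \<and> p \<le> n} = {p. prime p \<and> p \<le> z} \<union> {p. prime p \<and> z < p \<and> p \<le> n}"
    using assms by auto
  then show ?thesis by (simp only:) (subst sum.union_disjoint, auto)
qed

lemma theta_le: "(\<Sum>p | prime p \<and> p \<le> n. ln (real p)) \<le> 4 * real n"
proof (induction n rule: less_induct)
  case (less n)
  define z where "z = n - n div 2"
  define m where "m = n div 2"
  have zm: "z + m = n" "m \<le> z" by (auto simp: z_def m_def)
  show ?case
  proof (cases "n \<le> 1")
    case True
    then have "{p::nat. prime p \<and> p \<le> n} = {}" by (auto dest: prime_gt_1_nat)
    then show ?thesis by (simp only: sum.empty)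
  next
    case False
    then have m1: "m \<ge> 1" by (auto simp: m_def)
    have "(\<Sum>p | prime p \<and> p \<le> n. ln (real p)) =
      (\<Sum>p | prime p \<and> p \<le> z. ln (real p)) + (\<Sum>p | prime p \<and> z < p \<and> p \<le> n. ln (real p))"
      by (rule sum_primes_split) (use zm in auto)
    also have "\<dots> \<le> 4 * real z + ln (real (z + m choose m))"
      using less[of z] sum_ln_primes_le_ln_binomial[OF zm(2)] zm m1 by (intro add_mono) auto
    also have "real (z + m choose m) \<le> 2 ^ n"
      using binomial_le_pow2[of "z+m" m] zm by (metis of_nat_le_iff of_nat_numeral of_nat_power)
    then have "ln (real (z + m choose m)) \<le> ln (2 ^ n)"
      by (subst ln_le_cancel_iff) (auto simp: zero_less_binomial)
    also have "\<dots> = n * ln 2" by (simp add: ln_realpow)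
    also have "n * ln 2 \<le> real n * (25/36)" using ln2_le_25_over_36 by (intro mult_left_mono) auto
    also have "4 * real z + real n * (25/36) \<le> 4 * n"
    proof -
      \<comment> \<open>The worst case is \<open>n = 3\<close>. Since 8/3 + 25/36 < 4, the constant
        4 closes the induction.\<close>
      have "3 * z \<le> 2 * n" using m1 by (auto simp: z_def m_def)
      then show ?thesis by linarith
    qed
    finally show ?thesis by simp
  qed
qed

text \<open>A weak form of Stirling's formula: the term of index \<open>m\<close> in the series of
  \<open>exp m\<close> is at most the whole sum.\<close>

lemma fact_ge_power: "(real m / exp 1) ^ m \<le> fact m"
proof -
  have "(\<Sum>i\<in>{m}. real m ^ i / fact i) \<le> (\<Sum>i. real m ^ i / fact i)"
    using summable_exp[of "real m"] by (intro sum_le_suminf) (auto simp: divide_inverse_commute)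
  also have "\<dots> = exp (real m)" by (simp add: exp_def divide_inverse_commute scaleR_conv_of_real)
  finally have "real m ^ m \<le> exp (real m) * fact m" by (simp add: field_simps)
  also have "exp (real m) = exp 1 ^ m" by (simp flip: exp_of_nat_mult)
  finally show ?thesis by (simp add: power_divide field_simps)
qed

lemma ln_binomial_le:
  assumes "m \<ge> 1" and that: "m \<le> n"
  shows "ln (real (n choose m)) \<le> m * (1 + ln (real n / real m))"
proof -
  have "real (n choose m) * (real m / exp 1) ^ m \<le> real (n choose m) * fact m"
    by (intro mult_left_mono fact_ge_power) auto
  also have "\<dots> = real ((n choose m) * fact m)" by simp
  also have "\<dots> \<le> real (n ^ m)" using binomial_fact_pow by (intro of_nat_mono)
  finally have "real (n choose m) \<le> (exp 1 * (real n / real m)) ^ m"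
    using assms by (simp add: power_divide power_mult_distrib field_simps)
  then have "ln (real (n choose m)) \<le> ln ((exp 1 * (real n / real m)) ^ m)"
    using assms that by (subst ln_le_cancel_iff) (auto simp: zero_less_binomial)
  also have "\<dots> = m * (1 + ln (real n / real m))"
    using assms that ln_mult[of "exp 1" "real n / real m"] by (simp add: ln_realpow)
  finally show ?thesis .
qed

lemma ln_le_two_sqrt: "x > 0 \<Longrightarrow> ln x \<le> 2 * sqrt (x::real)"
proof -
  assume x: "x > 0"
  have "ln x = ln (sqrt x ^ 2)" using x by simp
  also have "\<dots> = 2 * ln (sqrt x)" using x by (subst ln_realpow) auto
  also have "\<dots> \<le> 2 * sqrt x" using x by (intro mult_left_mono ln_bound) auto
  finally show ?thesis .
qed

text \<open>With \<open>m = u * z\<close> the logarithm of the binomial coefficient has order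
  \<open>u * ln (1 / u) * z\<close>, which is small against \<open>z\<close> when \<open>u\<close>
  is small. So a short logarithmic interval cannot contain many primes; this upper bound needs no
  asymptotics for primes.\<close>

lemma theta_short_interval:
  assumes "\<rho> > 0"
  obtains \<delta> where "\<delta> > 0"
    "\<And>z::nat. z \<ge> 1 \<Longrightarrow> (\<Sum>p | prime p \<and> z < p \<and> real p \<le> exp \<delta> * real z. ln (real p)) \<le> \<rho> * real z"
proof
  \<comment> \<open>By \<open>ln t \<le> 2 * sqrt t\<close> the bound becomes
    \<open>u + 2 * sqrt (u * (u + 1))\<close> times \<open>z\<close>, at most
    \<open>4 * sqrt \<kappa> * z\<close> for \<open>u \<le> \<kappa> \<le> 1\<close>; hence the
    16.\<close>
  define \<kappa> where "\<kappa> = min 1 (\<rho>\<^sup>2 / 16)"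
  have k: "\<kappa> > 0" "\<kappa> \<le> 1" "\<kappa> \<le> \<rho>\<^sup>2/16" using assms by (auto simp: \<kappa>_def)
  define \<delta> where "\<delta> = ln (1 + \<kappa>)"
  show "\<delta> > 0" using k by (simp add: \<delta>_def)
  fix z :: nat assume z: "z \<ge> 1"
  define m where "m = nat \<lfloor>\<kappa> * real z\<rfloor>"
  have ed: "exp \<delta> = 1 + \<kappa>" using k by (simp add: \<delta>_def)
  have "real m \<le> \<kappa> * real z" using k by (auto simp: m_def)
  moreover have "\<kappa> * real z \<le> 1 * real z" using k by (intro mult_right_mono) auto
  ultimately have mz: "m \<le> z" "real m \<le> \<kappa> * real z" by linarith+
  have eq: "{p. prime p \<and> z < p \<and> real p \<le> exp \<delta> * real z} = {p. prime p \<and> z < p \<and> p \<le> z + m}"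
  proof -
    have "real p \<le> exp \<delta> * real z \<longleftrightarrow> p \<le> z + m" if "z < p" for p
    proof -
      have "p \<le> z + m \<longleftrightarrow> int p - int z \<le> \<lfloor>\<kappa> * real z\<rfloor>" using that k by (auto simp: m_def)
      also have "\<dots> \<longleftrightarrow> real p - real z \<le> \<kappa> * real z" by (simp add: le_floor_iff)
      finally show ?thesis by (auto simp: ed algebra_simps)
    qed
    then show ?thesis by auto
  qed
  show "(\<Sum>p | prime p \<and> z < p \<and> real p \<le> exp \<delta> * real z. ln (real p)) \<le> \<rho> * real z"
  proof (cases "m \<ge> 1")
    case False
    then have "{p. prime p \<and> z < p \<and> p \<le> z + m} = {}" by auto
    then show ?thesis unfolding eq by (simp only: sum.empty) (use assms in simp)
  next
    case True
    define u where "u = real m / real z"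
    have u: "u > 0" "u \<le> \<kappa>" using True z mz by (auto simp: u_def field_simps)
    have lnu: "ln (1 + 1/u) \<le> 2 * sqrt (1 + 1/u)"
      using u by (intro ln_le_two_sqrt) (auto simp: add_pos_pos)
    have "real (z+m) / real m = 1 + 1 / u" using True z by (simp add: u_def field_simps)
    then have "(\<Sum>p | prime p \<and> z < p \<and> p \<le> z + m. ln (real p)) \<le> m * (1 + ln (1 + 1 / u))"
      using sum_ln_primes_le_ln_binomial[OF mz(1)] ln_binomial_le[OF True, of "z+m"] by simp
    also have "\<dots> \<le> m * (1 + 2 * sqrt (1 + 1/u))"
      using lnu by (intro mult_left_mono) auto
    also have "m * (1 + 2 * sqrt (1 + 1/u)) = (u + 2 * (u * sqrt (1 + 1/u))) * z"
      using z by (simp add: u_def field_simps)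
    also have "u * sqrt (1+1/u) = sqrt (u\<^sup>2 * (1+1/u))" using u by (simp add: real_sqrt_mult)
    also have "u\<^sup>2 * (1+1/u) = u * (u + 1)" using u by (simp add: field_simps power2_eq_square)
    also have "sqrt (u * (u+1)) \<le> sqrt (\<kappa> * 2)" using u k by (intro real_sqrt_le_mono mult_mono) auto
    also have "u \<le> sqrt \<kappa>"
    proof -
      have "u \<le> \<kappa>" using u by simp
      also have "\<kappa> = sqrt \<kappa> * sqrt \<kappa>" using k by simp
      also have "\<dots> \<le> sqrt \<kappa> * 1" using k by (intro mult_left_mono) auto
      finally show ?thesis by simp
    qed
    also have "sqrt (\<kappa> * 2) \<le> sqrt \<kappa> * (3/2)"
    proof -
      have "sqrt 2 \<le> sqrt ((3/2)\<^sup>2)" by (intro real_sqrt_le_mono) (simp add: power2_eq_square)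
      then show ?thesis using k by (auto simp: real_sqrt_mult)
    qed
    also have "sqrt \<kappa> + 2 * (sqrt \<kappa> * (3/2)) = 4 * sqrt \<kappa>" by simp
    also have "sqrt \<kappa> \<le> sqrt ((\<rho>/4)\<^sup>2)" using k by (intro real_sqrt_le_mono) (simp add: power_divide)
    then have "4 * sqrt \<kappa> * z \<le> \<rho> * z" using assms by (intro mult_right_mono) auto
    finally show ?thesis unfolding eq using u k
      by (simp add: mult_right_mono)
  qed
qed

lemma card_multiples_le:
  assumes "d \<ge> (1::nat)"
  shows "card {m\<in>{1..n}. d dvd m} = n div d"
proof -
  have "{m\<in>{1..n}. d dvd m} = (\<lambda>k. d * k) ` {1..n div d}"
  proof (intro subset_antisym subsetI)
    fix m assume "m \<in> {m\<in>{1..n}. d dvd m}"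
    then obtain k where k: "m = d * k" "1 \<le> d * k" "d * k \<le> n" by auto
    from k have "d * k div d \<le> n div d" by (intro div_le_mono)
    with k show "m \<in> (\<lambda>k. d * k) ` {1..n div d}"
      using assms by (intro image_eqI[of _ _ k]) auto
  next
    fix m assume "m \<in> (\<lambda>k. d * k) ` {1..n div d}"
    then obtain k where k: "m = d * k" and k2: "k \<in> {1..n div d}" by blast
    have "d * k \<le> d * (n div d)" using k2 by simp
    also have "\<dots> \<le> n" by simp
    finally show "m \<in> {m\<in>{1..n}. d dvd m}" using k k2 assms by auto
  qed
  moreover have "inj_on (\<lambda>k. d * k) {1..n div d}" using assms by (auto simp: inj_on_def)
  ultimately show ?thesis by (simp add: card_image)
qed

text \<open>Both \<open>p\<close> and \<open>k\<close> range up to \<open>n\<close> rather than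
  \<open>m\<close>, so that a later sum over \<open>m\<close> can be interchanged with them. The
  range of \<open>k\<close> is long enough because \<open>p ^ k \<le> n\<close> implies
  \<open>k \<le> n\<close>.\<close>

lemma ln_eq_sum_prime_powers:
  assumes "m \<ge> 1" "m \<le> n"
  shows "ln (real m) = (\<Sum>p | prime p \<and> p \<le> n. \<Sum>k=1..n. if p ^ k dvd m then ln (real p) else 0)"
proof -
  have "real m = (\<Prod>p\<in>prime_factors m. real p ^ multiplicity p m)"
    using arg_cong[OF prime_factorization_nat[of m], of real] assms by simp
  then have "ln (real m) = ln (\<Prod>p\<in>prime_factors m. real p ^ multiplicity p m)" by simp
  also have "\<dots> = (\<Sum>p\<in>prime_factors m. ln (real p ^ multiplicity p m))"
    by (subst ln_prod) (auto simp: prime_gt_0_nat in_prime_factors_imp_prime)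
  also have "\<dots> = (\<Sum>p\<in>prime_factors m. real (multiplicity p m) * ln (real p))"
    by (intro sum.cong) (auto simp: ln_realpow prime_gt_0_nat in_prime_factors_imp_prime)
  also have "\<dots> = (\<Sum>p | prime p \<and> p \<le> n. real (multiplicity p m) * ln (real p))"
  proof (intro sum.mono_neutral_left)
    show "prime_factors m \<subseteq> {p. prime p \<and> p \<le> n}"
      using assms by (auto simp: prime_factors_dvd dest!: dvd_imp_le)
    show "\<forall>i\<in>{p. prime p \<and> p \<le> n} - prime_factors m. real (multiplicity i m) * ln (real i) = 0"
      using assms by (auto simp: prime_factors_multiplicity)
  qed auto
  also have "\<dots> = (\<Sum>p | prime p \<and> p \<le> n. \<Sum>k=1..n. if p ^ k dvd m then ln (real p) else 0)"
  proof (intro sum.cong refl)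
    fix p assume p: "p \<in> {p. prime p \<and> p \<le> n}"
    have "p ^ multiplicity p m dvd m" by (rule multiplicity_dvd)
    then have "p ^ multiplicity p m \<le> n" using assms by (auto dest!: dvd_imp_le)
    moreover have "multiplicity p m < p ^ multiplicity p m"
      using p by (intro less_exp[THEN order_less_le_trans] power_mono) (auto dest: prime_ge_2_nat)
    ultimately have le: "multiplicity p m \<le> n" by simp
    have "{k\<in>{1..n}. p ^ k dvd m} = {1..multiplicity p m}"
      using le p assms by (subst power_dvd_iff_le_multiplicity) (auto dest: not_prime_unit)
    then show "real (multiplicity p m) * ln (real p) = (\<Sum>k=1..n. if p ^ k dvd m then ln (real p) else 0)"
      using sum.inter_filter[of "{1..n}" "\<lambda>_. ln (real p)" "\<lambda>k. p ^ k dvd m"] by simp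
  qed
  finally show ?thesis .
qed

text \<open>Legendre's formula in logarithmic form, from which both Mertens bounds are read
  off.\<close>

lemma ln_fact_eq_sum_primes:
  "ln (fact n :: real) = (\<Sum>p | prime p \<and> p \<le> n. \<Sum>k=1..n. real (n div p ^ k) * ln (real p))"
proof -
  have "ln (fact n :: real) = ln (\<Prod>m\<in>{1..n}. real m)" by (simp add: fact_prod)
  also have "\<dots> = (\<Sum>m=1..n. ln (real m))" by (rule ln_prod) auto
  also have "\<dots> = (\<Sum>m=1..n. \<Sum>p | prime p \<and> p \<le> n. \<Sum>k=1..n. if p ^ k dvd m then ln (real p) else 0)"
    by (intro sum.cong refl ln_eq_sum_prime_powers) auto
  also have "\<dots> = (\<Sum>p | prime p \<and> p \<le> n. \<Sum>m=1..n. \<Sum>k=1..n. if p ^ k dvd m then ln (real p) else 0)"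
    by (rule sum.swap)
  also have "\<dots> = (\<Sum>p | prime p \<and> p \<le> n. \<Sum>k=1..n. \<Sum>m=1..n. if p ^ k dvd m then ln (real p) else 0)"
    by (rule sum.cong[OF refl], rule sum.swap)
  also have "\<dots> = (\<Sum>p | prime p \<and> p \<le> n. \<Sum>k=1..n. real (n div p ^ k) * ln (real p))"
  proof (intro sum.cong refl)
    fix p k assume p: "p \<in> {p. prime p \<and> p \<le> n}"
    then have "p ^ k \<ge> 1" by (auto simp: prime_gt_0_nat Suc_le_eq)
    then have "card {m\<in>{1..n}. p ^ k dvd m} = n div p ^ k" by (rule card_multiples_le)
    then show "(\<Sum>m=1..n. if p ^ k dvd m then ln (real p) else 0) = real (n div p ^ k) * ln (real p)"
      using sum.inter_filter[of "{1..n}" "\<lambda>_. ln (real p)" "\<lambda>m. p ^ k dvd m"] by simp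
  qed
  finally show ?thesis .
qed

text \<open>Only the terms with \<open>k = 1\<close> of Legendre's formula are kept. Removing the
  floors costs the sum of \<open>ln p\<close> over \<open>p \<le> n\<close>, and Chebyshev's bound
  for it is the 4.\<close>

lemma mertens_upper:
  assumes "n \<ge> 1"
  shows "(\<Sum>p | prime p \<and> p \<le> n. ln (real p) / real p) \<le> ln (real n) + 4"
proof -
  have "real n * (\<Sum>p | prime p \<and> p \<le> n. ln (real p) / real p) - (\<Sum>p | prime p \<and> p \<le> n. ln (real p))
     = (\<Sum>p | prime p \<and> p \<le> n. (real n / real p - 1) * ln (real p))"
    unfolding sum_distrib_left sum_subtractf[symmetric] by (intro sum.cong refl) (simp add: left_diff_distrib)
  also have "\<dots> \<le> (\<Sum>p | prime p \<and> p \<le> n. real (n div p ^ 1) * ln (real p))"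
  proof (intro sum_mono mult_right_mono)
    fix p assume p: "p \<in> {p. prime p \<and> p \<le> n}"
    show "real n / real p - 1 \<le> real (n div p ^ 1)"
      using floor_divide_of_nat_eq[of n p, where ?'a=real] by simp linarith
    show "ln (real p) \<ge> 0" using p by (auto intro!: ln_ge_zero simp: prime_gt_0_nat Suc_le_eq)
  qed
  also have "\<dots> \<le> (\<Sum>p | prime p \<and> p \<le> n. \<Sum>k=1..n. real (n div p ^ k) * ln (real p))"
  proof (intro sum_mono)
    fix p assume p: "p \<in> {p. prime p \<and> p \<le> n}"
    show "real (n div p ^ 1) * ln (real p) \<le> (\<Sum>k=1..n. real (n div p ^ k) * ln (real p))"
      using assms p by (intro member_le_sum) (auto intro!: ln_ge_zero simp: prime_gt_0_nat Suc_le_eq)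
  qed
  also have "\<dots> = ln (fact n)" by (rule ln_fact_eq_sum_primes[symmetric])
  also have "\<dots> \<le> ln (real n ^ n)"
    using fact_le_power[of n, where 'a=real] assms by (subst ln_le_cancel_iff) auto
  also have "\<dots> = real n * ln (real n)" using assms by (simp add: ln_realpow)
  finally have "real n * (\<Sum>p | prime p \<and> p \<le> n. ln (real p) / real p) \<le> real n * (ln (real n) + 4)"
    using theta_le[of n] by (simp add: algebra_simps)
  then show ?thesis using assms by simp
qed

lemma sum_ln_over_square_primes_bounded:
  obtains C where "C \<ge> 0" "\<And>n. (\<Sum>p | prime p \<and> p \<le> n. ln (real p) / (real p)\<^sup>2) \<le> C"
proof
  let ?g = "\<lambda>k::nat. 2 * real k powr (-3/2)"
  have s: "summable ?g" by (intro summable_mult) (simp add: summable_real_powr_iff)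
  show "suminf ?g \<ge> 0" using s by (intro suminf_nonneg) auto
  fix n :: nat
  have "(\<Sum>p | prime p \<and> p \<le> n. ln (real p) / (real p)\<^sup>2) \<le> (\<Sum>p | prime p \<and> p \<le> n. ?g p)"
  proof (intro sum_mono)
    fix p assume "p \<in> {p. prime p \<and> p \<le> n}"
    then have p: "real p > 0" by (auto simp: prime_gt_0_nat)
    have "ln (real p) / (real p)\<^sup>2 \<le> 2 * sqrt (real p) / (real p)\<^sup>2"
      using p by (intro divide_right_mono ln_le_two_sqrt) auto
    also have "\<dots> = 2 * (real p powr (1/2) / real p powr 2)"
      using p by (simp add: powr_half_sqrt)
    also have "\<dots> = ?g p" by (subst powr_diff[symmetric]) simp
    finally show "ln (real p) / (real p)\<^sup>2 \<le> ?g p" .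
  qed
  also have "\<dots> \<le> suminf ?g" using s by (intro sum_le_suminf) auto
  finally show "(\<Sum>p | prime p \<and> p \<le> n. ln (real p) / (real p)\<^sup>2) \<le> suminf ?g" .
qed

lemma sum_inverse_powers_le:
  assumes "p \<ge> (2::real)"
  shows "(\<Sum>k=1..n. 1 / p ^ k) \<le> 1 / p + 2 / p\<^sup>2"
proof -
  have "(p - 1) * (\<Sum>k=1..n. 1 / p ^ k) = 1 - 1 / p ^ n"
  proof (induction n)
    case (Suc n)
    have "(p - 1) * (1 / p ^ Suc n) = 1 / p ^ n - 1 / p ^ Suc n"
      using assms by (simp add: field_simps)
    then show ?case using Suc by (simp add: distrib_left)
  qed simp
  then have "(\<Sum>k=1..n. 1 / p ^ k) = (1 - 1 / p ^ n) / (p - 1)"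
    using assms by (simp add: field_simps)
  also have "\<dots> \<le> 1 / (p - 1)" using assms by (intro divide_right_mono) auto
  also have "\<dots> \<le> 1 / p + 2 / p\<^sup>2"
  proof -
    have "1 / p + 2 / p\<^sup>2 - 1 / (p - 1) = (p - 2) / (p\<^sup>2 * (p - 1))"
      using assms by (simp add: divide_simps) (simp add: algebra_simps power2_eq_square)
    also have "\<dots> \<ge> 0" using assms by auto
    finally show ?thesis by simp
  qed
  finally show ?thesis .
qed

text \<open>Now the floors are simply dropped, and the prime powers beyond the first contribute at
  most twice the bounded sum of \<open>ln p / p ^ 2\<close>.\<close>

lemma mertens_lower:
  obtains C where "C \<ge> 0"
    "\<And>n. n \<ge> 1 \<Longrightarrow> (\<Sum>p | prime p \<and> p \<le> n. ln (real p) / real p) \<ge> ln (real n) - C"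
proof -
  obtain C where C: "C \<ge> 0" "\<And>n. (\<Sum>p | prime p \<and> p \<le> n. ln (real p) / (real p)\<^sup>2) \<le> C"
    using sum_ln_over_square_primes_bounded by blast
  show ?thesis
  proof (rule that[of "1 + 2 * C"])
    fix n :: nat assume n: "n \<ge> 1"
    have "real n * (ln (real n) - 1) = ln ((real n / exp 1) ^ n)"
      using n by (simp add: ln_realpow ln_div)
    also have "\<dots> \<le> ln (fact n)"
      using fact_ge_power[of n] n by (subst ln_le_cancel_iff) auto
    also have "\<dots> = (\<Sum>p | prime p \<and> p \<le> n. \<Sum>k=1..n. real (n div p ^ k) * ln (real p))"
      by (rule ln_fact_eq_sum_primes)
    also have "\<dots> \<le> (\<Sum>p | prime p \<and> p \<le> n. \<Sum>k=1..n. (real n * (1 / real p ^ k)) * ln (real p))"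
    proof (intro sum_mono mult_right_mono)
      fix p k assume p: "p \<in> {p. prime p \<and> p \<le> n}"
      show "real (n div p ^ k) \<le> real n * (1 / real p ^ k)"
        using of_nat_div_le_of_nat[where ?'a=real, of n "p^k"] by simp
      show "ln (real p) \<ge> 0" using p by (auto intro!: ln_ge_zero simp: prime_gt_0_nat Suc_le_eq)
    qed
    also have "\<dots> = (\<Sum>p | prime p \<and> p \<le> n. real n * ln (real p) * (\<Sum>k=1..n. 1 / real p ^ k))"
      unfolding sum_distrib_left by (intro sum.cong refl) simp
    also have "\<dots> \<le> (\<Sum>p | prime p \<and> p \<le> n. real n * ln (real p) * (1 / real p + 2 / (real p)\<^sup>2))"
    proof (intro sum_mono mult_left_mono sum_inverse_powers_le)
      fix p assume p: "p \<in> {p. prime p \<and> p \<le> n}"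
      then show "2 \<le> real p" by (auto dest: prime_ge_2_nat)
      show "real n * ln (real p) \<ge> 0"
        using p by (auto intro!: ln_ge_zero mult_nonneg_nonneg simp: prime_gt_0_nat Suc_le_eq)
    qed
    also have "\<dots> = real n * ((\<Sum>p | prime p \<and> p \<le> n. ln (real p) / real p) +
        2 * (\<Sum>p | prime p \<and> p \<le> n. ln (real p) / (real p)\<^sup>2))"
      unfolding sum_distrib_left sum.distrib[symmetric] by (intro sum.cong refl) (simp add: distrib_left)
    finally have "ln (real n) - 1 \<le> (\<Sum>p | prime p \<and> p \<le> n. ln (real p) / real p) +
        2 * (\<Sum>p | prime p \<and> p \<le> n. ln (real p) / (real p)\<^sup>2)"
      using n by simp
    then show "(\<Sum>p | prime p \<and> p \<le> n. ln (real p) / real p) \<ge> ln (real n) - (1 + 2 * C)"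
      using C(2)[of n] by linarith
  qed (use C in auto)
qed

text \<open>The Mertens bounds at \<open>n\<close> and at \<open>A * n\<close> have errors 4 and
  \<open>C\<close>, so a ratio \<open>A\<close> with \<open>ln A \<ge> C + 5\<close> leaves mass 1
  in between. These windows supply the primes for the matchings.\<close>

lemma mertens_window:
  obtains A :: nat where "A \<ge> 3"
    "\<And>n. n \<ge> 1 \<Longrightarrow> (\<Sum>p | prime p \<and> n < p \<and> p \<le> A * n. ln (real p) / real p) \<ge> 1"
proof -
  obtain C where C: "C \<ge> 0"
    "\<And>n. n \<ge> 1 \<Longrightarrow> (\<Sum>p | prime p \<and> p \<le> n. ln (real p) / real p) \<ge> ln (real n) - C"
    using mertens_lower by blast
  obtain A :: nat where A: "real A \<ge> exp (C + 5)" using real_arch_simple by blast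
  have "exp (C + 5) \<ge> 1 + (C + 5)" by (rule exp_ge_add_one_self)
  then have A3: "A \<ge> 3" using A C(1) by linarith
  show ?thesis
  proof (rule that[OF A3])
    fix n :: nat assume n: "n \<ge> 1"
    have "ln (real A) \<ge> ln (exp (C + 5))" using A A3 by (subst ln_le_cancel_iff) auto
    then have "ln (real A) \<ge> C + 5" by simp
    moreover have "ln (real (A * n)) = ln (real A) + ln (real n)" using A3 n by (simp add: ln_mult)
    moreover have "n \<le> A * n" "A * n \<ge> 1" using A3 n by auto
    ultimately show "(\<Sum>p | prime p \<and> n < p \<and> p \<le> A * n. ln (real p) / real p) \<ge> 1"
      using sum_primes_split[of n "A * n" "\<lambda>p. ln (real p) / real p"] mertens_upper[OF n] C(2)[of "A*n"]
      by linarith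
  qed
qed

section \<open>The Turan-Kubilius inequality\<close>

text \<open>The cutoff is real so that passing from \<open>x\<close> to \<open>x / p\<close>
  involves no rounding.\<close>

definition nats_upto :: "real \<Rightarrow> nat set" where
  "nats_upto x = {1..nat \<lfloor>x\<rfloor>}"

lemma in_nats_upto [simp]: "n \<in> nats_upto x \<longleftrightarrow> 1 \<le> n \<and> real n \<le> x"
  by (auto simp: nats_upto_def le_nat_floor) linarith

lemma finite_nats_upto [simp]: "finite (nats_upto x)"
  by (simp add: nats_upto_def)

lemma card_nats_upto_le: "x \<ge> 0 \<Longrightarrow> real (card (nats_upto x)) \<le> x"
  by (simp add: nats_upto_def)

lemma bij_betw_multiples_upto:
  assumes "d \<ge> (1::nat)"
  shows "bij_betw (\<lambda>m. d * m) (nats_upto (x / real d)) {n\<in>nats_upto x. d dvd n}"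
  unfolding bij_betw_def
proof
  show "inj_on (\<lambda>m. d * m) (nats_upto (x / real d))" using assms by (auto simp: inj_on_def)
  show "(\<lambda>m. d * m) ` nats_upto (x / real d) = {n\<in>nats_upto x. d dvd n}"
  proof (intro subset_antisym subsetI)
    fix n assume "n \<in> (\<lambda>m. d * m) ` nats_upto (x / real d)"
    then obtain m where "m \<in> nats_upto (x / real d)" "n = d * m" by blast
    with assms show "n \<in> {n\<in>nats_upto x. d dvd n}" by (simp add: field_simps)
  next
    fix n assume n: "n \<in> {n\<in>nats_upto x. d dvd n}"
    then obtain m where m: "n = d * m" by blast
    with n assms have "m \<in> nats_upto (x / real d)" by (auto simp: field_simps)
    with m show "n \<in> (\<lambda>m. d * m) ` nats_upto (x / real d)" by blast
  qed
qed

lemma card_multiples_upto_bounds: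
  assumes "d \<ge> (1::nat)" "x \<ge> 0"
  shows "real (card {n\<in>nats_upto x. d dvd n}) \<le> x / real d"
    and "real (card {n\<in>nats_upto x. d dvd n}) \<ge> x / real d - 1"
proof -
  have "card {n\<in>nats_upto x. d dvd n} = nat \<lfloor>x / real d\<rfloor>"
    using bij_betw_same_card[OF bij_betw_multiples_upto[OF assms(1), of x]] by (simp add: nats_upto_def)
  moreover have "x / real d \<ge> 0" using assms by simp
  ultimately show "real (card {n\<in>nats_upto x. d dvd n}) \<le> x / real d"
    and "real (card {n\<in>nats_upto x. d dvd n}) \<ge> x / real d - 1"
    by linarith+
qed

text \<open>As a random variable of \<open>n\<close>, \<open>a n\<close> has mean about 1.
  Divisibility by distinct primes is nearly independent, so the second moment exceeds 1 only through
  the diagonal \<open>p = q\<close>, up to a rounding error that does not grow with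
  \<open>x\<close>.\<close>

lemma turan_kubilius_variance:
  fixes w :: "nat \<Rightarrow> real"
  assumes "finite P" "\<And>p. p \<in> P \<Longrightarrow> prime p" "\<And>p. p \<in> P \<Longrightarrow> w p \<ge> 0" "(\<Sum>p\<in>P. w p) = 1" "x \<ge> 0"
  defines "a \<equiv> \<lambda>n. \<Sum>p\<in>P. if p dvd n then w p * real p else 0"
  shows "(\<Sum>n\<in>nats_upto x. (1 - a n)\<^sup>2) \<le> x * (\<Sum>p\<in>P. (w p)\<^sup>2 * real p) + 2 * (\<Sum>p\<in>P. w p * real p)"
proof -
  let ?c = "\<lambda>d. real (card {n\<in>nats_upto x. d dvd n})"
  have cnt: "(\<Sum>n\<in>nats_upto x. if d dvd n then c else 0) = c * ?c d" for d and c :: real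
    by (simp flip: sum.inter_filter)
  have 1: "(\<Sum>n\<in>nats_upto x. a n) \<ge> x - (\<Sum>p\<in>P. w p * real p)"
  proof -
    have "(\<Sum>n\<in>nats_upto x. a n) = (\<Sum>p\<in>P. w p * real p * ?c p)"
      unfolding a_def by (subst sum.swap) (simp add: cnt)
    also have "\<dots> \<ge> (\<Sum>p\<in>P. w p * real p * (x / real p - 1))"
      using assms by (intro sum_mono mult_left_mono card_multiples_upto_bounds mult_nonneg_nonneg)
        (auto simp: prime_gt_0_nat Suc_le_eq)
    also have "(\<Sum>p\<in>P. w p * real p * (x / real p - 1)) = (\<Sum>p\<in>P. x * w p - w p * real p)"
      using assms(2) by (intro sum.cong refl) (auto simp: field_simps dest: prime_gt_0_nat)
    also have "\<dots> = x - (\<Sum>p\<in>P. w p * real p)"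
      using assms(4) by (simp add: sum_subtractf flip: sum_distrib_left)
    finally show ?thesis .
  qed
  have 2: "(\<Sum>n\<in>nats_upto x. (a n)\<^sup>2) \<le> x + x * (\<Sum>p\<in>P. (w p)\<^sup>2 * real p)"
  proof -
    have "(a n)\<^sup>2 = (\<Sum>p\<in>P. \<Sum>q\<in>P. if lcm p q dvd n then w p * real p * (w q * real q) else 0)" for n
      unfolding a_def power2_eq_square sum_product by (intro sum.cong refl) auto
    then have "(\<Sum>n\<in>nats_upto x. (a n)\<^sup>2) =
        (\<Sum>n\<in>nats_upto x. \<Sum>p\<in>P. \<Sum>q\<in>P. if lcm p q dvd n then w p * real p * (w q * real q) else 0)"
      by simp
    also have "\<dots> = (\<Sum>p\<in>P. \<Sum>n\<in>nats_upto x. \<Sum>q\<in>P. if lcm p q dvd n then w p * real p * (w q * real q) else 0)"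
      by (rule sum.swap)
    also have "\<dots> = (\<Sum>p\<in>P. \<Sum>q\<in>P. \<Sum>n\<in>nats_upto x. if lcm p q dvd n then w p * real p * (w q * real q) else 0)"
      by (rule sum.cong[OF refl], rule sum.swap)
    also have "\<dots> = (\<Sum>p\<in>P. \<Sum>q\<in>P. w p * real p * (w q * real q) * ?c (lcm p q))"
      by (simp only: cnt)
    also have "\<dots> \<le> (\<Sum>p\<in>P. \<Sum>q\<in>P. w p * w q * x + (if p = q then x * ((w p)\<^sup>2 * real p) else 0))"
    proof (intro sum_mono)
      fix p q assume pq: "p \<in> P" "q \<in> P"
      have pos: "p > 0" "q > 0" using pq assms(2) by (auto simp: prime_gt_0_nat)
      have w: "w p \<ge> 0" "w q \<ge> 0" using pq assms by auto
      have "lcm p q \<ge> 1" using pos by (simp add: lcm_pos_nat Suc_le_eq)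
      then have "w p * real p * (w q * real q) * ?c (lcm p q) \<le> w p * real p * (w q * real q) * (x / real (lcm p q))"
        using w assms(5) by (intro mult_left_mono card_multiples_upto_bounds) auto
      also have "\<dots> \<le> w p * w q * x + (if p = q then x * ((w p)\<^sup>2 * real p) else 0)"
      proof (cases "p = q")
        case True
        have "w p * real p * (w q * real q) * (x / real (lcm p q)) = x * ((w p)\<^sup>2 * real p)"
          using pos True by (simp add: power2_eq_square)
        then show ?thesis using True w assms(5) by simp
      next
        case False
        then have "coprime p q" using pq assms(2) primes_coprime by blast
        then have "lcm p q = p * q" by (simp add: lcm_coprime)
        then show ?thesis using False pos by simp
      qed
      finally show "w p * real p * (w q * real q) * ?c (lcm p q) \<le> w p * w q * x + (if p = q then x * ((w p)\<^sup>2 * real p) else 0)" .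
    qed
    also have "\<dots> = (\<Sum>p\<in>P. w p * x) * (\<Sum>q\<in>P. w q) + (\<Sum>p\<in>P. x * ((w p)\<^sup>2 * real p))"
      unfolding sum_product using assms(1) by (simp add: sum.distrib mult_ac)
    also have "\<dots> = x + x * (\<Sum>p\<in>P. (w p)\<^sup>2 * real p)"
      using assms(4) by (simp add: sum_distrib_left flip: sum_distrib_right)
    finally show ?thesis .
  qed
  have "(\<Sum>n\<in>nats_upto x. (1 - a n)\<^sup>2) = (\<Sum>n\<in>nats_upto x. 1 - 2 * a n + (a n)\<^sup>2)"
    by (intro sum.cong refl) (simp add: power2_eq_square algebra_simps)
  also have "\<dots> = real (card (nats_upto x)) - 2 * (\<Sum>n\<in>nats_upto x. a n) + (\<Sum>n\<in>nats_upto x. (a n)\<^sup>2)"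
    by (simp add: sum.distrib sum_subtractf sum_distrib_left)
  finally show ?thesis using 1 2 card_nats_upto_le[OF assms(5)] by linarith
qed

text \<open>Cauchy-Schwarz against the variance of \<open>a\<close>. The threshold for
  \<open>x\<close> is fixed before \<open>f\<close>, and every uniformity claimed later descends
  from this order of quantifiers.\<close>

lemma turan_kubilius:
  fixes w :: "nat \<Rightarrow> real"
  assumes "finite P" "\<And>p. p \<in> P \<Longrightarrow> prime p" "\<And>p. p \<in> P \<Longrightarrow> w p \<ge> 0" "(\<Sum>p\<in>P. w p) = 1"
    and V: "(\<Sum>p\<in>P. (w p)\<^sup>2 * real p) < \<eta>\<^sup>2" and "\<eta> > 0"
  shows "\<forall>\<^sub>F x in at_top. \<forall>f. (\<forall>n. \<bar>f n\<bar> \<le> 1) \<longrightarrow>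
    \<bar>(\<Sum>n\<in>nats_upto x. f n) - (\<Sum>p\<in>P. w p * real p * (\<Sum>m\<in>nats_upto (x / real p). f (p * m)))\<bar> \<le> \<eta> * x"
proof -
  define V where "V = (\<Sum>p\<in>P. (w p)\<^sup>2 * real p)"
  define E where "E = 2 * (\<Sum>p\<in>P. w p * real p)"
  \<comment> \<open>From here on the rounding error \<open>E\<close> fits into the gap between
    \<open>V\<close> and the square of \<open>\<eta>\<close>.\<close>
  have "\<forall>\<^sub>F x in at_top. x \<ge> max 0 (E / (\<eta>\<^sup>2 - V))" by (rule eventually_ge_at_top)
  then show ?thesis
  proof eventually_elim
    case (elim x)
    then have x: "x \<ge> 0" "E \<le> x * (\<eta>\<^sup>2 - V)" using V by (auto simp: V_def field_simps)
    define a where "a = (\<lambda>n. \<Sum>p\<in>P. if p dvd n then w p * real p else 0)"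
    have var: "(\<Sum>n\<in>nats_upto x. (1 - a n)\<^sup>2) \<le> \<eta>\<^sup>2 * x"
      using turan_kubilius_variance[OF assms(1-4) x(1)] x(2)
      by (simp add: V_def E_def a_def algebra_simps)
    show ?case
    proof (intro allI impI)
      fix f :: "nat \<Rightarrow> real" assume f: "\<forall>n. \<bar>f n\<bar> \<le> 1"
      have "(\<Sum>p\<in>P. w p * real p * (\<Sum>m\<in>nats_upto (x / real p). f (p * m))) =
          (\<Sum>p\<in>P. \<Sum>n\<in>nats_upto x. if p dvd n then w p * real p * f n else 0)"
      proof (intro sum.cong refl)
        fix p assume "p \<in> P"
        then have "p \<ge> 1" using assms(2) by (auto simp: prime_gt_0_nat Suc_le_eq)
        from sum.reindex_bij_betw[OF bij_betw_multiples_upto[OF this, of x], of f]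
        show "w p * real p * (\<Sum>m\<in>nats_upto (x / real p). f (p * m)) =
            (\<Sum>n\<in>nats_upto x. if p dvd n then w p * real p * f n else 0)"
          by (simp add: sum_distrib_left flip: sum.inter_filter)
      qed
      also have "\<dots> = (\<Sum>n\<in>nats_upto x. f n * a n)"
        unfolding a_def sum_distrib_left by (subst sum.swap) (auto intro!: sum.cong)
      finally have "(\<Sum>n\<in>nats_upto x. f n) - (\<Sum>p\<in>P. w p * real p * (\<Sum>m\<in>nats_upto (x / real p). f (p * m)))
         = (\<Sum>n\<in>nats_upto x. f n * (1 - a n))"
        by (simp add: right_diff_distrib sum_subtractf)
      moreover have "\<bar>\<Sum>n\<in>nats_upto x. f n * (1 - a n)\<bar> \<le> \<eta> * x"
      proof (rule power2_le_imp_le)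
        have "\<bar>\<Sum>n\<in>nats_upto x. f n * (1 - a n)\<bar>\<^sup>2 \<le> (\<Sum>n\<in>nats_upto x. (f n)\<^sup>2) * (\<Sum>n\<in>nats_upto x. (1 - a n)\<^sup>2)"
          using Cauchy_Schwarz_ineq_sum[of f "\<lambda>n. 1 - a n" "nats_upto x"] by simp
        also have "\<dots> \<le> x * (\<eta>\<^sup>2 * x)"
        proof (intro mult_mono var)
          have "(\<Sum>n\<in>nats_upto x. (f n)\<^sup>2) \<le> (\<Sum>n\<in>nats_upto x. 1)"
            using f by (intro sum_mono) (simp add: abs_square_le_1)
          then show "(\<Sum>n\<in>nats_upto x. (f n)\<^sup>2) \<le> x" using card_nats_upto_le[OF x(1)] by simp
        qed (use x in \<open>auto intro: sum_nonneg\<close>)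
        finally show "\<bar>\<Sum>n\<in>nats_upto x. f n * (1 - a n)\<bar>\<^sup>2 \<le> (\<eta> * x)\<^sup>2"
          by (simp add: power2_eq_square algebra_simps)
      qed (use x assms in auto)
      ultimately show "\<bar>(\<Sum>n\<in>nats_upto x. f n) - (\<Sum>p\<in>P. w p * real p * (\<Sum>m\<in>nats_upto (x / real p). f (p * m)))\<bar> \<le> \<eta> * x"
        by simp
    qed
  qed
qed

section \<open>Matchings of nearby primes\<close>

text \<open>Congruence makes a pair act alike on residue classes, and injectivity of both
  projections lets one family of weights serve for the \<open>p\<close> and for the
  \<open>q\<close>. The lower bound \<open>\<delta>\<close> is the gain of each induction step
  below; without it \<open>p = q\<close> would be allowed and nothing would be gained.\<close>

definition prime_matching :: "nat \<Rightarrow> real \<Rightarrow> real \<Rightarrow> (nat \<times> nat) set \<Rightarrow> bool" where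
  "prime_matching K \<delta> \<epsilon> M \<longleftrightarrow> finite M \<and> inj_on fst M \<and> inj_on snd M \<and>
     (\<forall>(p, q)\<in>M. prime p \<and> prime q \<and> coprime p K \<and> coprime q K \<and> [p = q] (mod K) \<and>
       \<delta> \<le> ln (real q) - ln (real p) \<and> ln (real q) - ln (real p) \<le> \<epsilon>)"

lemma ln_over_self_antimono:
  assumes "3 \<le> x" "x \<le> (y::real)"
  shows "ln y / y \<le> ln x / x"
proof -
  have "ln (y / x) \<le> y / x - 1" using assms by (intro ln_le_minus_one) auto
  then have "x * (ln y - ln x) \<le> y - x" using assms by (simp add: ln_div field_simps)
  moreover have "ln x \<ge> 1" using assms exp_le by (subst ln_ge_iff) linarith+
  then have "y - x \<le> ln x * (y - x)" using assms by (intro mult_right_mono[of 1 "ln x" "y - x", simplified]) auto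
  ultimately show ?thesis using assms by (simp add: field_simps)
qed

text \<open>Maximality under inclusion suffices: the unmatched elements are then pairwise unrelated.
  The same element may be a first component of one pair and a second component of another.\<close>

lemma maximal_matching:
  fixes R :: "'v \<Rightarrow> 'v \<Rightarrow> bool"
  assumes "finite W"
  obtains M where "M \<subseteq> W \<times> W" "inj_on fst M" "inj_on snd M" "\<And>x y. (x, y) \<in> M \<Longrightarrow> R x y"
    "\<And>x y. x \<in> W - (fst ` M \<union> snd ` M) \<Longrightarrow> y \<in> W - (fst ` M \<union> snd ` M) \<Longrightarrow> \<not> R x y"
proof -
  define \<M> where "\<M> = {M. M \<subseteq> W \<times> W \<and> inj_on fst M \<and> inj_on snd M \<and> (\<forall>(x, y)\<in>M. R x y)}"
  have "finite \<M>" by (rule finite_subset[of _ "Pow (W \<times> W)"]) (use assms in \<open>auto simp: \<M>_def\<close>)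
  moreover have "{} \<in> \<M>" by (auto simp: \<M>_def)
  ultimately obtain M where M: "M \<in> \<M>" "\<And>M'. M' \<in> \<M> \<Longrightarrow> M \<subseteq> M' \<Longrightarrow> M = M'"
    using finite_has_maximal[of \<M>] by blast
  show thesis
  proof (rule that[of M])
    fix x y assume xy: "x \<in> W - (fst ` M \<union> snd ` M)" "y \<in> W - (fst ` M \<union> snd ` M)"
    show "\<not> R x y"
    proof
      assume "R x y"
      moreover have "x \<notin> fst ` M" "y \<notin> snd ` M" "x \<in> W" "y \<in> W" using xy by auto
      ultimately have "insert (x, y) M \<in> \<M>"
        using M(1) unfolding \<M>_def by (simp add: image_iff)
      then have "M = insert (x, y) M" using M(2)[of "insert (x, y) M"] by blast
      then have "(x, y) \<in> M" by blast
      then have "x \<in> fst ` M" by (rule rev_image_eqI) simp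
      then show False using \<open>x \<notin> fst ` M\<close> by contradiction
    qed
  qed (use M(1) in \<open>auto simp: \<M>_def\<close>)
qed

text \<open>Within one residue class and one cell of logarithmic length \<open>\<epsilon>\<close>, the primes left unmatched
  all lie within a logarithmic interval of length \<open>\<delta>\<close>, and hence carry little weight.\<close>

lemma prime_matching_window:
  fixes A n K :: nat
  assumes "A \<ge> 3" "n \<ge> 3" "K \<ge> 1" "n \<ge> K" "\<epsilon> > 0" "\<rho> > 0" and \<delta>: "\<delta> > 0"
    and mass: "(\<Sum>p | prime p \<and> n < p \<and> p \<le> A * n. ln (real p) / real p) \<ge> 1"
    and short: "\<And>z::nat. z \<ge> 1 \<Longrightarrow> (\<Sum>p | prime p \<and> z < p \<and> real p \<le> exp \<delta> * real z. ln (real p)) \<le> \<rho> * real z"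
    and \<rho>: "\<rho> * (real K * (2 * ln (real A) / \<epsilon> + 2)) \<le> 1 / 2"
    and n: "ln (real n) / real n \<le> \<rho>"
  obtains M where "prime_matching K \<delta> \<epsilon> M" "\<And>p q. (p, q) \<in> M \<Longrightarrow> n < p \<and> p \<le> A * n \<and> n < q \<and> q \<le> A * n"
    "(\<Sum>(p, q)\<in>M. 1 / real p) \<ge> 1 / (4 * ln (real (A * n)))"
proof -
  define W where "W = {p. prime p \<and> n < p \<and> p \<le> A * n}"
  have finW: "finite W" unfolding W_def by simp
  define R where "R = (\<lambda>p q::nat. [p = q] (mod K) \<and> \<delta> \<le> ln (real q) - ln (real p) \<and> ln (real q) - ln (real p) \<le> \<epsilon>)"
  obtain M where M: "M \<subseteq> W \<times> W" "inj_on fst M" "inj_on snd M" "\<And>x y. (x, y) \<in> M \<Longrightarrow> R x y"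
    "\<And>x y. x \<in> W - (fst ` M \<union> snd ` M) \<Longrightarrow> y \<in> W - (fst ` M \<union> snd ` M) \<Longrightarrow> \<not> R x y"
    by (rule maximal_matching[OF finW, of R]) blast
  have finM: "finite M" using M(1) finW finite_subset by blast
  define Z where "Z = W - (fst ` M \<union> snd ` M)"
  define \<mu> where "\<mu> = (\<lambda>p. ln (real p) / real p)"
  define cell where "cell = (\<lambda>p::nat. nat \<lfloor>(ln (real p) - ln (real n)) / \<epsilon>\<rfloor>)"
  define L where "L = nat \<lfloor>ln (real A) / \<epsilon>\<rfloor> + 1"
  have \<mu>_nonneg: "\<mu> p \<ge> 0" for p by (cases "p = 0") (auto simp: \<mu>_def)
  have lnA: "ln (real A) > 0" using assms by simp
  have cell_less: "cell p < L" if "p \<in> W" for p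
  proof -
    have "real p \<le> real A * real n" using that by (simp add: W_def flip: of_nat_mult)
    then have "ln (real p) \<le> ln (real A * real n)" using that assms by (subst ln_le_cancel_iff) (auto simp: W_def)
    then have "ln (real p) - ln (real n) \<le> ln (real A)" using assms by (simp add: ln_mult)
    then have "(ln (real p) - ln (real n)) / \<epsilon> \<le> ln (real A) / \<epsilon>" using assms by (intro divide_right_mono) auto
    then have "\<lfloor>(ln (real p) - ln (real n)) / \<epsilon>\<rfloor> \<le> \<lfloor>ln (real A) / \<epsilon>\<rfloor>" by (rule floor_mono)
    then show ?thesis by (auto simp: cell_def L_def)
  qed
  have cell_mass: "(\<Sum>p | p \<in> Z \<and> cell p = i \<and> p mod K = c. \<mu> p) \<le> 2 * \<rho>" for i c
  proof (cases "{p. p \<in> Z \<and> cell p = i \<and> p mod K = c} = {}")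
    case True
    then show ?thesis using assms by (simp only: sum.empty)
  next
    case False
    define Q where "Q = {p. p \<in> Z \<and> cell p = i \<and> p mod K = c}"
    have Q: "finite Q" "Q \<noteq> {}" using finW False by (auto simp: Q_def Z_def)
    \<comment> \<open>The least unmatched prime of the cell accounts for one \<open>\<rho>\<close>,
      the primes shortly above it for the other.\<close>
    define z where "z = Min Q"
    have zQ: "z \<in> Q" using Q by (simp add: z_def)
    then have zn: "z > n" "z \<in> Z" by (auto simp: Q_def Z_def W_def)
    have sub: "Q \<subseteq> insert z {p. prime p \<and> z < p \<and> real p \<le> exp \<delta> * real z}"
    proof
      fix p assume p: "p \<in> Q"
      show "p \<in> insert z {p. prime p \<and> z < p \<and> real p \<le> exp \<delta> * real z}"
      proof (cases "p = z")
        case False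
        then have pz: "z < p" using p Q by (simp add: z_def order.not_eq_order_implies_strict)
        have ge: "ln (real p) \<ge> ln (real n)" "ln (real z) \<ge> ln (real n)" using pz zn assms by auto
        have "\<lfloor>(ln (real p) - ln (real n)) / \<epsilon>\<rfloor> = \<lfloor>(ln (real z) - ln (real n)) / \<epsilon>\<rfloor>"
        proof -
          have "cell p = cell z" using p zQ by (simp add: Q_def)
          then show ?thesis using ge assms unfolding cell_def by (subst (asm) eq_nat_nat_iff) auto
        qed
        then have "(ln (real p) - ln (real n)) / \<epsilon> - (ln (real z) - ln (real n)) / \<epsilon> < 1" by linarith
        then have "ln (real p) - ln (real z) \<le> \<epsilon>" using assms by (simp add: field_simps)
        moreover have "[z = p] (mod K)" using p zQ by (simp add: Q_def cong_def)
        moreover have "\<not> R z p" using M(5)[of z p] p zn by (auto simp: Q_def Z_def)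
        ultimately have "ln (real p) < ln (real z) + \<delta>" by (auto simp: R_def)
        then have "exp (ln (real p)) \<le> exp (\<delta> + ln (real z))" by simp
        then have "real p \<le> exp \<delta> * real z" using pz zn by (simp add: exp_add)
        then show ?thesis using p pz by (simp add: Q_def Z_def W_def)
      qed simp
    qed
    have finS: "finite {p. prime p \<and> z < p \<and> real p \<le> exp \<delta> * real z}"
      by (rule finite_subset[of _ "{..nat \<lfloor>exp \<delta> * real z\<rfloor>}"]) (auto simp: le_nat_floor)
    have "sum \<mu> Q \<le> (\<Sum>p\<in>insert z {p. prime p \<and> z < p \<and> real p \<le> exp \<delta> * real z}. \<mu> p)"
      using sub finS \<mu>_nonneg by (intro sum_mono2) auto
    also have "\<dots> = \<mu> z + (\<Sum>p | prime p \<and> z < p \<and> real p \<le> exp \<delta> * real z. \<mu> p)"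
      using finS by simp
    also have "\<dots> \<le> \<rho> + (\<Sum>p | prime p \<and> z < p \<and> real p \<le> exp \<delta> * real z. ln (real p)) / real z"
    proof (intro add_mono)
      show "\<mu> z \<le> \<rho>" using ln_over_self_antimono[of "real n" "real z"] zn assms n by (simp add: \<mu>_def)
      show "(\<Sum>p | prime p \<and> z < p \<and> real p \<le> exp \<delta> * real z. \<mu> p) \<le>
          (\<Sum>p | prime p \<and> z < p \<and> real p \<le> exp \<delta> * real z. ln (real p)) / real z"
        unfolding sum_divide_distrib \<mu>_def using zn by (intro sum_mono divide_left_mono) auto
    qed
    also have "\<dots> \<le> \<rho> + \<rho> * real z / real z"
      using zn by (intro add_left_mono divide_right_mono short) auto
    also have "\<dots> = 2 * \<rho>" using zn by simp
    finally show ?thesis by (simp add: Q_def)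
  qed
  have "sum \<mu> Z = (\<Sum>(i, c)\<in>{..<L} \<times> {..<K}. \<Sum>p | p \<in> Z \<and> (cell p, p mod K) = (i, c). \<mu> p)"
  proof -
    have "(\<lambda>p. (cell p, p mod K)) ` Z \<subseteq> {..<L} \<times> {..<K}"
      using cell_less assms by (auto simp: Z_def)
    from sum.group[OF _ _ this, of \<mu>] show ?thesis using finW by (simp add: Z_def case_prod_unfold prod_eq_iff)
  qed
  also have "\<dots> \<le> (\<Sum>(i, c)\<in>{..<L} \<times> {..<K}. 2 * \<rho>)"
    using cell_mass by (intro sum_mono) auto
  also have "\<dots> = real L * real K * (2 * \<rho>)" by (simp add: case_prod_unfold)
  also have "real L \<le> ln (real A) / \<epsilon> + 1" using lnA assms by (simp add: L_def)
  then have "real L * real K * (2 * \<rho>) \<le> (ln (real A) / \<epsilon> + 1) * real K * (2 * \<rho>)"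
    using assms by (intro mult_right_mono) auto
  also have "\<dots> = \<rho> * (real K * (2 * ln (real A) / \<epsilon> + 2))" by (simp add: field_simps)
  finally have Z: "sum \<mu> Z \<le> 1 / 2" using \<rho> by linarith
  have "1 \<le> sum \<mu> W" using mass by (simp add: W_def \<mu>_def)
  also have "\<dots> \<le> sum \<mu> (fst ` M \<union> snd ` M \<union> Z)"
    using finW finM \<mu>_nonneg by (intro sum_mono2) (auto simp: Z_def)
  also have "\<dots> \<le> sum \<mu> (fst ` M) + sum \<mu> (snd ` M) + sum \<mu> Z"
    using finW finM \<mu>_nonneg sum_Un_nat sum.union_inter[of "fst ` M \<union> snd ` M" Z \<mu>] sum.union_inter[of "fst ` M" "snd ` M" \<mu>]
      sum_nonneg[of "(fst ` M \<union> snd ` M) \<inter> Z" \<mu>] sum_nonneg[of "fst ` M \<inter> snd ` M" \<mu>]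
    by (simp add: Z_def)
  \<comment> \<open>Second components are larger and \<open>ln t / t\<close> decreases from 3 on, so
    the first components carry at least half of the matched mass, that is 1/4.\<close>
  also have "sum \<mu> (snd ` M) \<le> sum \<mu> (fst ` M)"
  proof -
    have "sum \<mu> (snd ` M) = (\<Sum>m\<in>M. \<mu> (snd m))" using M(3) by (simp add: sum.reindex)
    also have "\<dots> \<le> (\<Sum>m\<in>M. \<mu> (fst m))"
    proof (intro sum_mono)
      fix m assume m: "m \<in> M"
      then have W: "fst m \<in> W" "snd m \<in> W" using M(1) by auto
      have "R (fst m) (snd m)" using m M(4) by simp
      then have "ln (real (fst m)) \<le> ln (real (snd m))" using \<delta> by (simp add: R_def)
      then have "real (fst m) \<le> real (snd m)" using W assms by (subst (asm) ln_le_cancel_iff) (auto simp: W_def)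
      then show "\<mu> (snd m) \<le> \<mu> (fst m)"
        using W assms unfolding \<mu>_def by (intro ln_over_self_antimono) (auto simp: W_def)
    qed
    also have "\<dots> = sum \<mu> (fst ` M)" using M(2) by (simp add: sum.reindex)
    finally show ?thesis .
  qed
  finally have X: "sum \<mu> (fst ` M) \<ge> 1 / 4" using Z by simp
  have coprime: "coprime p K" if "p \<in> W" for p
  proof (rule prime_imp_coprime_nat)
    show "\<not> p dvd K" using that assms by (auto simp: W_def dest!: dvd_imp_le)
  qed (use that in \<open>simp add: W_def\<close>)
  show thesis
  proof (rule that)
    have "prime p \<and> prime q \<and> coprime p K \<and> coprime q K \<and> R p q" if "(p, q) \<in> M" for p q
      using that M(1) M(4)[OF that] coprime by (auto simp: W_def)
    then show "prime_matching K \<delta> \<epsilon> M"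
      using finM M(2,3) unfolding prime_matching_def R_def by blast
    show "n < p \<and> p \<le> A * n \<and> n < q \<and> q \<le> A * n" if "(p, q) \<in> M" for p q
      using that M(1) by (auto simp: W_def)
    define l where "l = ln (real (A * n))"
    have "A * n > 1" using mult_le_mono[of 3 A 3 n] assms by simp
    then have l: "l > 0" unfolding l_def by (intro ln_gt_zero) (simp del: of_nat_mult)
    \<comment> \<open>Replacing \<open>ln p\<close> by its maximum over the window leaves a multiple
      of the reciprocal of the logarithm, which for geometric windows is a harmonic term.\<close>
    have "1 / 4 \<le> (\<Sum>m\<in>M. \<mu> (fst m))" using X M(2) by (simp add: sum.reindex)
    also have "\<dots> \<le> (\<Sum>m\<in>M. l * (1 / real (fst m)))"
    proof (intro sum_mono)
      fix m assume m: "m \<in> M"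
      then have W: "fst m \<in> W" using M(1) by auto
      then have "ln (real (fst m)) \<le> l" unfolding l_def W_def
        using assms(1,2) by (subst ln_le_cancel_iff) (auto simp del: of_nat_mult simp: prime_gt_0_nat)
      then show "\<mu> (fst m) \<le> l * (1 / real (fst m))"
        unfolding \<mu>_def by (simp add: divide_right_mono)
    qed
    also have "\<dots> = l * (\<Sum>(p, q)\<in>M. 1 / real p)"
      by (simp add: sum_distrib_left case_prod_unfold)
    finally show "(\<Sum>(p, q)\<in>M. 1 / real p) \<ge> 1 / (4 * ln (real (A * n)))"
      using l unfolding l_def[symmetric] by (simp add: field_simps)
  qed
qed

lemma prime_matching_union:
  assumes "prime_matching K \<delta> \<epsilon> M" "prime_matching K \<delta> \<epsilon> M'"
    and "fst ` M \<inter> fst ` M' = {}" "snd ` M \<inter> snd ` M' = {}"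
  shows "prime_matching K \<delta> \<epsilon> (M \<union> M')"
  using assms unfolding prime_matching_def by (auto simp: inj_on_Un)

lemma harmonic_unbounded:
  fixes c B :: real and i :: nat
  assumes "c > 0"
  shows "\<exists>J. (\<Sum>j<J. c / real (j + i + 1)) \<ge> B"
proof (rule ccontr)
  assume "\<not> ?thesis"
  then have "summable (\<lambda>j. c / real (j + i + 1))"
    using assms by (intro summableI_nonneg_bounded[where x = B]) (auto simp: not_le intro: less_imp_le)
  then have "summable (\<lambda>j. (1 / c) * (c / real (j + (i + 1))))"
    by (intro summable_mult) (simp add: add.assoc)
  then have "summable (\<lambda>j. 1 / real j)"
    using assms by (subst summable_iff_shift[symmetric, of _ "i + 1"]) simp
  then show False using not_summable_harmonic[where 'a=real] by (simp add: inverse_eq_divide)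
qed

text \<open>The matchings of the disjoint windows from \<open>A ^ j\<close> to
  \<open>A ^ (j + 1)\<close> are united; their masses are comparable to \<open>1 / j\<close> and so
  diverge. It matters that \<open>\<delta>\<close> is chosen before \<open>B\<close>.\<close>

lemma prime_matchings_exist:
  fixes K :: nat and \<epsilon> :: real
  assumes "K \<ge> 1" "\<epsilon> > 0"
  obtains \<delta> where "\<delta> > 0"
    "\<And>B. \<exists>M. prime_matching K \<delta> \<epsilon> M \<and> (\<Sum>(p, q)\<in>M. 1 / real p) \<ge> B"
proof -
  obtain A :: nat where A: "A \<ge> 3"
    "\<And>n. n \<ge> 1 \<Longrightarrow> (\<Sum>p | prime p \<and> n < p \<and> p \<le> A * n. ln (real p) / real p) \<ge> 1"
    using mertens_window by blast
  define D where "D = real K * (2 * ln (real A) / \<epsilon> + 2)"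
  have "2 * ln (real A) / \<epsilon> \<ge> 0" using A assms by simp
  then have D: "D > 0" using assms unfolding D_def by (intro mult_pos_pos) linarith+
  \<comment> \<open>All cells and residue classes of a window together then leave at most half of
    its mass unmatched.\<close>
  define \<rho> where "\<rho> = 1 / (2 * D)"
  have \<rho>: "\<rho> > 0" "\<rho> * D \<le> 1 / 2" using D by (auto simp: \<rho>_def)
  obtain \<delta> where \<delta>: "\<delta> > 0" "\<And>z::nat. z \<ge> 1 \<Longrightarrow>
      (\<Sum>p | prime p \<and> z < p \<and> real p \<le> exp \<delta> * real z. ln (real p)) \<le> \<rho> * real z"
    using theta_short_interval[OF \<rho>(1)] by blast
  have "\<forall>\<^sub>F n in sequentially. ln (real n) / real n < \<rho>"
    using lim_ln_over_n \<rho>(1) by (intro order_tendstoD)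
  then obtain n0 where n0: "\<And>n. n \<ge> n0 \<Longrightarrow> ln (real n) / real n < \<rho>"
    by (auto simp: eventually_sequentially)
  define i where "i = max n0 (max 3 K)"
  define l where "l = ln (real A)"
  have l: "l > 0" using A by (simp add: l_def)
  have Aj: "A ^ (j + i) \<ge> i" for j
  proof -
    have "j + i < 2 ^ (j + i)" by (rule less_exp)
    also have "2 ^ (j + i) \<le> A ^ (j + i)" using A by (intro power_mono) auto
    finally show ?thesis by simp
  qed
  have step: "\<exists>M. prime_matching K \<delta> \<epsilon> M \<and>
      (\<forall>(p, q)\<in>M. A ^ (j + i) < p \<and> p \<le> A ^ (Suc j + i) \<and> A ^ (j + i) < q \<and> q \<le> A ^ (Suc j + i)) \<and>
      (\<Sum>(p, q)\<in>M. 1 / real p) \<ge> (1 / (4 * l)) / real (j + i + 1)" for j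
  proof -
    have n: "A ^ (j + i) \<ge> 3" "A ^ (j + i) \<ge> K" "A ^ (j + i) \<ge> n0" "A ^ (j + i) \<ge> 1"
      using Aj[of j] by (auto simp: i_def)
    obtain M where M: "prime_matching K \<delta> \<epsilon> M"
      "\<And>p q. (p, q) \<in> M \<Longrightarrow> A ^ (j + i) < p \<and> p \<le> A * A ^ (j + i) \<and> A ^ (j + i) < q \<and> q \<le> A * A ^ (j + i)"
      "(\<Sum>(p, q)\<in>M. 1 / real p) \<ge> 1 / (4 * ln (real (A * A ^ (j + i))))"
      using prime_matching_window[OF A(1) n(1) assms(1) n(2) assms(2) \<rho>(1) \<delta>(1) A(2)[OF n(4)] \<delta>(2)
          \<rho>(2)[unfolded D_def] less_imp_le[OF n0[OF n(3)]]] by blast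
    have "ln (real (A * A ^ (j + i))) = real (j + i + 1) * l"
      using A ln_realpow[of "real A" "j + i + 1"] by (simp add: l_def)
    then have "1 / (4 * ln (real (A * A ^ (j + i)))) = (1 / (4 * l)) / real (j + i + 1)"
      by (simp add: field_simps)
    then show ?thesis using M by (intro exI[of _ M]) auto
  qed
  have all: "\<exists>M. prime_matching K \<delta> \<epsilon> M \<and> (\<forall>(p, q)\<in>M. p \<le> A ^ (J + i) \<and> q \<le> A ^ (J + i)) \<and>
      (\<Sum>(p, q)\<in>M. 1 / real p) \<ge> (\<Sum>j<J. (1 / (4 * l)) / real (j + i + 1))" for J
  proof (induction J)
    case 0
    show ?case by (intro exI[of _ "{}"]) (auto simp: prime_matching_def)
  next
    case (Suc J)
    then obtain M where M: "prime_matching K \<delta> \<epsilon> M" "\<forall>(p, q)\<in>M. p \<le> A ^ (J + i) \<and> q \<le> A ^ (J + i)"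
      "(\<Sum>(p, q)\<in>M. 1 / real p) \<ge> (\<Sum>j<J. (1 / (4 * l)) / real (j + i + 1))" by blast
    obtain M' where M': "prime_matching K \<delta> \<epsilon> M'"
      "\<forall>(p, q)\<in>M'. A ^ (J + i) < p \<and> p \<le> A ^ (Suc J + i) \<and> A ^ (J + i) < q \<and> q \<le> A ^ (Suc J + i)"
      "(\<Sum>(p, q)\<in>M'. 1 / real p) \<ge> (1 / (4 * l)) / real (J + i + 1)"
      using step[of J] by blast
    have "p \<noteq> p' \<and> q \<noteq> q'" if "(p, q) \<in> M" "(p', q') \<in> M'" for p q p' q'
      using bspec[OF M(2) that(1)] bspec[OF M'(2) that(2)] by auto
    then have disj: "fst ` M \<inter> fst ` M' = {}" "snd ` M \<inter> snd ` M' = {}" by force+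
    have "A ^ (J + i) \<le> A ^ (Suc J + i)" using A by (intro power_increasing) auto
    then have le: "\<forall>(p, q)\<in>M \<union> M'. p \<le> A ^ (Suc J + i) \<and> q \<le> A ^ (Suc J + i)"
      using M(2) M'(2) order_trans by blast
    have "M \<inter> M' = {}" using disj by blast
    then have "(\<Sum>(p, q)\<in>M \<union> M'. 1 / real p) = (\<Sum>(p, q)\<in>M. 1 / real p) + (\<Sum>(p, q)\<in>M'. 1 / real p)"
      using M(1) M'(1) by (intro sum.union_disjoint) (auto simp: prime_matching_def)
    then have "(\<Sum>(p, q)\<in>M \<union> M'. 1 / real p) \<ge> (\<Sum>j<Suc J. (1 / (4 * l)) / real (j + i + 1))"
      using M(3) M'(3) by simp
    then show ?case using prime_matching_union[OF M(1) M'(1) disj] le by blast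
  qed
  show thesis
  proof (rule that[OF \<delta>(1)])
    fix B
    obtain J where "(\<Sum>j<J. (1 / (4 * l)) / real (j + i + 1)) \<ge> B"
      using harmonic_unbounded[of "1 / (4 * l)" B i] l by auto
    then show "\<exists>M. prime_matching K \<delta> \<epsilon> M \<and> (\<Sum>(p, q)\<in>M. 1 / real p) \<ge> B"
      using all[of J] by (meson order_trans)
  qed
qed

section \<open>Slow variation of averages along residue classes\<close>

lemma Omega_prime_mult: "prime p \<Longrightarrow> m \<ge> 1 \<Longrightarrow> Omega (p * m) = Suc (Omega m)"
  by (simp add: Omega_def prime_factorization_mult prime_factorization_prime prime_gt_0_nat)

definition unit_seq :: "(nat \<Rightarrow> real) \<Rightarrow> bool" where
  "unit_seq b \<longleftrightarrow> (\<forall>m. \<bar>b m\<bar> \<le> 1)"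

definition shift_seq :: "nat \<Rightarrow> (nat \<Rightarrow> real) \<Rightarrow> nat \<Rightarrow> real" where
  "shift_seq a b = (\<lambda>m. b (m + a))"

lemma unit_seq_shift_seq [simp]: "unit_seq b \<Longrightarrow> unit_seq (shift_seq a b)"
  by (simp add: unit_seq_def shift_seq_def)

lemma shift_seq_shift_seq [simp]: "shift_seq a (shift_seq a' b) = shift_seq (a' + a) b"
  by (simp add: shift_seq_def add_ac)

lemma shift_seq_0 [simp]: "shift_seq 0 b = b"
  by (simp add: shift_seq_def)

definition class_sum :: "nat \<Rightarrow> nat \<Rightarrow> (nat \<Rightarrow> real) \<Rightarrow> real \<Rightarrow> real" where
  "class_sum K r b x = (\<Sum>n\<in>nats_upto x. if [n = r] (mod K) then b (Omega n) else 0)"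

definition class_avg :: "nat \<Rightarrow> nat \<Rightarrow> (nat \<Rightarrow> real) \<Rightarrow> real \<Rightarrow> real" where
  "class_avg K r b x = class_sum K r b x / x"

lemma abs_class_avg_diff_le:
  assumes "unit_seq b" "0 < x" "x \<le> y"
  shows "\<bar>class_avg K r b y - class_avg K r b x\<bar> \<le> (2 * (y - x) + 1) / y"
proof -
  let ?f = "\<lambda>n. if [n = r] (mod K) then b (Omega n) else 0"
  have f: "\<bar>?f n\<bar> \<le> 1" for n using assms(1) by (simp add: unit_seq_def)
  have sub: "nats_upto x \<subseteq> nats_upto y" using assms by auto
  have "class_sum K r b y - class_sum K r b x = (\<Sum>n\<in>nats_upto y - nats_upto x. ?f n)"
    unfolding class_sum_def using sub by (simp add: sum_diff)
  also have "\<bar>\<dots>\<bar> \<le> (\<Sum>n\<in>nats_upto y - nats_upto x. 1)"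
    using f by (intro order_trans[OF sum_abs] sum_mono) auto
  also have "\<dots> = real (card (nats_upto y) - card (nats_upto x))"
    using sub by (simp add: card_Diff_subset)
  also have "\<dots> \<le> y - x + 1" using assms by (simp add: nats_upto_def) linarith
  finally have 1: "\<bar>class_sum K r b y - class_sum K r b x\<bar> \<le> y - x + 1" .
  have "\<bar>class_sum K r b x\<bar> \<le> (\<Sum>n\<in>nats_upto x. 1)"
    unfolding class_sum_def using f by (intro order_trans[OF sum_abs] sum_mono) auto
  then have 2: "\<bar>class_sum K r b x\<bar> \<le> x" using card_nats_upto_le[of x] assms by simp
  have "class_avg K r b y - class_avg K r b x =
      (class_sum K r b y - class_sum K r b x) / y - class_sum K r b x * ((y - x) / (x * y))"
    using assms by (simp add: class_avg_def field_simps)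
  also have "\<bar>\<dots>\<bar> \<le> (y - x + 1) / y + x * ((y - x) / (x * y))"
  proof (intro order_trans[OF abs_triangle_ineq4] add_mono)
    show "\<bar>(class_sum K r b y - class_sum K r b x) / y\<bar> \<le> (y - x + 1) / y"
      using 1 assms by (simp add: divide_right_mono)
    show "\<bar>class_sum K r b x * ((y - x) / (x * y))\<bar> \<le> x * ((y - x) / (x * y))"
      using 2 assms unfolding abs_mult by (intro mult_mono) auto
  qed
  also have "\<dots> = (2 * (y - x) + 1) / y" using assms by (simp add: field_simps)
  finally show ?thesis .
qed

text \<open>Replacing \<open>n\<close> by \<open>p * m\<close> turns the class of \<open>r\<close>
  into that of \<open>r / p\<close> and adds one to \<open>Omega\<close>, so the right side sees
  \<open>b\<close> only through its shift. Indexing by \<open>I\<close> through \<open>\<pi>\<close>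
  allows the same weights for both projections of a matching.\<close>

lemma class_avg_step:
  fixes \<pi> :: "'i \<Rightarrow> nat" and w :: "'i \<Rightarrow> real"
  assumes "finite I" "inj_on \<pi> I" "\<And>i. i \<in> I \<Longrightarrow> prime (\<pi> i)" "\<And>i. i \<in> I \<Longrightarrow> coprime (\<pi> i) K"
    and s: "\<And>i. i \<in> I \<Longrightarrow> [\<pi> i * s i = r] (mod K)"
    and w: "\<And>i. i \<in> I \<Longrightarrow> w i \<ge> 0" "(\<Sum>i\<in>I. w i) = 1" "(\<Sum>i\<in>I. (w i)\<^sup>2 * real (\<pi> i)) < \<eta>\<^sup>2"
    and "\<eta> > 0"
  shows "\<forall>\<^sub>F x in at_top. \<forall>b. unit_seq b \<longrightarrow>
    \<bar>class_avg K r b x - (\<Sum>i\<in>I. w i * class_avg K (s i) (shift_seq 1 b) (x / real (\<pi> i)))\<bar> \<le> \<eta>"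
proof -
  define w' where "w' = (\<lambda>p. w (the_inv_into I \<pi> p))"
  have w'[simp]: "w' (\<pi> i) = w i" if "i \<in> I" for i
    using that assms(2) by (simp add: w'_def the_inv_into_f_f)
  have "\<forall>\<^sub>F x in at_top. \<forall>f. (\<forall>n. \<bar>f n\<bar> \<le> 1) \<longrightarrow>
    \<bar>(\<Sum>n\<in>nats_upto x. f n) - (\<Sum>p\<in>\<pi> ` I. w' p * real p * (\<Sum>m\<in>nats_upto (x / real p). f (p * m)))\<bar> \<le> \<eta> * x"
    by (rule turan_kubilius) (use assms in \<open>auto simp: sum.reindex\<close>)
  moreover have "\<forall>\<^sub>F x in at_top. x > (0::real)" by (rule eventually_gt_at_top)
  ultimately show ?thesis
  proof eventually_elim
    case (elim x)
    show ?case
    proof (intro allI impI)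
      fix b assume b: "unit_seq b"
      let ?f = "\<lambda>n. if [n = r] (mod K) then b (Omega n) else 0"
      have eq: "(\<Sum>m\<in>nats_upto (x / real (\<pi> i)). ?f (\<pi> i * m)) = class_sum K (s i) (shift_seq 1 b) (x / real (\<pi> i))"
        if i: "i \<in> I" for i
        unfolding class_sum_def
      proof (intro sum.cong refl)
        fix m assume m: "m \<in> nats_upto (x / real (\<pi> i))"
        have "[\<pi> i * m = r] (mod K) \<longleftrightarrow> [\<pi> i * m = \<pi> i * s i] (mod K)"
          using s[OF i] by (meson cong_sym cong_trans)
        also have "\<dots> \<longleftrightarrow> [m = s i] (mod K)" using assms(4)[OF i] by (intro cong_mult_lcancel_nat)
        finally show "?f (\<pi> i * m) = (if [m = s i] (mod K) then shift_seq 1 b (Omega m) else 0)"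
          using m i assms(3) by (simp add: Omega_prime_mult shift_seq_def)
      qed
      have "\<bar>(\<Sum>n\<in>nats_upto x. ?f n) - (\<Sum>p\<in>\<pi> ` I. w' p * real p * (\<Sum>m\<in>nats_upto (x / real p). ?f (p * m)))\<bar> \<le> \<eta> * x"
        using b by (intro elim(1)[rule_format]) (auto simp: unit_seq_def)
      also have "(\<Sum>p\<in>\<pi> ` I. w' p * real p * (\<Sum>m\<in>nats_upto (x / real p). ?f (p * m))) =
          (\<Sum>i\<in>I. w i * real (\<pi> i) * class_sum K (s i) (shift_seq 1 b) (x / real (\<pi> i)))"
        using assms(2) by (simp add: sum.reindex eq cong: sum.cong)
      also have "\<dots> = (\<Sum>i\<in>I. w i * class_avg K (s i) (shift_seq 1 b) (x / real (\<pi> i))) * x"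
        unfolding class_avg_def sum_distrib_right using elim(2) assms(3)
        by (intro sum.cong refl) (auto simp: field_simps prime_gt_0_nat)
      also have "(\<Sum>n\<in>nats_upto x. ?f n) = class_avg K r b x * x"
        using elim(2) by (simp add: class_avg_def class_sum_def)
      finally have "\<bar>class_avg K r b x - (\<Sum>i\<in>I. w i * class_avg K (s i) (shift_seq 1 b) (x / real (\<pi> i)))\<bar> * x \<le> \<eta> * x"
        using elim(2) by (simp add: abs_mult flip: left_diff_distrib)
      then show "\<bar>class_avg K r b x - (\<Sum>i\<in>I. w i * class_avg K (s i) (shift_seq 1 b) (x / real (\<pi> i)))\<bar> \<le> \<eta>"
        using elim(2) by simp
    qed
  qed
qed

definition unit_classes :: "nat \<Rightarrow> nat set" where
  "unit_classes K = {r. r < K \<and> coprime r K}"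

lemma finite_unit_classes [simp]: "finite (unit_classes K)"
  by (simp add: unit_classes_def)

lemma unit_classes_div:
  assumes "coprime p K" "r \<in> unit_classes K"
  obtains s where "s \<in> unit_classes K" "[p * s = r] (mod K)"
proof -
  have K: "K > 0" using assms by (auto simp: unit_classes_def)
  obtain u where u: "[p * u = 1] (mod K)" using cong_solve_coprime_nat[OF assms(1)] by auto
  define s where "s = (u * r) mod K"
  have "[p * s = p * (u * r)] (mod K)" unfolding s_def by (intro cong_mult cong_refl) (simp add: cong_def)
  also have "p * (u * r) = (p * u) * r" by simp
  also have "[(p * u) * r = 1 * r] (mod K)" using u by (intro cong_mult cong_refl)
  finally have ps: "[p * s = r] (mod K)" by simp
  have "coprime (p * s) K"
    using cong_imp_coprime[OF cong_sym[OF ps]] assms(2) by (simp add: unit_classes_def)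
  then have "coprime s K" by simp
  moreover have "s < K" using K by (simp add: s_def)
  ultimately show thesis using that ps by (auto simp: unit_classes_def)
qed

text \<open>A bound \<open>\<beta>\<close> for the limit superior of the differences. The slack
  \<open>e\<close> is kept apart from \<open>\<beta>\<close>, so that the errors of repeated
  induction steps do not accumulate.\<close>

definition slow_variation :: "nat \<Rightarrow> real \<Rightarrow> real \<Rightarrow> bool" where
  "slow_variation K \<beta> d \<longleftrightarrow> (\<forall>e>0. \<forall>\<^sub>F x in at_top. \<forall>r\<in>unit_classes K. \<forall>b. unit_seq b \<longrightarrow>
     \<bar>class_avg K r b (x * exp d) - class_avg K r b x\<bar> \<le> \<beta> + e)"

text \<open>The base of the induction: changing the cutoff by a factor \<open>exp d\<close> only
  affects a proportion of at most \<open>d\<close> of the integers counted.\<close>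

lemma slow_variation_small:
  assumes "0 \<le> d" "d \<le> \<epsilon>"
  shows "slow_variation K (2 * \<epsilon>) d"
  unfolding slow_variation_def
proof (intro allI impI)
  fix e :: real assume e: "e > 0"
  have "\<forall>\<^sub>F x in at_top. x \<ge> max 1 (1 / e)" by (rule eventually_ge_at_top)
  then show "\<forall>\<^sub>F x in at_top. \<forall>r\<in>unit_classes K. \<forall>b. unit_seq b \<longrightarrow>
     \<bar>class_avg K r b (x * exp d) - class_avg K r b x\<bar> \<le> 2 * \<epsilon> + e"
  proof eventually_elim
    case (elim x)
    then have x: "x > 0" "x \<ge> 1 / e" by auto
    have y: "x \<le> x * exp d" using x assms by simp
    have "(2 * (x * exp d - x) + 1) / (x * exp d) = 2 * (1 - exp (- d)) + 1 / (x * exp d)"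
      using x by (simp add: field_simps exp_minus)
    also have "1 - exp (- d) \<le> d" using exp_ge_add_one_self[of "- d"] by simp
    also have "1 / (x * exp d) \<le> 1 / x" using x y by (intro divide_left_mono) auto
    also have "1 / x \<le> e" using x e by (simp add: field_simps)
    finally have "(2 * (x * exp d - x) + 1) / (x * exp d) \<le> 2 * \<epsilon> + e" using assms by simp
    then show ?case using abs_class_avg_diff_le[OF _ x(1) y] by (meson order_trans)
  qed
qed

lemma eventually_at_top_mult:
  fixes c :: real
  assumes "eventually P at_top" "c > 0"
  shows "\<forall>\<^sub>F x in at_top. P (x * c)"
proof -
  have "filterlim (\<lambda>x::real. x * c) at_top at_top"
    using assms(2) by (intro filterlim_at_top_mult_tendsto_pos[OF tendsto_const _ filterlim_ident])
  then show ?thesis using assms(1) by (simp add: filterlim_iff)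
qed

text \<open>Averaging over a matching \<open>(p, q)\<close> compares the points \<open>x e\<^sup>d / q\<close> and \<open>x / p\<close>, whose logarithmic
  distance is smaller than \<open>d\<close> by at least \<open>\<delta>\<close>, and the constant \<open>\<beta>\<close> is not enlarged.\<close>

lemma slow_variation_step:
  assumes "K \<ge> 1" "\<epsilon> > 0" "\<delta> > 0" "D \<ge> 0" "\<beta> \<ge> 0"
    and M: "\<And>B. \<exists>M. prime_matching K \<delta> \<epsilon> M \<and> (\<Sum>(p, q)\<in>M. 1 / real p) \<ge> B"
    and IH: "\<And>d'. 0 \<le> d' \<Longrightarrow> d' \<le> D \<Longrightarrow> slow_variation K \<beta> d'"
    and d: "\<epsilon> \<le> d" "d \<le> D + \<delta>"
  shows "slow_variation K \<beta> d"
  unfolding slow_variation_def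
proof (intro allI impI)
  fix e :: real assume e: "e > 0"
  define \<eta> where "\<eta> = e / 3"
  have \<eta>: "\<eta> > 0" using e by (simp add: \<eta>_def)
  \<comment> \<open>Weights \<open>1 / p\<close> normalised by the total mass \<open>B\<close> have
    variance at most \<open>exp \<epsilon> / B\<close>, also when evaluated at \<open>q\<close>,
    because \<open>q \<le> exp \<epsilon> * p\<close>.\<close>
  obtain M where M: "prime_matching K \<delta> \<epsilon> M" "(\<Sum>(p, q)\<in>M. 1 / real p) \<ge> 2 * exp \<epsilon> / \<eta>\<^sup>2"
    using M by blast
  define B where "B = (\<Sum>m\<in>M. 1 / real (fst m))"
  have B: "B \<ge> 2 * exp \<epsilon> / \<eta>\<^sup>2" using M(2) by (simp add: B_def case_prod_unfold)
  moreover have "2 * exp \<epsilon> / \<eta>\<^sup>2 > 0" using \<eta> by simp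
  ultimately have Bpos: "B > 0" by linarith
  have "exp \<epsilon> / B < \<eta>\<^sup>2"
  proof -
    have "exp \<epsilon> < 2 * exp \<epsilon>" by simp
    also have "2 * exp \<epsilon> \<le> B * \<eta>\<^sup>2" using B \<eta> by (simp add: field_simps)
    finally show ?thesis using Bpos by (simp add: field_simps)
  qed
  define w where "w = (\<lambda>m :: nat \<times> nat. 1 / real (fst m) / B)"
  have fin: "finite M" and inj: "inj_on fst M" "inj_on snd M" using M(1) by (auto simp: prime_matching_def)
  have el: "prime (fst m)" "prime (snd m)" "coprime (fst m) K" "coprime (snd m) K" "[fst m = snd m] (mod K)"
    "\<delta> \<le> ln (real (snd m)) - ln (real (fst m))" "ln (real (snd m)) - ln (real (fst m)) \<le> \<epsilon>"
    if "m \<in> M" for m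
    using M(1) that by (auto simp: prime_matching_def case_prod_unfold)
  have pos: "real (fst m) > 0" "real (snd m) > 0" if "m \<in> M" for m
    using el[OF that] by (auto simp: prime_gt_0_nat)
  have w0: "w m \<ge> 0" for m using Bpos by (simp add: w_def)
  have w1: "sum w M = 1" using Bpos unfolding w_def sum_divide_distrib[symmetric] B_def[symmetric] by simp
  have quot: "real (snd m) \<le> exp \<epsilon> * real (fst m)" if "m \<in> M" for m
  proof -
    have "exp (ln (real (snd m))) \<le> exp (\<epsilon> + ln (real (fst m)))" using el[OF that] by simp
    then show ?thesis using pos[OF that] by (simp add: exp_add)
  qed
  have Vq: "(\<Sum>m\<in>M. (w m)\<^sup>2 * real (snd m)) < \<eta>\<^sup>2"
  proof -
    have "(\<Sum>m\<in>M. (w m)\<^sup>2 * real (snd m)) \<le> (\<Sum>m\<in>M. (w m)\<^sup>2 * (exp \<epsilon> * real (fst m)))"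
      using quot by (intro sum_mono mult_left_mono) auto
    also have "\<dots> = (\<Sum>m\<in>M. exp \<epsilon> / B * w m)"
      using pos Bpos by (intro sum.cong refl) (auto simp: w_def power2_eq_square field_simps)
    also have "\<dots> = exp \<epsilon> / B" using w1 unfolding sum_distrib_left[symmetric] by simp
    finally show ?thesis using \<open>exp \<epsilon> / B < \<eta>\<^sup>2\<close> by simp
  qed
  have Vp: "(\<Sum>m\<in>M. (w m)\<^sup>2 * real (fst m)) < \<eta>\<^sup>2"
  proof -
    have "real (fst m) \<le> real (snd m)" if "m \<in> M" for m
    proof -
      have "ln (real (fst m)) \<le> ln (real (snd m))" using el(6)[OF that] assms(3) by simp
      then show ?thesis using pos[OF that] by (subst (asm) ln_le_cancel_iff)
    qed
    then have "(\<Sum>m\<in>M. (w m)\<^sup>2 * real (fst m)) \<le> (\<Sum>m\<in>M. (w m)\<^sup>2 * real (snd m))"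
      by (intro sum_mono mult_left_mono) auto
    then show ?thesis using Vq by simp
  qed
  have evr: "\<forall>\<^sub>F x in at_top. \<forall>b. unit_seq b \<longrightarrow>
     \<bar>class_avg K r b (x * exp d) - class_avg K r b x\<bar> \<le> \<beta> + e" if r: "r \<in> unit_classes K" for r
  proof -
    have "\<exists>s. s \<in> unit_classes K \<and> [fst m * s = r] (mod K)" if "m \<in> M" for m
      using unit_classes_div[OF el(3)[OF that] r] by blast
    then obtain s where s: "\<And>m. m \<in> M \<Longrightarrow> s m \<in> unit_classes K" "\<And>m. m \<in> M \<Longrightarrow> [fst m * s m = r] (mod K)"
      by metis
    have s': "[snd m * s m = r] (mod K)" if "m \<in> M" for m
    proof -
      have "[snd m * s m = fst m * s m] (mod K)" using el(5)[OF that] by (intro cong_mult cong_refl) (rule cong_sym)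
      then show ?thesis using s(2)[OF that] by (rule cong_trans)
    qed
    have ev1: "\<forall>\<^sub>F x in at_top. \<forall>b. unit_seq b \<longrightarrow>
      \<bar>class_avg K r b x - (\<Sum>m\<in>M. w m * class_avg K (s m) (shift_seq 1 b) (x / real (fst m)))\<bar> \<le> \<eta>"
      using el s w0 w1 Vp \<eta> fin inj by (intro class_avg_step) auto
    have "\<forall>\<^sub>F x in at_top. \<forall>b. unit_seq b \<longrightarrow>
      \<bar>class_avg K r b x - (\<Sum>m\<in>M. w m * class_avg K (s m) (shift_seq 1 b) (x / real (snd m)))\<bar> \<le> \<eta>"
      using el s' w0 w1 Vq \<eta> fin inj by (intro class_avg_step) auto
    from eventually_at_top_mult[OF this, of "exp d"]
    have ev2: "\<forall>\<^sub>F x in at_top. \<forall>b. unit_seq b \<longrightarrow> \<bar>class_avg K r b (x * exp d) -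
        (\<Sum>m\<in>M. w m * class_avg K (s m) (shift_seq 1 b) (x * exp d / real (snd m)))\<bar> \<le> \<eta>" by simp
    have ev3: "\<forall>\<^sub>F x in at_top. \<forall>m\<in>M. \<forall>b. unit_seq b \<longrightarrow>
      \<bar>class_avg K (s m) b (x * exp d / real (snd m)) - class_avg K (s m) b (x / real (fst m))\<bar> \<le> \<beta> + \<eta>"
    proof (intro eventually_ball_finite fin ballI)
      fix m assume m: "m \<in> M"
      \<comment> \<open>The hypothesis \<open>\<epsilon> \<le> d\<close> makes \<open>d'\<close>
        nonnegative, and the gap of at least \<open>\<delta>\<close> in the pair brings it down to
        the range \<open>D\<close> already treated.\<close>
      define d' where "d' = d - (ln (real (snd m)) - ln (real (fst m)))"
      have "slow_variation K \<beta> d'" using el[OF m] d by (intro IH) (auto simp: d'_def)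
      then have "\<forall>\<^sub>F x in at_top. \<forall>r\<in>unit_classes K. \<forall>b. unit_seq b \<longrightarrow>
        \<bar>class_avg K r b (x * exp d') - class_avg K r b x\<bar> \<le> \<beta> + \<eta>"
        using \<eta> by (simp add: slow_variation_def)
      from eventually_at_top_mult[OF this, of "1 / real (fst m)"]
      have "\<forall>\<^sub>F x in at_top. \<forall>r\<in>unit_classes K. \<forall>b. unit_seq b \<longrightarrow>
        \<bar>class_avg K r b (x * (1 / real (fst m)) * exp d') - class_avg K r b (x * (1 / real (fst m)))\<bar> \<le> \<beta> + \<eta>"
        using pos[OF m] by simp
      moreover have "exp d' = exp d * real (fst m) / real (snd m)"
        using pos[OF m] unfolding d'_def exp_diff by simp
      then have "x * (1 / real (fst m)) * exp d' = x * exp d / real (snd m)" for x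
        using pos[OF m] by simp
      ultimately show "\<forall>\<^sub>F x in at_top. \<forall>b. unit_seq b \<longrightarrow>
        \<bar>class_avg K (s m) b (x * exp d / real (snd m)) - class_avg K (s m) b (x / real (fst m))\<bar> \<le> \<beta> + \<eta>"
        using s(1)[OF m] by (auto elim!: eventually_mono)
    qed
    from ev1 ev2 ev3 show ?thesis
    proof eventually_elim
      case (elim x)
      show ?case
      proof (intro allI impI)
        fix b assume b: "unit_seq b"
        let ?P = "\<lambda>m. class_avg K (s m) (shift_seq 1 b) (x / real (fst m))"
        let ?Q = "\<lambda>m. class_avg K (s m) (shift_seq 1 b) (x * exp d / real (snd m))"
        have "\<bar>(\<Sum>m\<in>M. w m * ?Q m) - (\<Sum>m\<in>M. w m * ?P m)\<bar> = \<bar>\<Sum>m\<in>M. w m * (?Q m - ?P m)\<bar>"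
          by (simp add: sum_subtractf right_diff_distrib)
        also have "\<dots> \<le> (\<Sum>m\<in>M. w m * (\<beta> + \<eta>))"
          using elim(3) b w0 by (intro order_trans[OF sum_abs] sum_mono) (auto simp: abs_mult intro!: mult_left_mono)
        also have "\<dots> = \<beta> + \<eta>" using w1 by (simp flip: sum_distrib_right)
        finally have 3: "\<bar>(\<Sum>m\<in>M. w m * ?Q m) - (\<Sum>m\<in>M. w m * ?P m)\<bar> \<le> \<beta> + \<eta>" .
        have "\<beta> + e = \<eta> + \<eta> + (\<beta> + \<eta>)" by (simp add: \<eta>_def)
        then show "\<bar>class_avg K r b (x * exp d) - class_avg K r b x\<bar> \<le> \<beta> + e"
          using 3 elim(1)[rule_format, OF b] elim(2)[rule_format, OF b] by linarith
      qed
    qed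
  qed
  show "\<forall>\<^sub>F x in at_top. \<forall>r\<in>unit_classes K. \<forall>b. unit_seq b \<longrightarrow>
     \<bar>class_avg K r b (x * exp d) - class_avg K r b x\<bar> \<le> \<beta> + e"
    using evr by (intro eventually_ball_finite) auto
qed

text \<open>For fixed \<open>\<epsilon>\<close> every step extends the admissible logarithmic
  distance by \<open>\<delta>\<close> and keeps the bound \<open>2 * \<epsilon>\<close>, so any
  \<open>d\<close> is reached in finitely many steps. Only afterwards does \<open>\<epsilon>\<close>
  tend to 0, which makes the dependence of \<open>\<delta>\<close> on it harmless.\<close>

lemma slow_variation_zero:
  assumes "K \<ge> 1" "d \<ge> 0"
  shows "slow_variation K 0 d"
  unfolding slow_variation_def
proof (intro allI impI)
  fix e :: real assume e: "e > 0"
  define \<epsilon> where "\<epsilon> = e / 4"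
  have \<epsilon>: "\<epsilon> > 0" using e by (simp add: \<epsilon>_def)
  obtain \<delta> where \<delta>: "\<delta> > 0" "\<And>B. \<exists>M. prime_matching K \<delta> \<epsilon> M \<and> (\<Sum>(p, q)\<in>M. 1 / real p) \<ge> B"
    using prime_matchings_exist[OF assms(1) \<epsilon>] by blast
  have "\<forall>d'. 0 \<le> d' \<and> d' \<le> \<epsilon> + real n * \<delta> \<longrightarrow> slow_variation K (2 * \<epsilon>) d'" for n
  proof (induction n)
    case 0
    then show ?case using slow_variation_small by auto
  next
    case (Suc n)
    show ?case
    proof (intro allI impI)
      fix d' assume d': "0 \<le> d' \<and> d' \<le> \<epsilon> + real (Suc n) * \<delta>"
      show "slow_variation K (2 * \<epsilon>) d'"
      proof (cases "d' \<le> \<epsilon>")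
        case True
        then show ?thesis using d' slow_variation_small by auto
      next
        case False
        show ?thesis
        proof (rule slow_variation_step[OF assms(1) \<epsilon> \<delta>(1) _ _ \<delta>(2)])
          show "\<epsilon> + real n * \<delta> \<ge> 0" using \<epsilon> \<delta> by simp
          show "d' \<le> \<epsilon> + real n * \<delta> + \<delta>" using d' by (simp add: algebra_simps)
        qed (use \<epsilon> False Suc in auto)
      qed
    qed
  qed
  moreover obtain n :: nat where "d / \<delta> \<le> real n" using real_arch_simple by blast
  then have "d \<le> \<epsilon> + real n * \<delta>" using \<delta> \<epsilon> by (simp add: field_simps)
  ultimately have "slow_variation K (2 * \<epsilon>) d" using assms by blast
  then have "\<forall>\<^sub>F x in at_top. \<forall>r\<in>unit_classes K. \<forall>b. unit_seq b \<longrightarrow>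
     \<bar>class_avg K r b (x * exp d) - class_avg K r b x\<bar> \<le> 2 * \<epsilon> + 2 * \<epsilon>"
    using \<epsilon> unfolding slow_variation_def by (elim allE[of _ "2 * \<epsilon>"] impE) auto
  then show "\<forall>\<^sub>F x in at_top. \<forall>r\<in>unit_classes K. \<forall>b. unit_seq b \<longrightarrow>
     \<bar>class_avg K r b (x * exp d) - class_avg K r b x\<bar> \<le> 0 + e"
    by (simp add: \<epsilon>_def)
qed

section \<open>Transfer between residue classes along a single prime\<close>

text \<open>Divergence of the reciprocals, not infinitude of the primes, is what makes
  Turan-Kubilius weights supported on the class have small variance.\<close>

definition rich :: "nat \<Rightarrow> nat \<Rightarrow> bool" where
  "rich K c \<longleftrightarrow> (\<forall>B::real. \<exists>P. finite P \<and> (\<forall>p\<in>P. prime p \<and> [p = c] (mod K)) \<and> (\<Sum>p\<in>P. 1 / real p) \<ge> B)"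

text \<open>Taken over all \<open>b\<close> at once, this compares in total variation the
  distribution of \<open>Omega\<close> on the class of \<open>r\<close> with that of
  \<open>Omega + a\<close> on the class of \<open>s\<close>.\<close>

definition asymp_eq :: "nat \<Rightarrow> nat \<Rightarrow> nat \<Rightarrow> nat \<Rightarrow> bool" where
  "asymp_eq K r a s \<longleftrightarrow> (\<forall>e>0. \<forall>\<^sub>F x in at_top. \<forall>b. unit_seq b \<longrightarrow>
     \<bar>class_avg K r b x - class_avg K s (shift_seq a b) x\<bar> \<le> e)"

lemma asymp_eq_trans:
  assumes "asymp_eq K r a s" "asymp_eq K s a' t"
  shows "asymp_eq K r (a + a') t"
  unfolding asymp_eq_def
proof (intro allI impI)
  fix e :: real assume e: "e > 0"
  have "\<forall>\<^sub>F x in at_top. \<forall>b. unit_seq b \<longrightarrow> \<bar>class_avg K r b x - class_avg K s (shift_seq a b) x\<bar> \<le> e / 2"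
    "\<forall>\<^sub>F x in at_top. \<forall>b. unit_seq b \<longrightarrow> \<bar>class_avg K s b x - class_avg K t (shift_seq a' b) x\<bar> \<le> e / 2"
    using assms half_gt_zero[OF e] unfolding asymp_eq_def by blast+
  then show "\<forall>\<^sub>F x in at_top. \<forall>b. unit_seq b \<longrightarrow> \<bar>class_avg K r b x - class_avg K t (shift_seq (a + a') b) x\<bar> \<le> e"
  proof eventually_elim
    case (elim x)
    show ?case
    proof (intro allI impI)
      fix b assume b: "unit_seq b"
      then have "unit_seq (shift_seq a b)" by simp
      then show "\<bar>class_avg K r b x - class_avg K t (shift_seq (a + a') b) x\<bar> \<le> e"
        using elim(1)[rule_format, OF b] elim(2)[rule_format, of "shift_seq a b"]
        unfolding shift_seq_shift_seq by linarith
    qed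
  qed
qed

text \<open>Turan-Kubilius over primes in the class of \<open>c\<close> leads to averages over the
  single class of \<open>s\<close>, at the points \<open>x / p\<close>. Only finitely many
  \<open>p\<close> occur, so slow variation moves all these points back to \<open>x\<close>.\<close>

lemma rich_asymp_eq:
  assumes K: "K \<ge> 1" and c: "rich K c" "coprime c K"
    and rs: "r \<in> unit_classes K" "s \<in> unit_classes K" "[c * s = r] (mod K)"
  shows "asymp_eq K r 1 s"
  unfolding asymp_eq_def
proof (intro allI impI)
  fix e :: real assume e: "e > 0"
  define \<eta> where "\<eta> = e / 2"
  have \<eta>: "\<eta> > 0" using e by (simp add: \<eta>_def)
  obtain P where P: "finite P" "\<And>p. p \<in> P \<Longrightarrow> prime p" "\<And>p. p \<in> P \<Longrightarrow> [p = c] (mod K)"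
    "(\<Sum>p\<in>P. 1 / real p) \<ge> 2 / \<eta>\<^sup>2"
    using c unfolding rich_def by meson
  define B where "B = (\<Sum>p\<in>P. 1 / real p)"
  have "2 / \<eta>\<^sup>2 > 0" using \<eta> by simp
  then have Bpos: "B > 0" using P(4) unfolding B_def by linarith
  have "1 < B * \<eta>\<^sup>2"
  proof -
    have "2 \<le> B * \<eta>\<^sup>2" using P(4) \<eta> by (simp add: B_def field_simps)
    then show ?thesis by simp
  qed
  then have B2: "1 / B < \<eta>\<^sup>2" using Bpos by (simp add: field_simps)
  define w where "w = (\<lambda>p. 1 / real p / B)"
  have pos: "real p > 0" if "p \<in> P" for p using P(2)[OF that] by (simp add: prime_gt_0_nat)
  have w0: "w p \<ge> 0" for p using Bpos by (simp add: w_def)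
  have w1: "sum w P = 1" using Bpos unfolding w_def sum_divide_distrib[symmetric] B_def[symmetric] by simp
  have V: "(\<Sum>p\<in>P. (w p)\<^sup>2 * real p) < \<eta>\<^sup>2"
  proof -
    have "(\<Sum>p\<in>P. (w p)\<^sup>2 * real p) = (\<Sum>p\<in>P. 1 / B * w p)"
      using pos Bpos by (intro sum.cong refl) (auto simp: w_def power2_eq_square field_simps)
    also have "\<dots> = 1 / B" using w1 unfolding sum_distrib_left[symmetric] by simp
    finally show ?thesis using B2 by simp
  qed
  have cop: "coprime p K" if "p \<in> P" for p
    using P(3)[OF that] c(2) by (meson cong_imp_coprime cong_sym)
  have ps: "[p * s = r] (mod K)" if "p \<in> P" for p
    using cong_mult[OF P(3)[OF that] cong_refl[of s]] rs(3) by (rule cong_trans)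
  have ev1: "\<forall>\<^sub>F x in at_top. \<forall>b. unit_seq b \<longrightarrow>
      \<bar>class_avg K r b x - (\<Sum>p\<in>P. w p * class_avg K s (shift_seq 1 b) (x / real p))\<bar> \<le> \<eta>"
    using P cop ps w0 w1 V \<eta> by (intro class_avg_step[where \<pi> = "\<lambda>p. p" and s = "\<lambda>_. s"]) auto
  have ev2: "\<forall>\<^sub>F x in at_top. \<forall>p\<in>P. \<forall>b. unit_seq b \<longrightarrow> \<bar>class_avg K s b x - class_avg K s b (x / real p)\<bar> \<le> \<eta>"
  proof (intro eventually_ball_finite P ballI)
    fix p assume p: "p \<in> P"
    have "slow_variation K 0 (ln (real p))"
      using P(2)[OF p] by (intro slow_variation_zero K) (simp add: prime_gt_0_nat Suc_le_eq)
    then have "\<forall>\<^sub>F x in at_top. \<forall>r\<in>unit_classes K. \<forall>b. unit_seq b \<longrightarrow>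
        \<bar>class_avg K r b (x * exp (ln (real p))) - class_avg K r b x\<bar> \<le> 0 + \<eta>"
      unfolding slow_variation_def using \<eta> by blast
    from eventually_at_top_mult[OF this, of "1 / real p"]
    show "\<forall>\<^sub>F x in at_top. \<forall>b. unit_seq b \<longrightarrow> \<bar>class_avg K s b x - class_avg K s b (x / real p)\<bar> \<le> \<eta>"
      using pos[OF p] rs(2) by (auto elim!: eventually_mono)
  qed
  from ev1 ev2 show "\<forall>\<^sub>F x in at_top. \<forall>b. unit_seq b \<longrightarrow> \<bar>class_avg K r b x - class_avg K s (shift_seq 1 b) x\<bar> \<le> e"
  proof eventually_elim
    case (elim x)
    show ?case
    proof (intro allI impI)
      fix b assume b: "unit_seq b"
      let ?P = "\<lambda>p. class_avg K s (shift_seq 1 b) (x / real p)"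
      have "class_avg K s (shift_seq 1 b) x - (\<Sum>p\<in>P. w p * ?P p) = (\<Sum>p\<in>P. w p * (class_avg K s (shift_seq 1 b) x - ?P p))"
        using w1 by (simp add: sum_subtractf right_diff_distrib flip: sum_distrib_right)
      also have "\<bar>\<dots>\<bar> \<le> (\<Sum>p\<in>P. w p * \<eta>)"
        using elim(2) b w0 by (intro order_trans[OF sum_abs] sum_mono) (auto simp: abs_mult intro!: mult_left_mono)
      also have "\<dots> = \<eta>" using w1 by (simp flip: sum_distrib_right)
      finally have "\<bar>class_avg K s (shift_seq 1 b) x - (\<Sum>p\<in>P. w p * ?P p)\<bar> \<le> \<eta>" .
      moreover have "e = \<eta> + \<eta>" by (simp add: \<eta>_def)
      ultimately show "\<bar>class_avg K r b x - class_avg K s (shift_seq 1 b) x\<bar> \<le> e"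
        using elim(1)[rule_format, OF b] by linarith
    qed
  qed
qed

section \<open>Residue classes rich in primes\<close>

text \<open>The length is recorded because it is the total translation of \<open>Omega\<close>
  produced by the product.\<close>

definition rich_product :: "nat \<Rightarrow> nat \<Rightarrow> nat \<Rightarrow> bool" where
  "rich_product K a n \<longleftrightarrow> (\<exists>cs. length cs = a \<and> (\<forall>c\<in>set cs. rich K c \<and> coprime c K) \<and> [prod_list cs = n] (mod K))"

lemma rich_cong: "rich K c \<Longrightarrow> [c = c'] (mod K) \<Longrightarrow> rich K c'"
  unfolding rich_def by (meson cong_trans)

lemma rich_product_cong: "rich_product K a m \<Longrightarrow> [m = n] (mod K) \<Longrightarrow> rich_product K a n"
  unfolding rich_product_def by (blast intro: cong_trans)

lemma rich_product_0: "rich_product K 0 1"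
  by (simp add: rich_product_def)

lemma rich_product_single: "rich K c \<Longrightarrow> coprime c K \<Longrightarrow> rich_product K 1 c"
  unfolding rich_product_def by (intro exI[of _ "[c]"]) simp

lemma rich_product_mult:
  assumes "rich_product K a m" "rich_product K b n"
  shows "rich_product K (a + b) (m * n)"
proof -
  obtain cs where cs: "length cs = a" "\<forall>c\<in>set cs. rich K c \<and> coprime c K" "[prod_list cs = m] (mod K)"
    using assms(1) unfolding rich_product_def by blast
  obtain ds where ds: "length ds = b" "\<forall>c\<in>set ds. rich K c \<and> coprime c K" "[prod_list ds = n] (mod K)"
    using assms(2) unfolding rich_product_def by blast
  have "[prod_list (cs @ ds) = m * n] (mod K)" using cong_mult[OF cs(3) ds(3)] by simp
  then show ?thesis unfolding rich_product_def using cs(1,2) ds(1,2)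
    by (intro exI[of _ "cs @ ds"]) auto
qed

lemma rich_product_power: "rich_product K a n \<Longrightarrow> rich_product K (a * j) (n ^ j)"
  by (induction j) (auto simp: rich_product_0[unfolded One_nat_def] dest: rich_product_mult)

lemma rich_product_coprime:
  assumes "rich_product K a n"
  shows "coprime n K"
proof -
  obtain cs where cs: "\<forall>c\<in>set cs. rich K c \<and> coprime c K" "[prod_list cs = n] (mod K)"
    using assms(1) unfolding rich_product_def by blast
  have "coprime (prod_list cs) K" using cs(1) by (induction cs) auto
  then show ?thesis using cs(2) cong_imp_coprime by blast
qed

lemma asymp_eq_refl: "asymp_eq K r 0 r"
  by (simp add: asymp_eq_def)

lemma mod_in_unit_classes: "K \<ge> 1 \<Longrightarrow> coprime n K \<Longrightarrow> n mod K \<in> unit_classes K"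
  by (simp add: unit_classes_def coprime_mod_left_iff)

lemma rich_product_asymp_eq:
  assumes K: "K \<ge> 1" and "rich_product K a n" "r \<in> unit_classes K" "s \<in> unit_classes K" "[n * s = r] (mod K)"
  shows "asymp_eq K r a s"
proof -
  obtain cs where cs: "length cs = a" "\<forall>c\<in>set cs. rich K c \<and> coprime c K" "[prod_list cs = n] (mod K)"
    using assms(2) unfolding rich_product_def by blast
  have "[prod_list cs * s = r] (mod K)"
    using cong_mult[OF cs(3) cong_refl[of s]] assms(5) by (rule cong_trans)
  with cs(2) assms(3) have "asymp_eq K r (length cs) s"
  proof (induction cs arbitrary: r)
    case Nil
    then have "r = s" using assms(4) by (auto simp: unit_classes_def cong_def)
    then show ?case by (simp add: asymp_eq_refl)
  next
    case (Cons c cs)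
    define t where "t = (prod_list cs * s) mod K"
    have ts: "[prod_list cs * s = t] (mod K)" by (simp add: t_def cong_def)
    have "coprime (prod_list cs) K" using Cons.prems(1) by (induction cs) auto
    then have t: "t \<in> unit_classes K"
      unfolding t_def using K assms(4) by (intro mod_in_unit_classes) (auto simp: unit_classes_def)
    have "asymp_eq K t (length cs) s" using Cons.prems ts t by (intro Cons.IH) auto
    moreover have "asymp_eq K r 1 t"
    proof (rule rich_asymp_eq[OF K _ _ Cons.prems(2) t])
      have "[c * t = c * (prod_list cs * s)] (mod K)" using ts by (intro cong_mult cong_refl) (rule cong_sym)
      then show "[c * t = r] (mod K)" using Cons.prems(3) by (simp add: mult.assoc) (rule cong_trans)
    qed (use Cons.prems in auto)
    ultimately have "asymp_eq K r (1 + length cs) s" by (intro asymp_eq_trans)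
    then show ?case by simp
  qed
  then show ?thesis using cs by simp
qed

text \<open>The least positive difference \<open>g\<close> of two elements divides every element, by
  division with remainder; the last hypothesis then leaves only \<open>g = 1\<close>.\<close>

lemma numerical_semigroup_consecutive:
  fixes L :: "nat set"
  assumes add: "\<And>a b. a \<in> L \<Longrightarrow> b \<in> L \<Longrightarrow> a + b \<in> L" and "0 \<in> L" and "k \<in> L" "k > 0"
    and nodiv: "\<And>l. prime l \<Longrightarrow> \<exists>a\<in>L. \<not> l dvd a"
  shows "\<exists>a\<in>L. Suc a \<in> L"
proof -
  define g where "g = (LEAST g. g > 0 \<and> (\<exists>a\<in>L. a + g \<in> L))"
  have "k > 0 \<and> (\<exists>a\<in>L. a + k \<in> L)" using assms(2-4) by (intro conjI bexI[of _ 0]) auto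
  then have "g > 0 \<and> (\<exists>a\<in>L. a + g \<in> L)" unfolding g_def by (rule LeastI)
  then obtain b where g: "g > 0" and b: "b \<in> L" "b + g \<in> L" by blast
  have least: "g \<le> h" if "h > 0" "a \<in> L" "a + h \<in> L" for a h
    unfolding g_def using that by (intro Least_le) auto
  have mult: "j * a \<in> L" if "a \<in> L" for a j
    using that assms(2) by (induction j) (auto intro: add)
  have "g dvd l" if "l \<in> L" for l
  proof (rule ccontr)
    assume "\<not> g dvd l"
    then have r: "l mod g > 0" by (auto simp: dvd_eq_mod_eq_0)
    \<comment> \<open>Adding \<open>(l div g) * b\<close> to \<open>l\<close> and taking
      \<open>(l div g) * (b + g)\<close> gives two elements of \<open>L\<close> whose difference is
      the remainder, which is smaller than \<open>g\<close>.\<close>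
    have "(l div g) * (b + g) + l mod g = l + (l div g) * b"
      by (simp add: distrib_left)
    then have "(l div g) * (b + g) + l mod g \<in> L" using that mult b(1) add by simp
    then have "g \<le> l mod g" using r mult[OF b(2)] by (intro least)
    then show False using mod_less_divisor[OF g, of l] by linarith
  qed
  then have "g = 1"
  proof (rule_tac ccontr)
    assume "g \<noteq> 1" and dvd: "\<And>l. l \<in> L \<Longrightarrow> g dvd l"
    then obtain l where "prime l" "l dvd g" using prime_factor_nat by blast
    then show False using nodiv[of l] dvd dvd_trans by blast
  qed
  then show ?thesis using b by auto
qed

section \<open>Representing every unit class by primes from rich classes\<close>

definition poor_primes :: "nat \<Rightarrow> nat set" where
  "poor_primes K = {p. prime p \<and> \<not> (rich K p \<and> coprime p K)}"

text \<open>There are finitely many classes modulo \<open>K\<close>, each class that is not rich has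
  bounded reciprocal sums, and finitely many primes divide \<open>K\<close>.\<close>

lemma poor_primes_bounded:
  assumes "K \<ge> 1"
  obtains B where "\<And>P. finite P \<Longrightarrow> P \<subseteq> poor_primes K \<Longrightarrow> (\<Sum>p\<in>P. 1 / real p) \<le> B"
proof -
  have "\<exists>B. \<forall>P. finite P \<longrightarrow> P \<subseteq> {p. prime p \<and> \<not> rich K p \<and> p mod K = c} \<longrightarrow> (\<Sum>p\<in>P. 1 / real p) \<le> B" for c
  proof (cases "rich K c")
    case True
    have "{p. prime p \<and> \<not> rich K p \<and> p mod K = c} = {}"
      using rich_cong[OF True] by (auto simp: cong_def)
    then have "P = {}" if "P \<subseteq> {p. prime p \<and> \<not> rich K p \<and> p mod K = c}" for P using that by blast
    then show ?thesis by (intro exI[of _ 0] allI impI) (metis order.refl sum.empty)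
  next
    case False
    then obtain B where B: "\<And>P. finite P \<Longrightarrow> \<forall>p\<in>P. prime p \<and> [p = c] (mod K) \<Longrightarrow> (\<Sum>p\<in>P. 1 / real p) < B"
      unfolding rich_def by (meson not_le)
    have "(\<Sum>p\<in>P. 1 / real p) \<le> B" if "finite P" "P \<subseteq> {p. prime p \<and> \<not> rich K p \<and> p mod K = c}" for P
    proof (rule less_imp_le, rule B[OF that(1)], rule ballI)
      fix p assume "p \<in> P"
      then have "prime p" "p mod K = c" using that(2) by auto
      then show "prime p \<and> [p = c] (mod K)" by (auto simp: cong_def)
    qed
    then show ?thesis by blast
  qed
  then obtain B where B: "\<And>c P. finite P \<Longrightarrow> P \<subseteq> {p. prime p \<and> \<not> rich K p \<and> p mod K = c} \<Longrightarrow> (\<Sum>p\<in>P. 1 / real p) \<le> B c"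
    by metis
  show thesis
  proof (rule that[of "(\<Sum>c<K. B c) + (\<Sum>p | p dvd K. 1 / real p)"])
    fix P assume P: "finite P" "P \<subseteq> poor_primes K"
    let ?P1 = "P \<inter> {p. p dvd K}" and ?P2 = "P - {p. p dvd K}"
    have "(\<Sum>p\<in>P. 1 / real p) = (\<Sum>p\<in>?P1. 1 / real p) + (\<Sum>p\<in>?P2. 1 / real p)"
      using P(1) by (simp add: sum.Int_Diff)
    also have "(\<Sum>p\<in>?P1. 1 / real p) \<le> (\<Sum>p | p dvd K. 1 / real p)"
      using assms by (intro sum_mono2) auto
    also have "(\<Sum>p\<in>?P2. 1 / real p) = (\<Sum>c<K. \<Sum>p | p \<in> ?P2 \<and> p mod K = c. 1 / real p)"
      using P assms by (intro sum.group[symmetric]) auto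
    also have "\<dots> \<le> (\<Sum>c<K. B c)"
    proof (intro sum_mono B)
      fix c show "{p. p \<in> ?P2 \<and> p mod K = c} \<subseteq> {p. prime p \<and> \<not> rich K p \<and> p mod K = c}"
        using P(2) by (auto simp: poor_primes_def intro: prime_imp_coprime_nat)
    qed (use P in auto)
    finally show "(\<Sum>p\<in>P. 1 / real p) \<le> (\<Sum>c<K. B c) + (\<Sum>p | p dvd K. 1 / real p)" by simp
  qed
qed

lemma bounded_sums_small_tail:
  fixes f :: "'i \<Rightarrow> real"
  assumes B: "\<And>P. finite P \<Longrightarrow> P \<subseteq> E \<Longrightarrow> sum f P \<le> B" and "\<tau> > 0"
  obtains P0 where "finite P0" "P0 \<subseteq> E" "\<And>P. finite P \<Longrightarrow> P \<subseteq> E - P0 \<Longrightarrow> sum f P \<le> \<tau>"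
proof -
  define S where "S = {sum f P | P. finite P \<and> P \<subseteq> E}"
  have bdd: "bdd_above S" unfolding S_def using B by (intro bdd_aboveI[of _ B]) auto
  have "S \<noteq> {}" unfolding S_def by blast
  then obtain y where "y \<in> S" "y > Sup S - \<tau>"
    using \<open>\<tau> > 0\<close> less_cSupE[of "Sup S - \<tau>" S] by auto
  then obtain P0 where P0: "finite P0" "P0 \<subseteq> E" "sum f P0 > Sup S - \<tau>" unfolding S_def by blast
  show thesis
  proof (rule that[OF P0(1,2)])
    fix P assume P: "finite P" "P \<subseteq> E - P0"
    then have "sum f (P0 \<union> P) \<in> S" unfolding S_def using P0 by blast
    then have "sum f (P0 \<union> P) \<le> Sup S" using bdd by (rule cSup_upper)
    moreover have "sum f (P0 \<union> P) = sum f P0 + sum f P" using P P0 by (intro sum.union_disjoint) auto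
    ultimately show "sum f P \<le> \<tau>" using P0(3) by linarith
  qed
qed

text \<open>The solutions \<open>t\<close> form one residue class modulo \<open>p\<close>, so they
  are separated by \<open>t div p\<close>.\<close>

lemma card_progression_multiples_le:
  fixes u H p :: nat
  assumes "coprime p H" "p > 0"
  shows "card {t\<in>{1..N}. p dvd u + H * t} \<le> N div p + 1"
proof -
  have inj: "inj_on (\<lambda>t. t div p) {t\<in>{1..N}. p dvd u + H * t}"
  proof (rule inj_onI)
    fix t t' assume t: "t \<in> {t\<in>{1..N}. p dvd u + H * t}" "t' \<in> {t\<in>{1..N}. p dvd u + H * t}" "t div p = t' div p"
    then have "[u + H * t = u + H * t'] (mod p)" by (simp add: cong_def dvd_eq_mod_eq_0)
    then have "[H * t = H * t'] (mod p)" by (simp add: cong_add_lcancel_nat)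
    then have "[t = t'] (mod p)"
      using assms(1) by (subst (asm) cong_mult_lcancel_nat) (auto simp: coprime_commute)
    then show "t = t'" using t(3) unfolding cong_def by (metis div_mult_mod_eq)
  qed
  have "(\<lambda>t. t div p) ` {t\<in>{1..N}. p dvd u + H * t} \<subseteq> {..N div p}" by (auto intro: div_le_mono)
  then have "card {t\<in>{1..N}. p dvd u + H * t} \<le> card {..N div p}"
    using inj by (intro card_inj_on_le) auto
  then show ?thesis by simp
qed

text \<open>A union bound. Finitely many primes \<open>P0\<close> are avoided by a congruence to 1,
  after which the rest of \<open>E\<close> has reciprocal sum at most 1/4. Each remaining prime also
  costs a rounding error of 1, so the number of elements of \<open>E\<close> up to the end of the
  progression must be small against its length. This again follows from a small tail of the
  reciprocals.\<close>

lemma progression_avoiding_sparse_primes: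
  fixes K n0 :: nat and E :: "nat set"
  assumes "K \<ge> 1" "coprime n0 K" and E: "\<And>p. p \<in> E \<Longrightarrow> prime p"
    and B: "\<And>P. finite P \<Longrightarrow> P \<subseteq> E \<Longrightarrow> (\<Sum>p\<in>P. 1 / real p) \<le> B"
  obtains n where "n \<ge> 1" "[n = n0] (mod K)" "\<And>p. p \<in> E \<Longrightarrow> \<not> p dvd n"
proof -
  obtain P0 where P0: "finite P0" "P0 \<subseteq> E" "\<And>P. finite P \<Longrightarrow> P \<subseteq> E - P0 \<Longrightarrow> (\<Sum>p\<in>P. 1 / real p) \<le> 1 / 4"
    by (rule bounded_sums_small_tail[OF B, where \<tau> = "1/4"]) auto
  define Q where "Q = \<Prod>(P0 - {p. p dvd K})"
  have cop: "coprime K Q"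
    unfolding Q_def
  proof (rule prod_coprime_right)
    fix p assume "p \<in> P0 - {p. p dvd K}"
    then show "coprime K p" using P0(2) E prime_imp_coprime_nat[of p K] by (auto simp: coprime_commute)
  qed
  have Qpos: "Q \<ge> 1"
  proof -
    have "Q > 0" unfolding Q_def using P0 E by (intro prod_pos) (auto simp: prime_gt_0_nat)
    then show ?thesis by simp
  qed
  obtain u where u: "[u = n0] (mod K)" "[u = 1] (mod Q)"
    using binary_chinese_remainder_nat[OF cop] by blast
  define H where "H = K * Q"
  have H: "H \<ge> 1" using assms Qpos by (simp add: H_def)
  have cu: "coprime u K" "coprime u Q"
    using cong_imp_coprime[OF cong_sym[OF u(1)]] assms(2) cong_imp_coprime[OF cong_sym[OF u(2)]] by auto
  have copH: "coprime p u" if "p dvd H" "prime p" for p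
  proof -
    have "coprime H u" using cu by (simp add: H_def coprime_commute)
    then show ?thesis using that(1) by (meson coprime_divisors dvd_refl)
  qed
  \<comment> \<open>A second tail is needed since the required smallness depends on the modulus
    \<open>H\<close>, which is known only after \<open>P0\<close>.\<close>
  obtain P1 where P1: "finite P1" "P1 \<subseteq> E" "\<And>P. finite P \<Longrightarrow> P \<subseteq> E - P1 \<Longrightarrow> (\<Sum>p\<in>P. 1 / real p) \<le> 1 / (8 * real H)"
    by (rule bounded_sums_small_tail[OF B, where \<tau> = "1 / (8 * real H)"]) (use H in auto)
  \<comment> \<open>The excluded \<open>t\<close> number at most
    \<open>N / 4 + N / 8 + card P1 + u / 8\<close>, which this \<open>N\<close> exceeds.\<close>
  define N where "N = 4 * (card P1 + u + 1)"
  define X where "X = u + H * N"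
  define F where "F = {p\<in>E. p \<le> X \<and> \<not> p dvd H}"
  have finF: "finite F" unfolding F_def by (rule finite_subset[of _ "{..X}"]) auto
  have "real (card (\<Union>p\<in>F. {t\<in>{1..N}. p dvd u + H * t})) \<le> (\<Sum>p\<in>F. real (card {t\<in>{1..N}. p dvd u + H * t}))"
    using card_UN_le[OF finF, of "\<lambda>p. {t\<in>{1..N}. p dvd u + H * t}"] by (simp flip: of_nat_sum)
  also have "\<dots> \<le> (\<Sum>p\<in>F. real N * (1 / real p) + 1)"
  proof (intro sum_mono)
    fix p assume p: "p \<in> F"
    then have "prime p" "\<not> p dvd H" using E by (auto simp: F_def)
    then have "card {t\<in>{1..N}. p dvd u + H * t} \<le> N div p + 1"
      by (intro card_progression_multiples_le prime_imp_coprime_nat) (auto simp: prime_gt_0_nat)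
    then have "real (card {t\<in>{1..N}. p dvd u + H * t}) \<le> real (N div p) + 1" by linarith
    also have "real (N div p) \<le> real N * (1 / real p)" using of_nat_div_le_of_nat[of N p, where 'a=real] by simp
    finally show "real (card {t\<in>{1..N}. p dvd u + H * t}) \<le> real N * (1 / real p) + 1" by simp
  qed
  also have "\<dots> = real N * (\<Sum>p\<in>F. 1 / real p) + real (card F)"
    by (simp add: sum.distrib sum_distrib_left)
  also have "(\<Sum>p\<in>F. 1 / real p) \<le> 1 / 4"
  proof (rule P0(3)[OF finF])
    have "p dvd H" if "p \<in> P0" for p
    proof (cases "p dvd K")
      case False
      then have "p dvd Q" unfolding Q_def using P0(1) that by (intro dvd_prodI) auto
      then show ?thesis by (simp add: H_def)
    qed (simp add: H_def)
    then show "F \<subseteq> E - P0" by (auto simp: F_def)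
  qed
  also have "real (card F) \<le> real (card P1) + real X * (1 / (8 * real H))"
  proof -
    have "card F \<le> card (F - P1) + card P1"
      using card_Un_le[of "F - P1" P1] card_mono[of "F - P1 \<union> P1" F] finF P1(1) by fastforce
    moreover have "real (card (F - P1)) = (\<Sum>p\<in>F - P1. 1)" by simp
    moreover have "\<dots> \<le> (\<Sum>p\<in>F - P1. real X * (1 / real p))"
      using E by (intro sum_mono) (auto simp: F_def field_simps prime_gt_0_nat)
    moreover have "\<dots> = real X * (\<Sum>p\<in>F - P1. 1 / real p)" by (simp add: sum_distrib_left)
    moreover have "\<dots> \<le> real X * (1 / (8 * real H))"
      using finF by (intro mult_left_mono P1(3)) (auto simp: F_def)
    ultimately show ?thesis by linarith
  qed
  also have "real X * (1 / (8 * real H)) \<le> real u / 8 + real N / 8"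
  proof -
    have "real X * (1 / (8 * real H)) = real u / (8 * real H) + real N / 8"
      using H by (simp add: X_def field_simps)
    also have "real u / (8 * real H) \<le> real u / 8" using H by (intro divide_left_mono) auto
    finally show ?thesis by simp
  qed
  finally have "real (card (\<Union>p\<in>F. {t\<in>{1..N}. p dvd u + H * t})) \<le>
      real N * (1 / 4) + (real (card P1) + (real u / 8 + real N / 8))" by (simp add: mult_left_mono)
  also have "\<dots> < real N"
  proof -
    have "real N = 4 * real (card P1) + 4 * real u + 4" by (simp add: N_def)
    then show ?thesis by linarith
  qed
  finally have "card (\<Union>p\<in>F. {t\<in>{1..N}. p dvd u + H * t}) < card {1..N}" by simp
  then have "\<not> {1..N} \<subseteq> (\<Union>p\<in>F. {t\<in>{1..N}. p dvd u + H * t})"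
    using finF card_mono[of "\<Union>p\<in>F. {t\<in>{1..N}. p dvd u + H * t}" "{1..N}"] by fastforce
  then obtain t where t: "t \<in> {1..N}" "\<And>p. p \<in> F \<Longrightarrow> \<not> p dvd u + H * t" by blast
  show thesis
  proof (rule that[of "u + H * t"])
    have "H * t \<ge> 1" using H t by (simp add: Suc_le_eq)
    then show ge: "u + H * t \<ge> 1" by (rule trans_le_add2)
    have "[u + H * t = u] (mod K)" by (simp add: cong_def H_def mult.assoc)
    then show "[u + H * t = n0] (mod K)" using u(1) by (rule cong_trans)
    fix p assume p: "p \<in> E"
    show "\<not> p dvd u + H * t"
    proof
      assume dvd: "p dvd u + H * t"
      have "p \<le> u + H * t" using dvd ge by (intro dvd_imp_le) auto
      also have "\<dots> \<le> X" using t(1) by (simp add: X_def)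
      finally have "p dvd H" using t(2)[of p] dvd p by (auto simp: F_def)
      then have "p dvd u" using dvd dvd_add_left_iff[of p "H * t" u] by simp
      then show False using copH[OF \<open>p dvd H\<close> E[OF p]] E[OF p]
        by (metis coprime_self dvd_refl coprime_divisors not_prime_unit)
    qed
  qed
qed

text \<open>Some integer congruent to \<open>n\<close> has no poor prime factor, and its
  factorization into primes is the desired product. No prime need lie in the class of
  \<open>n\<close> itself, so Dirichlet's theorem is bypassed.\<close>

lemma rich_product_exists:
  assumes "K \<ge> 1" "coprime n K"
  shows "\<exists>a. rich_product K a n"
proof -
  obtain B where B: "\<And>P. finite P \<Longrightarrow> P \<subseteq> poor_primes K \<Longrightarrow> (\<Sum>p\<in>P. 1 / real p) \<le> B"
    using poor_primes_bounded[OF assms(1)] by blast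
  obtain m where m: "m \<ge> 1" "[m = n] (mod K)" "\<And>p. p \<in> poor_primes K \<Longrightarrow> \<not> p dvd m"
    using progression_avoiding_sparse_primes[OF assms, of "poor_primes K" B] B by (auto simp: poor_primes_def)
  have "\<exists>a. rich_product K a m" using m(1,3)
  proof (induction m rule: less_induct)
    case (less m)
    show ?case
    proof (cases "m = 1")
      case True
      then show ?thesis using rich_product_0 by auto
    next
      case False
      then obtain p where p: "prime p" "p dvd m" using prime_factor_nat by blast
      then obtain k where k: "m = p * k" by blast
      have "k \<ge> 1" "k < m" using less.prems(1) k prime_gt_1_nat[OF p(1)] by auto
      moreover have "\<not> q dvd k" if "q \<in> poor_primes K" for q using less.prems(2)[OF that] k by auto
      ultimately obtain a where "rich_product K a k" using less.IH[of k] by blast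
      moreover have "rich_product K 1 p"
        using less.prems(2)[of p] p by (intro rich_product_single) (auto simp: poor_primes_def)
      ultimately show ?thesis using rich_product_mult k by blast
    qed
  qed
  then show ?thesis using m(2) rich_product_cong by blast
qed

section \<open>Dirichlet series of periodic characters\<close>

text \<open>Vanishing over a period expresses that the character is nonprincipal. It bounds all
  partial sums by \<open>K\<close>, from which the control of \<open>L\<close> down to 1
  follows.\<close>

locale periodic_character =
  fixes ch :: "nat \<Rightarrow> complex" and K :: nat
  assumes K: "K \<ge> 1" and one: "ch 1 = 1" and mult: "ch (m * n) = ch m * ch n"
    and periodic: "ch (n + K) = ch n" and norm_le: "norm (ch n) \<le> 1"
    and sum_period: "(\<Sum>n<K. ch n) = 0"
begin

lemma norm_sum_lessThan_le: "norm (\<Sum>n<m. ch n) \<le> real K"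
proof -
  have per: "(\<Sum>n<m + K. ch n) = (\<Sum>n<m. ch n)" for m
    by (induction m) (use sum_period periodic in auto)
  have "(\<Sum>n<q * K + r. ch n) = (\<Sum>n<r. ch n)" for q r
  proof (induction q)
    case (Suc q)
    have eq: "Suc q * K + r = (q * K + r) + K" by simp
    show ?case unfolding eq using per[of "q * K + r"] Suc by simp
  qed simp
  from this[of "m div K" "m mod K"] have "norm (\<Sum>n<m. ch n) = norm (\<Sum>n<m mod K. ch n)" by simp
  also have "\<dots> \<le> (\<Sum>n<m mod K. 1)" by (intro sum_norm_le norm_le)
  also have "\<dots> \<le> real K" using K mod_less_divisor[of K m] by simp
  finally show ?thesis .
qed

text \<open>Abel summation against the bounded partial sums of \<open>ch\<close>. It serves for
  three sequences: \<open>n powr - \<sigma>\<close>, its derivative in \<open>\<sigma>\<close>, and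
  the Lambert defect.\<close>

lemma norm_sum_antimono_le:
  fixes g :: "nat \<Rightarrow> real"
  assumes g: "\<And>n. n \<ge> a \<Longrightarrow> g n \<ge> 0" "\<And>n. n \<ge> a \<Longrightarrow> g (Suc n) \<le> g n" and "a \<le> N"
  shows "norm (\<Sum>n=a..<N. ch n * of_real (g n)) \<le> 2 * real K * g a"
proof -
  define T where "T = (\<lambda>m. \<Sum>n=a..<m. ch n)"
  have T: "norm (T m) \<le> 2 * real K" if "a \<le> m" for m
  proof -
    have "T m = (\<Sum>n<m. ch n) - (\<Sum>n<a. ch n)"
      using that unfolding T_def by (simp add: sum_diff_nat_ivl flip: atLeast0LessThan)
    then have "norm (T m) \<le> norm (\<Sum>n<m. ch n) + norm (\<Sum>n<a. ch n)" by (simp add: norm_triangle_ineq4)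
    then show ?thesis using norm_sum_lessThan_le[of m] norm_sum_lessThan_le[of a] by linarith
  qed
  have "(\<Sum>n=a..<N. ch n * of_real (g n)) = T N * of_real (g N) + (\<Sum>n=a..<N. T (Suc n) * of_real (g n - g (Suc n)))"
    using \<open>a \<le> N\<close>
  proof (induction N rule: dec_induct)
    case (step N)
    have "T (Suc N) = T N + ch N" using step by (simp add: T_def)
    then show ?case using step by (simp add: algebra_simps)
  qed (simp add: T_def)
  also have "norm \<dots> \<le> norm (T N * of_real (g N)) + norm (\<Sum>n=a..<N. T (Suc n) * of_real (g n - g (Suc n)))"
    by (rule norm_triangle_ineq)
  also have "norm (T N * of_real (g N)) \<le> 2 * real K * g N"
    using T[OF \<open>a \<le> N\<close>] g(1)[OF \<open>a \<le> N\<close>] by (simp add: norm_mult mult_right_mono)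
  also have "norm (\<Sum>n=a..<N. T (Suc n) * of_real (g n - g (Suc n))) \<le> (\<Sum>n=a..<N. 2 * real K * (g n - g (Suc n)))"
  proof (intro sum_norm_le)
    fix n assume n: "n \<in> {a..<N}"
    have "norm (T (Suc n) * of_real (g n - g (Suc n))) = norm (T (Suc n)) * (g n - g (Suc n))"
      using g(2)[of n] n by (simp add: norm_mult del: of_real_diff)
    also have "\<dots> \<le> 2 * real K * (g n - g (Suc n))"
      using g(2)[of n] n T[of "Suc n"] by (intro mult_right_mono) auto
    finally show "norm (T (Suc n) * of_real (g n - g (Suc n))) \<le> 2 * real K * (g n - g (Suc n))" .
  qed
  also have "\<dots> = 2 * real K * (g a - g N)"
  proof -
    have "(\<Sum>n=a..<N. g n - g (Suc n)) = g a - g N"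
      using \<open>a \<le> N\<close> by (induction N rule: dec_induct) auto
    then show ?thesis by (simp flip: sum_distrib_left)
  qed
  finally show ?thesis by (simp add: algebra_simps)
qed

definition dterm :: "real \<Rightarrow> nat \<Rightarrow> complex" where
  "dterm \<sigma> n = ch n * of_real (real n powr - \<sigma>)"

definition L :: "real \<Rightarrow> complex" where
  "L \<sigma> = infsum (dterm \<sigma>) {1..}"

lemma dterm_mult: "dterm \<sigma> (m * n) = dterm \<sigma> m * dterm \<sigma> n"
  by (simp add: dterm_def mult powr_mult)

lemma dterm_1: "dterm \<sigma> 1 = 1"
  using one by (simp add: dterm_def)

lemma norm_dterm_le: "norm (dterm \<sigma> n) \<le> real n powr - \<sigma>"
  using norm_le[of n] by (simp add: dterm_def norm_mult mult_left_le_one_le)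

end

section \<open>Euler products obtained by sieving\<close>

lemma summable_on_powr: "\<sigma> > 1 \<Longrightarrow> (\<lambda>n. real n powr - \<sigma>) summable_on A"
proof -
  assume "\<sigma> > 1"
  then have "summable (\<lambda>n. real n powr - \<sigma>)" by (simp add: summable_real_powr_iff)
  then have "(\<lambda>n. real n powr - \<sigma>) summable_on UNIV"
    by (intro norm_summable_imp_summable_on) simp
  then show ?thesis by (rule summable_on_subset) simp
qed

text \<open>The factor \<open>1 - u p\<close> removes from the series exactly the multiples of
  \<open>p\<close>, by complete multiplicativity. The statement is generic in the field because it
  is applied to \<open>L\<close> and to the real zeta series.\<close>

lemma sieve_euler_product:
  fixes u :: "nat \<Rightarrow> 'a :: {real_normed_field, banach}"
  assumes mult: "\<And>m n. u (m * n) = u m * u n" and summ: "\<And>A. u summable_on A"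
    and "finite P" "\<And>p. p \<in> P \<Longrightarrow> prime p"
  shows "infsum u {1..} * (\<Prod>p\<in>P. 1 - u p) = infsum u {n. n \<ge> 1 \<and> (\<forall>p\<in>P. \<not> p dvd n)}"
  using assms(3,4)
proof (induction P rule: finite_induct)
  case empty
  then show ?case by (simp add: atLeast_def)
next
  case (insert p P)
  define A where "A = {n. n \<ge> 1 \<and> (\<forall>p\<in>P. \<not> p dvd n)}"
  define A' where "A' = {n. n \<ge> 1 \<and> (\<forall>p\<in>insert p P. \<not> p dvd n)}"
  have p: "prime p" using insert by simp
  have A: "A = A' \<union> (\<lambda>n. p * n) ` A"
  proof (intro subset_antisym subsetI)
    fix n assume n: "n \<in> A"
    show "n \<in> A' \<union> (\<lambda>n. p * n) ` A"
    proof (cases "p dvd n")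
      case True
      then obtain k where k: "n = p * k" by blast
      with n have "k \<in> A" by (auto simp: A_def Suc_le_eq)
      with k show ?thesis by blast
    qed (use n in \<open>auto simp: A_def A'_def\<close>)
  next
    fix n assume "n \<in> A' \<union> (\<lambda>n. p * n) ` A"
    then consider "n \<in> A'" | k where "n = p * k" "k \<in> A" by blast
    then show "n \<in> A"
    proof cases
      case 2
      have "\<not> q dvd p * k" if "q \<in> P" for q
      proof
        assume "q dvd p * k"
        moreover have "prime q" using insert that by auto
        ultimately have "q dvd p \<or> q dvd k" by (simp add: prime_dvd_mult_iff)
        moreover have "\<not> q dvd p" using primes_dvd_imp_eq[OF \<open>prime q\<close> p] insert that by blast
        ultimately show False using 2 that by (auto simp: A_def)
      qed
      then show ?thesis using 2 p prime_gt_0_nat[OF p] by (auto simp: A_def)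
    qed (auto simp: A_def A'_def)
  qed
  have disj: "A' \<inter> (\<lambda>n. p * n) ` A = {}" by (auto simp: A'_def)
  have "infsum u A = infsum u A' + infsum u ((\<lambda>n. p * n) ` A)"
    using infsum_Un_disjoint[OF summ summ disj] A by simp
  also have "infsum u ((\<lambda>n. p * n) ` A) = infsum (\<lambda>n. u (p * n)) A"
    using prime_gt_0_nat[OF p] by (subst infsum_reindex) (auto simp: inj_on_def o_def)
  also have "\<dots> = u p * infsum u A" by (simp add: mult infsum_cmult_right')
  finally have eq: "infsum u A = infsum u A' + u p * infsum u A" .
  have "infsum u A * (1 - u p) = infsum u A - u p * infsum u A" by (simp add: right_diff_distrib mult.commute)
  also have "\<dots> = infsum u A'" by (subst (1) eq) simp
  finally have "infsum u A * (1 - u p) = infsum u A'" .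
  moreover have "infsum u {1..} * (\<Prod>p\<in>P. 1 - u p) = infsum u A"
    unfolding A_def using insert.prems by (intro insert.IH) simp
  ultimately have "(infsum u {1..} * (\<Prod>p\<in>P. 1 - u p)) * (1 - u p) = infsum u A'" by simp
  moreover have "(\<Prod>p\<in>insert p P. 1 - u p) = (\<Prod>p\<in>P. 1 - u p) * (1 - u p)"
    using insert.hyps by simp
  ultimately show ?case unfolding A'_def by (metis mult.assoc)
qed

text \<open>After sieving by all primes up to \<open>y\<close>, only the term 1 and terms with
  \<open>n \<ge> y\<close> remain, and the latter lie in the tail of a convergent series.\<close>

lemma sieve_euler_product_tendsto:
  fixes u :: "nat \<Rightarrow> complex"
  assumes mult: "\<And>m n. u (m * n) = u m * u n" and "u 1 = 1" and \<sigma>: "\<sigma> > 1"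
    and le: "\<And>n. norm (u n) \<le> real n powr - \<sigma>"
  shows "(\<lambda>y. infsum u {1..} * (\<Prod>p | prime p \<and> p \<le> y. 1 - u p)) \<longlonglongrightarrow> 1"
proof -
  have abs: "(\<lambda>n. norm (u n)) summable_on A" for A
    using le by (intro summable_on_comparison_test[OF summable_on_powr[OF \<sigma>]]) auto
  then have summ: "u summable_on A" for A by (rule abs_summable_summable)
  define g where "g = (\<lambda>n. real n powr - \<sigma>)"
  have sg: "summable g" using \<sigma> by (simp add: g_def summable_real_powr_iff)
  have bound: "norm (infsum u {1..} * (\<Prod>p | prime p \<and> p \<le> y. 1 - u p) - 1) \<le> (\<Sum>n. g (n + y))" for y
  proof -
    let ?A = "{n. n \<ge> 1 \<and> (\<forall>p\<in>{p. prime p \<and> p \<le> y}. \<not> p dvd n)}"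
    have "infsum u {1..} * (\<Prod>p | prime p \<and> p \<le> y. 1 - u p) = infsum u ?A"
      by (intro sieve_euler_product mult summ) auto
    also have "?A = insert 1 (?A - {1})" by (auto dest: prime_gt_1_nat)
    also have "infsum u (insert 1 (?A - {1})) = 1 + infsum u (?A - {1})"
      using summ assms(2) by (subst infsum_insert) auto
    finally have "norm (infsum u {1..} * (\<Prod>p | prime p \<and> p \<le> y. 1 - u p) - 1) = norm (infsum u (?A - {1}))"
      by simp
    also have "\<dots> \<le> infsum (\<lambda>n. norm (u n)) (?A - {1})" by (rule norm_infsum_bound[OF abs])
    also have "\<dots> \<le> infsum g {y..}"
    proof (intro infsum_mono_neutral abs)
      show "g summable_on {y..}" using summable_on_powr[OF \<sigma>] by (simp add: g_def)
      have "n \<ge> y" if n: "n \<in> ?A - {1}" for n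
      proof (rule ccontr)
        assume "\<not> n \<ge> y"
        obtain p where p: "prime p" "p dvd n" using n prime_factor_nat[of n] by auto
        then have "p \<le> n" using n by (auto intro: dvd_imp_le)
        then show False using p n \<open>\<not> n \<ge> y\<close> by auto
      qed
      then show "norm (u n) \<le> 0" if "n \<in> (?A - {1}) - {y..}" for n using that by auto
    qed (use le in \<open>auto simp: g_def\<close>)
    also have "{y..} = (\<lambda>n. n + y) ` UNIV" by (auto simp: image_iff intro: le_Suc_ex simp: nat_le_iff_add add.commute)
    also have "infsum g ((\<lambda>n. n + y) ` UNIV) = infsum (\<lambda>n. g (n + y)) UNIV"
      by (subst infsum_reindex) (auto simp: o_def)
    also have "\<dots> = (\<Sum>n. g (n + y))"
  proof (rule infsumI, rule sums_nonneg_imp_has_sum, rule summable_sums)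
      show "summable (\<lambda>n. g (n + y))" using sg summable_iff_shift by blast
    qed (simp add: g_def)
    finally show ?thesis .
  qed
  have "(\<lambda>y. \<Sum>n. g (n + y)) \<longlonglongrightarrow> 0" using suminf_exist_split2[OF sg] .
  then have "(\<lambda>y. infsum u {1..} * (\<Prod>p | prime p \<and> p \<le> y. 1 - u p) - 1) \<longlonglongrightarrow> 0"
    by (rule Lim_null_comparison[rotated]) (use bound in auto)
  then show ?thesis by (simp add: LIM_zero_iff)
qed

context periodic_character
begin

lemma dterm_le_inverse:
  assumes "\<sigma> \<ge> 1" "n \<ge> 1"
  shows "real n powr - \<sigma> \<le> 1 / real n"
proof -
  have "real n powr - \<sigma> \<le> real n powr - 1" using assms by (intro powr_mono) auto
  then show ?thesis using assms by (simp add: powr_minus_divide)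
qed

lemma abs_summable_dterm: "\<sigma> > 1 \<Longrightarrow> (\<lambda>n. norm (dterm \<sigma> n)) summable_on A"
  by (rule summable_on_comparison_test[OF summable_on_powr[of \<sigma>]]) (auto simp: norm_dterm_le)

text \<open>The unordered sum \<open>L\<close> is rewritten as a limit of partial sums in the
  natural order, since the cancellation in \<open>ch\<close> is visible only there.\<close>

lemma L_limit:
  assumes "\<sigma> > 1"
  shows "(\<lambda>N. \<Sum>n=1..<N. dterm \<sigma> n) \<longlonglongrightarrow> L \<sigma>"
proof -
  have d0: "dterm \<sigma> n = 0" if "\<not> 1 \<le> n" for n using that by (simp add: dterm_def not_le)
  have "(dterm \<sigma> has_sum L \<sigma>) {1..}"
    unfolding L_def by (rule has_sum_infsum[OF abs_summable_summable[OF abs_summable_dterm[OF assms]]])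
  moreover have "(dterm \<sigma> has_sum L \<sigma>) {1..} \<longleftrightarrow> (dterm \<sigma> has_sum L \<sigma>) UNIV"
    by (rule has_sum_cong_neutral) (auto simp: d0)
  ultimately have "(dterm \<sigma> has_sum L \<sigma>) UNIV" by blast
  then have "(\<lambda>N. \<Sum>n<N. dterm \<sigma> n) \<longlonglongrightarrow> L \<sigma>"
    using has_sum_imp_sums sums_def by blast
  moreover have "(\<Sum>n<N. dterm \<sigma> n) = (\<Sum>n=1..<N. dterm \<sigma> n)" for N
    by (rule sum.mono_neutral_right) (auto simp: d0)
  ultimately show ?thesis by simp
qed

lemma norm_dterm_tail_le:
  assumes "\<sigma> \<ge> 1" "a \<ge> 1" "a \<le> N"
  shows "norm (\<Sum>n=a..<N. dterm \<sigma> n) \<le> 2 * real K / real a"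
proof -
  have "norm (\<Sum>n=a..<N. ch n * of_real (real n powr - \<sigma>)) \<le> 2 * real K * real a powr - \<sigma>"
    using assms by (intro norm_sum_antimono_le) (auto intro!: powr_mono2')
  also have "\<dots> \<le> 2 * real K * (1 / real a)" using assms by (intro mult_left_mono dterm_le_inverse) auto
  finally show ?thesis by (simp add: dterm_def)
qed

text \<open>The derivatives of the partial sums are bounded uniformly in their length and in
  \<open>s \<ge> 1\<close>, again by Abel summation. The mean value inequality is applied to finite
  sums only, and the limit is taken last.\<close>

lemma L_lipschitz:
  obtains C where "C > 0" "\<And>\<sigma> \<tau>. 1 < \<sigma> \<Longrightarrow> 1 < \<tau> \<Longrightarrow> norm (L \<sigma> - L \<tau>) \<le> C * \<bar>\<sigma> - \<tau>\<bar>"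
proof -
  define C where "C = 2 + 2 * real K"
  have C: "C > 0" by (simp add: C_def)
  define d where "d = (\<lambda>s n. ch n * of_real (- ln (real n) * real n powr - s))"
  have deriv: "((\<lambda>s. dterm s n) has_vector_derivative d s n) (at s)" if "n \<ge> 1" for n s
  proof -
    have "((\<lambda>s. real n powr - s) has_real_derivative - ln (real n) * real n powr - s) (at s)"
      using that by (auto intro!: derivative_eq_intros)
    then show ?thesis unfolding dterm_def d_def
      by (intro has_vector_derivative_mult_right has_vector_derivative_of_real)
         (simp add: has_real_derivative_iff_has_vector_derivative)
  qed
  have dbound: "norm (\<Sum>n=1..<N. d s n) \<le> C" if s: "s \<ge> 1" for s N
  proof -
    have small: "norm (d s n) \<le> 1" if "n \<ge> 1" for n
    proof -
      have "norm (d s n) \<le> 1 * (ln (real n) * real n powr - s)"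
        unfolding d_def norm_mult norm_of_real using that norm_le[of n] by (intro mult_mono) (auto simp: abs_mult)
      also have "\<dots> \<le> ln (real n) * (1 / real n)"
        using mult_left_mono[OF dterm_le_inverse[OF s that], of "ln (real n)"] that by simp
      also have "\<dots> \<le> 1" using that ln_bound[of "real n"] by simp
      finally show ?thesis .
    qed
    show ?thesis
    proof (cases "N \<le> 3")
      case True
      have "norm (\<Sum>n=1..<N. d s n) \<le> (\<Sum>n=1..<N. 1)" using small by (intro sum_norm_le) auto
      then show ?thesis using True by (simp add: C_def)
    next
      case False
      \<comment> \<open>The sequence \<open>ln n * n powr - s\<close> is certain to decrease only
        beyond \<open>exp 1\<close>, hence the start at 3. The two terms left out are at most 1
        each, which is the 2 in \<open>C\<close>.\<close>
      have "norm (\<Sum>n=3..<N. ch n * of_real (ln (real n) * real n powr - s)) \<le> 2 * real K * (ln (real 3) * real 3 powr - s)"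
      proof (rule norm_sum_antimono_le)
        fix n :: nat assume n: "n \<ge> 3"
        show "0 \<le> ln (real n) * real n powr - s" using n by simp
        have eq: "ln (real m) * real m powr - s = ln (real m) / real m * real m powr (1 - s)" if "m \<ge> 1" for m
          using that by (simp add: powr_diff powr_minus divide_simps)
        show "ln (real (Suc n)) * real (Suc n) powr - s \<le> ln (real n) * real n powr - s"
        proof -
          have "ln (real (Suc n)) / real (Suc n) * real (Suc n) powr (1 - s) \<le> ln (real n) / real n * real n powr (1 - s)"
          proof (intro mult_mono)
            show "ln (real (Suc n)) / real (Suc n) \<le> ln (real n) / real n"
              using n by (intro ln_over_self_antimono) auto
            show "real (Suc n) powr (1 - s) \<le> real n powr (1 - s)"
              using n s by (intro powr_mono2') auto
          qed (use n in auto)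
          then show ?thesis using eq[of "Suc n"] eq[of n] n by simp
        qed
      qed (use False in auto)
      also have "\<dots> \<le> 2 * real K * 1"
      proof (intro mult_left_mono)
        have "ln (real 3) * real 3 powr - s \<le> ln (real 3) * (1 / real 3)"
          using s by (intro mult_left_mono dterm_le_inverse) auto
        also have "\<dots> \<le> 1" using ln_bound[of "3::real"] by simp
        finally show "ln (real 3) * real 3 powr - s \<le> 1" .
      qed auto
      also have "(\<Sum>n=3..<N. ch n * of_real (ln (real n) * real n powr - s)) = - (\<Sum>n=3..<N. d s n)"
        by (simp add: d_def sum_negf)
      finally have "norm (\<Sum>n=3..<N. d s n) \<le> 2 * real K" by simp
      moreover have "(\<Sum>n=1..<N. d s n) = d s 1 + d s 2 + (\<Sum>n=3..<N. d s n)"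
        using False by (simp add: sum.atLeast_Suc_lessThan numeral_2_eq_2 numeral_3_eq_3)
      moreover have "norm (d s 1 + d s 2 + (\<Sum>n=3..<N. d s n)) \<le> norm (d s 1) + norm (d s 2) + norm (\<Sum>n=3..<N. d s n)"
        by (meson add_mono norm_triangle_ineq order_refl order_trans)
      ultimately show ?thesis using small[of 1] small[of 2] by (simp add: C_def)
    qed
  qed
  have fin: "norm ((\<Sum>n=1..<N. dterm \<sigma> n) - (\<Sum>n=1..<N. dterm \<tau> n)) \<le> C * \<bar>\<sigma> - \<tau>\<bar>"
    if "1 < \<sigma>" "1 < \<tau>" for N \<sigma> \<tau>
  proof -
    have "norm ((\<Sum>n=1..<N. dterm \<sigma> n) - (\<Sum>n=1..<N. dterm \<tau> n)) \<le> C * norm (\<sigma> - \<tau>)"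
    proof (rule differentiable_bound[where S = "{1<..}" and f' = "\<lambda>s h. h *\<^sub>R (\<Sum>n=1..<N. d s n)"])
      fix s :: real assume s: "s \<in> {1<..}"
      have "((\<lambda>s. \<Sum>n=1..<N. dterm s n) has_vector_derivative (\<Sum>n=1..<N. d s n)) (at s)"
        by (intro has_vector_derivative_sum deriv) auto
      then show "((\<lambda>s. \<Sum>n=1..<N. dterm s n) has_derivative (\<lambda>h. h *\<^sub>R (\<Sum>n=1..<N. d s n))) (at s within {1<..})"
        by (auto simp: has_vector_derivative_def intro: has_derivative_at_withinI)
      show "onorm (\<lambda>h. h *\<^sub>R (\<Sum>n=1..<N. d s n)) \<le> C"
        using dbound[of s N] s by (intro onorm_le) (auto simp: mult.commute[of C] intro!: mult_left_mono)
    qed (use that in auto)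
    then show ?thesis by simp
  qed
  show thesis
  proof (rule that[OF C])
    fix \<sigma> \<tau> :: real assume st: "1 < \<sigma>" "1 < \<tau>"
    have "(\<lambda>N. norm ((\<Sum>n=1..<N. dterm \<sigma> n) - (\<Sum>n=1..<N. dterm \<tau> n))) \<longlonglongrightarrow> norm (L \<sigma> - L \<tau>)"
      using st by (intro tendsto_norm tendsto_diff L_limit)
    then show "norm (L \<sigma> - L \<tau>) \<le> C * \<bar>\<sigma> - \<tau>\<bar>"
      using fin[OF st] by (intro LIMSEQ_le_const2) auto
  qed
qed

end

text \<open>Comparison with the integral of \<open>z powr - \<sigma>\<close>, in telescoping form
  through the mean value theorem.\<close>

lemma zeta_bounds:
  assumes "\<sigma> > 1" "\<sigma> \<le> 2"
  shows "infsum (\<lambda>n. real n powr - \<sigma>) {1..} \<le> 2 / (\<sigma> - 1)"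
proof -
  have term_le: "real (Suc n) powr - \<sigma> \<le> (real n powr (1 - \<sigma>) - real (Suc n) powr (1 - \<sigma>)) / (\<sigma> - 1)" if n: "n \<ge> 1" for n
  proof -
    have "\<exists>z>real n. z < real (Suc n) \<and>
      real (Suc n) powr (1 - \<sigma>) - real n powr (1 - \<sigma>) = (real (Suc n) - real n) * ((1 - \<sigma>) * z powr (- \<sigma>))"
      using n by (intro MVT2) (auto intro!: derivative_eq_intros)
    then obtain z where z: "z > real n" "z < real (Suc n)"
      "real (Suc n) powr (1 - \<sigma>) - real n powr (1 - \<sigma>) = (1 - \<sigma>) * z powr (- \<sigma>)" by auto
    have "real (Suc n) powr - \<sigma> \<le> z powr - \<sigma>" using z n assms by (intro powr_mono2') auto
    also have "\<dots> = (real n powr (1 - \<sigma>) - real (Suc n) powr (1 - \<sigma>)) / (\<sigma> - 1)"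
      using z(3) assms by (simp add: field_simps)
    finally show ?thesis .
  qed
  have part: "(\<Sum>n=1..Suc N. real n powr - \<sigma>) \<le> 1 + (1 - real (Suc N) powr (1 - \<sigma>)) / (\<sigma> - 1)" for N
  proof (induction N)
    case (Suc N)
    then show ?case using term_le[of "Suc N"] by (simp add: diff_divide_distrib del: of_nat_Suc)
  qed simp
  have fin: "(\<Sum>n\<in>F. real n powr - \<sigma>) \<le> 2 / (\<sigma> - 1)" if F: "finite F" "F \<subseteq> {1..}" for F
  proof -
    have "F \<subseteq> {1..Suc (Max (insert 0 F))}" using F by (auto simp: le_SucI)
    then have "(\<Sum>n\<in>F. real n powr - \<sigma>) \<le> (\<Sum>n=1..Suc (Max (insert 0 F)). real n powr - \<sigma>)"
      by (intro sum_mono2) auto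
    also have "\<dots> \<le> 1 + (1 - real (Suc (Max (insert 0 F))) powr (1 - \<sigma>)) / (\<sigma> - 1)" by (rule part)
    also have "\<dots> \<le> 1 + 1 / (\<sigma> - 1)" using assms by (intro add_left_mono divide_right_mono) auto
    also have "1 + 1 / (\<sigma> - 1) = \<sigma> / (\<sigma> - 1)" using assms by (simp add: field_simps)
    also have "\<dots> \<le> 2 / (\<sigma> - 1)" using assms by (intro divide_right_mono) auto
    finally show ?thesis .
  qed
  show ?thesis
    using summable_on_powr[OF assms(1)] fin by (intro infsum_le_finite_sums) auto
qed

text \<open>For modulus 1 the first components of the matchings are just distinct primes.\<close>

lemma prime_reciprocals_unbounded: "\<exists>P. finite P \<and> (\<forall>p\<in>P. prime p) \<and> (\<Sum>p\<in>P. 1 / real p) \<ge> B"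
proof -
  obtain \<delta> :: real where "\<delta> > 0" "\<And>B. \<exists>M. prime_matching 1 \<delta> 1 M \<and> (\<Sum>(p, q)\<in>M. 1 / real p) \<ge> B"
    using prime_matchings_exist[OF order_refl zero_less_one] by blast
  then obtain M where M: "prime_matching 1 \<delta> 1 M" "(\<Sum>(p, q)\<in>M. 1 / real p) \<ge> B" by blast
  have "(\<Sum>p\<in>fst ` M. 1 / real p) = (\<Sum>(p, q)\<in>M. 1 / real p)"
    using M(1) by (simp add: prime_matching_def sum.reindex case_prod_unfold)
  then show ?thesis using M by (intro exI[of _ "fst ` M"]) (auto simp: prime_matching_def case_prod_unfold)
qed

section \<open>Order of vanishing at 1 when almost all primes have the same character value\<close>

context periodic_character
begin

context
  fixes \<zeta> :: complex and E :: "nat set" and B :: real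
  assumes good: "\<And>p. prime p \<Longrightarrow> p \<notin> E \<Longrightarrow> ch p = \<zeta>"
    and bad: "\<And>P. finite P \<Longrightarrow> P \<subseteq> E \<Longrightarrow> (\<Sum>p\<in>P. 1 / real p) \<le> B"
    and \<zeta>: "norm \<zeta> = 1" "Re \<zeta> < 0"
begin

lemma Re_zeta_ge: "- Re \<zeta> \<le> 1"
  using abs_Re_le_cmod[of \<zeta>] \<zeta> by linarith

lemma prime_powr_bounds:
  assumes "prime p" "\<sigma> > 1"
  shows "real p powr - \<sigma> > 0" "real p powr - \<sigma> \<le> 1 / real p" "real p powr - \<sigma> \<le> 1 / 2"
proof -
  have p: "p \<ge> 2" using assms by (auto dest: prime_ge_2_nat)
  then show "real p powr - \<sigma> > 0" by simp
  show 1: "real p powr - \<sigma> \<le> 1 / real p" using p assms by (intro dterm_le_inverse) auto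
  have "1 / real p \<le> 1 / 2" using p by (intro divide_left_mono) auto
  with 1 show "real p powr - \<sigma> \<le> 1 / 2" by linarith
qed

lemma norm_good_factor:
  fixes x :: real
  assumes "x \<ge> 0"
  shows "(norm (1 - \<zeta> * of_real x))\<^sup>2 = 1 + 2 * (- Re \<zeta>) * x + x\<^sup>2"
proof -
  have "(Re \<zeta>)\<^sup>2 + (Im \<zeta>)\<^sup>2 = 1" using \<zeta>(1) cmod_power2[of \<zeta>] by simp
  then have "x\<^sup>2 * ((Re \<zeta>)\<^sup>2 + (Im \<zeta>)\<^sup>2) = x\<^sup>2" by simp
  moreover have "(norm (1 - \<zeta> * of_real x))\<^sup>2 = (1 - Re \<zeta> * x)\<^sup>2 + (Im \<zeta> * x)\<^sup>2" by (simp add: cmod_power2)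
  ultimately show ?thesis by (simp add: power2_eq_square algebra_simps)
qed

text \<open>At a good prime the squared norm \<open>1 + 2 * \<kappa> * x + x ^ 2\<close>, with
  \<open>\<kappa> = - Re \<zeta>\<close>, is at least the square of \<open>1 + \<kappa> * x\<close>.
  Halving the exponent is harmless, because this bound serves only to show that \<open>L\<close>
  tends to 0. Bad primes cost a bounded factor altogether.\<close>

lemma factor_lower:
  assumes "prime p" "\<sigma> > 1"
  defines "x \<equiv> real p powr - \<sigma>"
  shows "norm (1 - dterm \<sigma> p) \<ge> exp (- Re \<zeta> / 2 * x - (if p \<in> E then 3 * (1 / real p) else 0))"
proof (cases "p \<in> E")
  case True
  have x: "x > 0" "x \<le> 1 / real p" "x \<le> 1 / 2" using prime_powr_bounds[OF assms(1,2)] by (auto simp: x_def)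
  have "- Re \<zeta> / 2 * x \<le> 1 * x" using Re_zeta_ge x by (intro mult_right_mono) auto
  then have "exp (- Re \<zeta> / 2 * x - (if p \<in> E then 3 * (1 / real p) else 0)) \<le> exp (- 2 * x)"
    using True x by simp
  also have "\<dots> \<le> 1 - x"
  proof -
    have "1 \<le> (1 - x) * (1 + 2 * x)" using x by (simp add: algebra_simps mult_left_le)
    also have "\<dots> \<le> (1 - x) * exp (2 * x)" using x exp_ge_add_one_self[of "2 * x"] by (intro mult_left_mono) auto
    finally show ?thesis by (simp add: exp_minus field_simps)
  qed
  also have "\<dots> \<le> 1 - norm (dterm \<sigma> p)" using norm_dterm_le[of \<sigma> p] by (simp add: x_def)
  also have "\<dots> \<le> norm (1 - dterm \<sigma> p)" using norm_triangle_ineq2[of 1 "dterm \<sigma> p"] by simp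
  finally show ?thesis .
next
  case False
  have x: "x > 0" "x \<le> 1 / 2" using prime_powr_bounds[OF assms(1,2)] by (auto simp: x_def)
  define \<kappa> where "\<kappa> = - Re \<zeta>"
  have \<kappa>: "0 < \<kappa>" "\<kappa> \<le> 1" using \<zeta> Re_zeta_ge by (auto simp: \<kappa>_def)
  have kx: "0 \<le> \<kappa> * x" "\<kappa> * x \<le> 1" using \<kappa> x mult_mono[of \<kappa> 1 x 1] by auto
  have d: "dterm \<sigma> p = \<zeta> * of_real x" using good[OF assms(1) False] by (simp add: dterm_def x_def)
  have "exp (\<kappa> * x / 2) \<le> 1 + \<kappa> * x"
  proof -
    have "exp (\<kappa> * x / 2) \<le> 1 + \<kappa> * x / 2 + (\<kappa> * x / 2)\<^sup>2" using kx by (intro exp_bound) auto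
    also have "(\<kappa> * x / 2)\<^sup>2 \<le> \<kappa> * x / 2 * 1" unfolding power2_eq_square using kx by (intro mult_left_mono) auto
    finally show ?thesis by simp
  qed
  also have "\<dots> \<le> norm (1 - \<zeta> * of_real x)"
  proof (rule power2_le_imp_le)
    have "\<kappa>\<^sup>2 * x\<^sup>2 \<le> 1 * x\<^sup>2" using \<kappa> by (intro mult_right_mono) (auto simp: power2_eq_square mult_le_one)
    then show "(1 + \<kappa> * x)\<^sup>2 \<le> (norm (1 - \<zeta> * of_real x))\<^sup>2"
      using x by (subst norm_good_factor) (auto simp: \<kappa>_def[symmetric] power2_eq_square algebra_simps)
  qed simp
  finally show ?thesis using False unfolding d by (simp add: \<kappa>_def)
qed

text \<open>In contrast to the lower estimate, the coefficient \<open>- Re \<zeta>\<close> must stay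
  exact here: it becomes the order of vanishing that is compared with 1.\<close>

lemma factor_upper:
  assumes "prime p" "\<sigma> > 1"
  defines "x \<equiv> real p powr - \<sigma>"
  shows "norm (1 - dterm \<sigma> p) \<le> exp (- Re \<zeta> * x + (1 / real p)\<^sup>2 + (if p \<in> E then 1 / real p else 0))"
proof (cases "p \<in> E")
  case True
  have x: "x > 0" "x \<le> 1 / real p" "x \<le> 1 / 2" using prime_powr_bounds[OF assms(1,2)] by (auto simp: x_def)
  have "norm (1 - dterm \<sigma> p) \<le> 1 + norm (dterm \<sigma> p)" using norm_triangle_ineq4[of 1 "dterm \<sigma> p"] by simp
  also have "\<dots> \<le> 1 + x" using norm_dterm_le[of \<sigma> p] by (simp add: x_def)
  also have "\<dots> \<le> exp x" by (rule exp_ge_add_one_self)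
  also have "\<dots> \<le> exp (- Re \<zeta> * x + (1 / real p)\<^sup>2 + 1 / real p)"
    using x \<zeta> mult_nonneg_nonneg[of "- Re \<zeta>" x] zero_le_power2[of "1 / real p"]
    unfolding exp_le_cancel_iff by linarith
  finally show ?thesis using True by simp
next
  case False
  have x: "x > 0" "x \<le> 1 / real p" using prime_powr_bounds[OF assms(1,2)] by (auto simp: x_def)
  have d: "dterm \<sigma> p = \<zeta> * of_real x" using good[OF assms(1) False] by (simp add: dterm_def x_def)
  have "norm (1 - \<zeta> * of_real x) \<le> exp (- Re \<zeta> * x + x\<^sup>2)"
  proof (rule power2_le_imp_le)
    have "(norm (1 - \<zeta> * of_real x))\<^sup>2 \<le> 1 + (2 * (- Re \<zeta>) * x + 2 * x\<^sup>2)"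
      using x by (subst norm_good_factor) auto
    also have "\<dots> \<le> exp (2 * (- Re \<zeta>) * x + 2 * x\<^sup>2)" by (rule exp_ge_add_one_self)
    also have "\<dots> = (exp (- Re \<zeta> * x + x\<^sup>2))\<^sup>2" by (simp add: algebra_simps flip: exp_double)
    finally show "(norm (1 - \<zeta> * of_real x))\<^sup>2 \<le> (exp (- Re \<zeta> * x + x\<^sup>2))\<^sup>2" .
  qed simp
  also have "\<dots> \<le> exp (- Re \<zeta> * x + (1 / real p)\<^sup>2)" using x by (simp add: power_mono del: power_divide)
  finally show ?thesis using False unfolding d by simp
qed

lemma sum_bad_le: "(\<Sum>p | prime p \<and> p \<le> y. if p \<in> E then c * (1 / real p) else 0) \<le> c * B" if "c \<ge> 0"
proof -
  have "(\<Sum>p | prime p \<and> p \<le> y. if p \<in> E then c * (1 / real p) else 0)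
      = c * (\<Sum>p\<in>{p. prime p \<and> p \<le> y} \<inter> E. 1 / real p)"
    by (subst sum.inter_restrict) (auto simp: sum_distrib_left intro!: sum.cong)
  also have "\<dots> \<le> c * B" using that by (intro mult_left_mono bad) auto
  finally show ?thesis .
qed

lemma euler_product_L:
  assumes "\<sigma> > 1"
  shows "(\<lambda>y. norm (L \<sigma>) * (\<Prod>p | prime p \<and> p \<le> y. norm (1 - dterm \<sigma> p))) \<longlonglongrightarrow> 1"
proof -
  have "(\<lambda>y. L \<sigma> * (\<Prod>p | prime p \<and> p \<le> y. 1 - dterm \<sigma> p)) \<longlonglongrightarrow> 1"
    unfolding L_def by (rule sieve_euler_product_tendsto[OF dterm_mult dterm_1 assms norm_dterm_le])
  from tendsto_norm[OF this] show ?thesis by (simp add: norm_mult prod_norm)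
qed

lemma norm_L_upper:
  assumes \<sigma>: "\<sigma> > 1" and P: "finite P" "\<And>p. p \<in> P \<Longrightarrow> prime p"
  shows "norm (L \<sigma>) * exp (- Re \<zeta> / 2 * (\<Sum>p\<in>P. real p powr - \<sigma>) - 3 * B) \<le> 1"
proof (rule tendsto_lowerbound[OF euler_product_L[OF \<sigma>]])
  have "\<forall>\<^sub>F y in sequentially. y \<ge> Max (insert 0 P)" by (rule eventually_ge_at_top)
  then show "\<forall>\<^sub>F y in sequentially. norm (L \<sigma>) * exp (- Re \<zeta> / 2 * (\<Sum>p\<in>P. real p powr - \<sigma>) - 3 * B)
    \<le> norm (L \<sigma>) * (\<Prod>p | prime p \<and> p \<le> y. norm (1 - dterm \<sigma> p))"
  proof eventually_elim
    case (elim y)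
    let ?S = "{p. prime p \<and> p \<le> y}"
    have sub: "P \<subseteq> ?S" using elim P by (auto dest: Max_ge[of "insert 0 P"])
    have "- Re \<zeta> / 2 * (\<Sum>p\<in>P. real p powr - \<sigma>) \<le> - Re \<zeta> / 2 * (\<Sum>p\<in>?S. real p powr - \<sigma>)"
      using \<zeta> sub by (intro mult_left_mono sum_mono2) auto
    then have "- Re \<zeta> / 2 * (\<Sum>p\<in>P. real p powr - \<sigma>) - 3 * B \<le>
        - Re \<zeta> / 2 * (\<Sum>p\<in>?S. real p powr - \<sigma>) - (\<Sum>p\<in>?S. if p \<in> E then 3 * (1 / real p) else 0)"
      using sum_bad_le[of 3 y] by simp
    also have "\<dots> = (\<Sum>p\<in>?S. - Re \<zeta> / 2 * real p powr - \<sigma> - (if p \<in> E then 3 * (1 / real p) else 0))"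
      by (simp add: sum_subtractf sum_distrib_left)
    finally have "exp (- Re \<zeta> / 2 * (\<Sum>p\<in>P. real p powr - \<sigma>) - 3 * B) \<le>
        (\<Prod>p\<in>?S. exp (- Re \<zeta> / 2 * real p powr - \<sigma> - (if p \<in> E then 3 * (1 / real p) else 0)))"
      by (simp flip: exp_sum)
    also have "\<dots> \<le> (\<Prod>p\<in>?S. norm (1 - dterm \<sigma> p))"
      using \<sigma> by (intro prod_mono conjI factor_lower) auto
    finally show ?case by (intro mult_left_mono) auto
  qed
qed simp

text \<open>A finite set of primes with large reciprocal sum is fixed first. Its sum of
  \<open>p powr - \<sigma>\<close> is continuous in \<open>\<sigma>\<close> and hence still large
  near 1, which makes \<open>norm (L \<sigma>)\<close> small.\<close>

lemma L_tendsto_0: "(L \<longlongrightarrow> 0) (at_right 1)"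
proof (rule tendstoI)
  fix e :: real assume e: "e > 0"
  define \<kappa> where "\<kappa> = - Re \<zeta>"
  have \<kappa>: "\<kappa> > 0" using \<zeta> by (simp add: \<kappa>_def)
  define T where "T = 2 / \<kappa> * (3 * B + ln (2 / e))"
  obtain P where P: "finite P" "\<And>p. p \<in> P \<Longrightarrow> prime p" "(\<Sum>p\<in>P. 1 / real p) \<ge> T + 1"
    using prime_reciprocals_unbounded[of "T + 1"] by blast
  have "((\<lambda>\<sigma>. \<Sum>p\<in>P. real p powr - \<sigma>) \<longlongrightarrow> (\<Sum>p\<in>P. real p powr - 1)) (at_right 1)"
    using P(2) by (intro tendsto_intros) (auto simp: prime_gt_0_nat)
  moreover have "(\<Sum>p\<in>P. real p powr - 1) > T"
    using P by (simp add: powr_minus_divide prime_gt_0_nat cong: sum.cong)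
  ultimately have ev: "\<forall>\<^sub>F \<sigma> in at_right 1. (\<Sum>p\<in>P. real p powr - \<sigma>) > T" by (intro order_tendstoD)
  have "\<forall>\<^sub>F \<sigma> in at_right (1::real). \<sigma> > 1" by (simp add: eventually_at_right_less)
  with ev show "\<forall>\<^sub>F \<sigma> in at_right 1. dist (L \<sigma>) 0 < e"
  proof eventually_elim
    case (elim \<sigma>)
    have "\<kappa> / 2 * T = 3 * B + ln (2 / e)" using \<kappa> by (simp add: T_def)
    then have "ln (2 / e) = \<kappa> / 2 * T - 3 * B" by linarith
    also have "\<dots> \<le> \<kappa> / 2 * (\<Sum>p\<in>P. real p powr - \<sigma>) - 3 * B" using elim \<kappa> by simp
    finally have "exp (ln (2 / e)) \<le> exp (- Re \<zeta> / 2 * (\<Sum>p\<in>P. real p powr - \<sigma>) - 3 * B)"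
      by (simp add: \<kappa>_def)
    then have "2 / e \<le> exp (- Re \<zeta> / 2 * (\<Sum>p\<in>P. real p powr - \<sigma>) - 3 * B)" using e by simp
    then have "norm (L \<sigma>) * (2 / e) \<le> norm (L \<sigma>) * exp (- Re \<zeta> / 2 * (\<Sum>p\<in>P. real p powr - \<sigma>) - 3 * B)"
      by (intro mult_left_mono) auto
    also have "\<dots> \<le> 1" using elim P by (intro norm_L_upper) auto
    finally have "norm (L \<sigma>) \<le> e / 2" using e by (simp add: field_simps)
    then show ?case using e by simp
  qed
qed

text \<open>The product for \<open>L\<close> is at most a constant times the power
  \<open>- Re \<zeta>\<close> of the exponential of the sum of \<open>p powr - \<sigma>\<close>. The
  Euler product of the zeta series bounds that exponential by the series, hence by
  \<open>2 / (\<sigma> - 1)\<close>.\<close>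

lemma norm_L_lower:
  obtains D where "D > 0" "\<And>\<sigma>. 1 < \<sigma> \<Longrightarrow> \<sigma> \<le> 2 \<Longrightarrow> 1 \<le> norm (L \<sigma>) * ((2 / (\<sigma> - 1)) powr (- Re \<zeta>) * D)"
proof -
  define \<kappa> where "\<kappa> = - Re \<zeta>"
  have \<kappa>: "\<kappa> > 0" using \<zeta> by (simp add: \<kappa>_def)
  define C where "C = (\<Sum>n::nat. (1 / real n)\<^sup>2)"
  have sC: "summable (\<lambda>n::nat. (1 / real n)\<^sup>2)"
    using inverse_power_summable[of 2, where 'a=real] by (simp add: power_divide inverse_eq_divide)
  show thesis
  proof (rule that[of "exp (C + B)"])
    fix \<sigma> :: real assume \<sigma>: "1 < \<sigma>" "\<sigma> \<le> 2"
    define z where "z = infsum (\<lambda>n. real n powr - \<sigma>) {1..}"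
    show "1 \<le> norm (L \<sigma>) * ((2 / (\<sigma> - 1)) powr (- Re \<zeta>) * exp (C + B))"
    proof (rule tendsto_upperbound[OF euler_product_L[OF \<sigma>(1)]], rule always_eventually, rule allI)
      fix y :: nat
      let ?S = "{p. prime p \<and> p \<le> y}"
      have "(\<Prod>p\<in>?S. norm (1 - dterm \<sigma> p)) \<le>
          (\<Prod>p\<in>?S. exp (\<kappa> * real p powr - \<sigma> + (1 / real p)\<^sup>2 + (if p \<in> E then 1 / real p else 0)))"
        unfolding \<kappa>_def using \<sigma> by (intro prod_mono conjI factor_upper) auto
      also have "\<dots> = exp (\<Sum>p\<in>?S. \<kappa> * real p powr - \<sigma> + (1 / real p)\<^sup>2 + (if p \<in> E then 1 / real p else 0))"
        by (rule exp_sum[symmetric]) simp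
      also have "(\<Sum>p\<in>?S. \<kappa> * real p powr - \<sigma> + (1 / real p)\<^sup>2 + (if p \<in> E then 1 / real p else 0)) =
          \<kappa> * (\<Sum>p\<in>?S. real p powr - \<sigma>) + (\<Sum>p\<in>?S. (1 / real p)\<^sup>2) + (\<Sum>p\<in>?S. if p \<in> E then 1 / real p else 0)"
        by (simp add: sum.distrib sum_distrib_left)
      also have "\<dots> \<le> \<kappa> * (\<Sum>p\<in>?S. real p powr - \<sigma>) + C + B"
      proof (intro add_mono order_refl)
        show "(\<Sum>p\<in>?S. (1 / real p)\<^sup>2) \<le> C"
          unfolding C_def using sC by (intro sum_le_suminf) auto
        show "(\<Sum>p\<in>?S. if p \<in> E then 1 / real p else 0) \<le> B"
          using sum_bad_le[of 1 y] by (simp cong: if_cong)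
      qed
      also have "exp (\<kappa> * (\<Sum>p\<in>?S. real p powr - \<sigma>) + C + B) = exp (\<Sum>p\<in>?S. real p powr - \<sigma>) powr \<kappa> * exp (C + B)"
        by (simp add: powr_def exp_add mult_ac)
      also have "\<dots> \<le> (2 / (\<sigma> - 1)) powr \<kappa> * exp (C + B)"
      proof (intro mult_right_mono powr_mono2)
        have summ: "(\<lambda>n. real n powr - \<sigma>) summable_on A" for A by (rule summable_on_powr[OF \<sigma>(1)])
        let ?A = "{n. n \<ge> 1 \<and> (\<forall>p\<in>?S. \<not> p dvd n)}"
        have "z * (\<Prod>p\<in>?S. 1 - real p powr - \<sigma>) = infsum (\<lambda>n. real n powr - \<sigma>) ?A"
          unfolding z_def by (intro sieve_euler_product summ) (auto simp: powr_mult)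
        also have "\<dots> \<ge> (\<Sum>n\<in>{1}. real n powr - \<sigma>)"
          by (intro finite_sum_le_infsum summ) (auto dest: prime_gt_1_nat)
        finally have "1 \<le> z * (\<Prod>p\<in>?S. 1 - real p powr - \<sigma>)" by simp
        also have "\<dots> \<le> z * (\<Prod>p\<in>?S. exp (- (real p powr - \<sigma>)))"
        proof (intro mult_left_mono prod_mono conjI)
          show "z \<ge> 0" unfolding z_def by (intro infsum_nonneg) auto
          fix p assume p: "p \<in> ?S"
          show "0 \<le> 1 - real p powr - \<sigma>" using prime_powr_bounds(3)[of p \<sigma>] p \<sigma> by simp
          show "1 - real p powr - \<sigma> \<le> exp (- (real p powr - \<sigma>))"
            using exp_ge_add_one_self[of "- (real p powr - \<sigma>)"] by simp
        qed
        also have "\<dots> = z * exp (- (\<Sum>p\<in>?S. real p powr - \<sigma>))" by (simp add: exp_sum sum_negf[symmetric])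
        finally have "exp (\<Sum>p\<in>?S. real p powr - \<sigma>) \<le> z" by (simp add: exp_minus field_simps)
        also have "z \<le> 2 / (\<sigma> - 1)" unfolding z_def by (rule zeta_bounds[OF \<sigma>])
        finally show "exp (\<Sum>p\<in>?S. real p powr - \<sigma>) \<le> 2 / (\<sigma> - 1)" .
      qed (use \<kappa> in auto)
      finally show "norm (L \<sigma>) * (\<Prod>p\<in>?S. norm (1 - dterm \<sigma> p)) \<le> norm (L \<sigma>) * ((2 / (\<sigma> - 1)) powr (- Re \<zeta>) * exp (C + B))"
        by (intro mult_left_mono) (auto simp: \<kappa>_def)
    qed simp
  qed simp
qed

text \<open>If \<open>Re \<zeta> > - 1\<close>, then \<open>L\<close> would vanish at \<open>1\<close> to the fractional order \<open>- Re \<zeta>\<close>, which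
  contradicts its Lipschitz continuity.\<close>

lemma Re_zeta_eq_minus_1: "Re \<zeta> = - 1"
proof (rule ccontr)
  assume neq: "Re \<zeta> \<noteq> - 1"
  define \<kappa> where "\<kappa> = - Re \<zeta>"
  have \<kappa>: "\<kappa> > 0" "\<kappa> < 1" using \<zeta> Re_zeta_ge neq by (auto simp: \<kappa>_def)
  obtain C where C: "C > 0" "\<And>\<sigma> \<tau>. 1 < \<sigma> \<Longrightarrow> 1 < \<tau> \<Longrightarrow> norm (L \<sigma> - L \<tau>) \<le> C * \<bar>\<sigma> - \<tau>\<bar>"
    using L_lipschitz by blast
  obtain D where D: "D > 0" "\<And>\<sigma>. 1 < \<sigma> \<Longrightarrow> \<sigma> \<le> 2 \<Longrightarrow> 1 \<le> norm (L \<sigma>) * ((2 / (\<sigma> - 1)) powr \<kappa> * D)"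
    unfolding \<kappa>_def by (rule norm_L_lower) blast
  \<comment> \<open>The Lipschitz bound, with the second point tending to 1, where \<open>L\<close>
    tends to 0.\<close>
  have Lle: "norm (L \<sigma>) \<le> C * (\<sigma> - 1)" if \<sigma>: "\<sigma> > 1" for \<sigma>
  proof (rule tendsto_lowerbound)
    have "((\<lambda>\<tau>. C * \<bar>\<sigma> - \<tau>\<bar> + norm (L \<tau>)) \<longlongrightarrow> C * \<bar>\<sigma> - 1\<bar> + norm (0::complex)) (at_right 1)"
      by (intro tendsto_intros L_tendsto_0)
    then show "((\<lambda>\<tau>. C * \<bar>\<sigma> - \<tau>\<bar> + norm (L \<tau>)) \<longlongrightarrow> C * (\<sigma> - 1)) (at_right 1)" using \<sigma> by simp
    have "\<forall>\<^sub>F \<tau> in at_right (1::real). \<tau> > 1" by (simp add: eventually_at_right_less)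
    then show "\<forall>\<^sub>F \<tau> in at_right 1. norm (L \<sigma>) \<le> C * \<bar>\<sigma> - \<tau>\<bar> + norm (L \<tau>)"
    proof eventually_elim
      case (elim \<tau>)
      have "norm (L \<sigma>) \<le> norm (L \<sigma> - L \<tau>) + norm (L \<tau>)" using norm_triangle_sub[of "L \<sigma>" "L \<tau>"] by simp
      then show ?case using C(2)[OF \<sigma> elim] by simp
    qed
  qed simp
  define F where "F = C * D * 2 powr \<kappa>"
  have F: "F > 0" using C D by (simp add: F_def)
  \<comment> \<open>Chosen so that \<open>F * s powr (1 - \<kappa>)\<close> is at most 1/2, while
    the lower bound for \<open>L\<close> says that it is at least 1.\<close>
  define s where "s = min 1 ((1 / (2 * F)) powr (1 / (1 - \<kappa>)))"
  have s: "0 < s" "s \<le> 1" "s \<le> (1 / (2 * F)) powr (1 / (1 - \<kappa>))" using F by (auto simp: s_def)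
  have "1 \<le> norm (L (1 + s)) * ((2 / s) powr \<kappa> * D)" using D(2)[of "1 + s"] s by simp
  also have "\<dots> \<le> C * s * ((2 / s) powr \<kappa> * D)"
    using Lle[of "1 + s"] s D by (intro mult_right_mono) auto
  also have "\<dots> = F * s powr (1 - \<kappa>)" using s by (simp add: F_def powr_divide powr_diff)
  also have "s powr (1 - \<kappa>) \<le> ((1 / (2 * F)) powr (1 / (1 - \<kappa>))) powr (1 - \<kappa>)"
    using s \<kappa> by (intro powr_mono2) auto
  also have "\<dots> = 1 / (2 * F)" using \<kappa> F by (simp add: powr_powr)
  finally show False using F by simp
qed

end

end

section \<open>Nonvanishing for real characters\<close>

lemma sum_divisors_prime_power_mult:
  fixes g :: "nat \<Rightarrow> real"
  assumes p: "prime p" "\<not> p dvd m"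
  shows "(\<Sum>d | d dvd p ^ k * m. g d) = (\<Sum>i\<le>k. \<Sum>d | d dvd m. g (p ^ i * d))"
proof -
  have "bij_betw (\<lambda>(i, d). p ^ i * d) ({..k} \<times> {d. d dvd m}) {d. d dvd p ^ k * m}"
    unfolding bij_betw_def
  proof
    show "inj_on (\<lambda>(i, d). p ^ i * d) ({..k} \<times> {d. d dvd m})"
    proof (rule inj_onI, clarify)
      fix i d j e assume *: "d dvd m" "e dvd m" "p ^ i * d = p ^ j * e"
      have "\<not> p dvd d" "\<not> p dvd e" using p(2) *(1,2) dvd_trans by blast+
      moreover have "d * p ^ i = e * p ^ j" using *(3) by (simp add: mult.commute)
      ultimately show "i = j \<and> d = e" using prime_power_cancel2[OF p(1), of d i e j] by blast
    qed
    show "(\<lambda>(i, d). p ^ i * d) ` ({..k} \<times> {d. d dvd m}) = {d. d dvd p ^ k * m}"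
    proof (intro subset_antisym subsetI)
      fix d assume "d \<in> {d. d dvd p ^ k * m}"
      then have "d dvd p ^ k * m" by simp
      then obtain x y where xy: "d = x * y" "x dvd p ^ k" "y dvd m" by (rule dvd_productE)
      from xy(2) obtain i where i: "i \<le> k" "x = p ^ i" using divides_primepow_nat[OF p(1)] by blast
      show "d \<in> (\<lambda>(i, d). p ^ i * d) ` ({..k} \<times> {d. d dvd m})"
        using xy i by (intro image_eqI[of _ _ "(i, y)"]) auto
    qed (auto intro!: mult_dvd_mono le_imp_power_dvd)
  qed
  from sum.reindex_bij_betw[OF this, of g] show ?thesis
    by (simp add: sum.cartesian_product case_prod_unfold)
qed

context
  fixes \<rho> :: "nat \<Rightarrow> real"
  assumes mult: "\<And>m n. \<rho> (m * n) = \<rho> m * \<rho> n" and one: "\<rho> 1 = 1" and vals: "\<And>n. \<rho> n \<in> {-1, 0, 1}"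
begin

lemma real_character_power: "\<rho> (p ^ i) = \<rho> p ^ i"
  by (induction i) (use mult one in auto)

lemma geometric_sum_sign: "(\<Sum>i\<le>k. \<rho> p ^ i) \<ge> 0" "even k \<Longrightarrow> (\<Sum>i\<le>k. \<rho> p ^ i) \<ge> 1"
proof -
  have "(\<Sum>i\<le>k. \<rho> p ^ i) \<ge> 0 \<and> (even k \<longrightarrow> (\<Sum>i\<le>k. \<rho> p ^ i) \<ge> 1)"
  proof -
    consider "\<rho> p = 0" | "\<rho> p = 1" | "\<rho> p = -1" using vals[of p] by auto
    then show ?thesis
    proof cases
      case 1 then show ?thesis by (simp add: power_0_left)
    next
      case 2 then show ?thesis by simp
    next
      case 3
      have "(\<Sum>i\<le>k. (-1::real) ^ i) = (if even k then 1 else 0)" by (induction k) auto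
      then show ?thesis using 3 by simp
    qed
  qed
  then show "(\<Sum>i\<le>k. \<rho> p ^ i) \<ge> 0" "even k \<Longrightarrow> (\<Sum>i\<le>k. \<rho> p ^ i) \<ge> 1" by auto
qed

text \<open>The divisor sum factors over the primes into geometric sums in \<open>\<rho> p\<close>.
  These are nonnegative, and at least 1 for an even exponent, so perfect squares contribute at least
  1.\<close>

lemma divisor_sum_real_character:
  assumes "n \<ge> 1"
  shows "(\<Sum>d | d dvd n. \<rho> d) \<ge> 0 \<and> ((\<forall>p. prime p \<longrightarrow> even (multiplicity p n)) \<longrightarrow> (\<Sum>d | d dvd n. \<rho> d) \<ge> 1)"
  using assms
proof (induction n rule: less_induct)
  case (less n)
  show ?case
  proof (cases "n = 1")
    case True
    then show ?thesis using one by simp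
  next
    case False
    then obtain p where p: "prime p" "p dvd n" using prime_factor_nat by blast
    define k where "k = multiplicity p n"
    obtain m where m: "n = p ^ k * m" "\<not> p dvd m"
      using multiplicity_decompose'[of n p] less.prems prime_gt_1_nat[OF p(1)] unfolding k_def by auto
    have k: "k \<ge> 1" using m p by (cases k) auto
    have m1: "m \<ge> 1" using m less.prems by (cases m) auto
    have "p ^ k > 1" using k p prime_gt_1_nat[of p] by (intro one_less_power) auto
    then have "m < n" using m m1 by simp
    have eq: "(\<Sum>d | d dvd n. \<rho> d) = (\<Sum>i\<le>k. \<rho> p ^ i) * (\<Sum>d | d dvd m. \<rho> d)"
      unfolding m(1) sum_divisors_prime_power_mult[OF p(1) m(2)]
      by (simp add: mult real_character_power sum_product)
    note IH = less.IH[OF \<open>m < n\<close> m1]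
    have "(\<Sum>d | d dvd n. \<rho> d) \<ge> 1" if ev: "\<forall>q. prime q \<longrightarrow> even (multiplicity q n)"
    proof -
      have "even (multiplicity q m)" if q: "prime q" for q
      proof (cases "q = p")
        case True
        then show ?thesis using m(2) by (simp add: not_dvd_imp_multiplicity_0)
      next
        case False
        have "multiplicity q n = multiplicity q (p ^ k) + multiplicity q m"
          unfolding m(1) using p q m1 by (intro prime_elem_multiplicity_mult_distrib) auto
        also have "multiplicity q (p ^ k) = 0"
          using p(1) q False by (simp add: multiplicity_distinct_prime_power)
        finally show ?thesis using ev[rule_format, OF q] by simp
      qed
      then have "(\<Sum>d | d dvd m. \<rho> d) \<ge> 1" using IH by blast
      moreover have "(\<Sum>i\<le>k. \<rho> p ^ i) \<ge> 1" using ev p(1) by (intro geometric_sum_sign) (simp add: k_def)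
      ultimately show ?thesis unfolding eq using mult_mono[of 1 _ 1] by fastforce
    qed
    then show ?thesis unfolding eq using IH geometric_sum_sign(1) by auto
  qed
qed

end

section \<open>Lambert series\<close>

text \<open>The exponents \<open>i + j\<close> are symmetric under reflection at
  \<open>n - 1/2\<close>. Pairing each with its mirror image, the arithmetic mean dominates the
  geometric mean, which is at least \<open>t ^ n\<close>.\<close>

lemma sum_powers_product_ge:
  assumes t: "0 < t" "t < (1::real)"
  shows "(\<Sum>i<n. t ^ i) * (\<Sum>i<Suc n. t ^ i) \<ge> real n * real (Suc n) * t ^ n"
proof -
  have pair: "t ^ a + t ^ b \<ge> 2 * t ^ n" if "a + b + 1 = 2 * n" for a b
  proof (rule power2_le_imp_le)
    have "(t ^ n)\<^sup>2 = t ^ (a + b + 1)" using that by (simp add: mult.commute flip: power_mult)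
    also have "\<dots> \<le> t ^ (a + b)" using t by (intro power_decreasing) auto
    finally have "(2 * t ^ n)\<^sup>2 \<le> 4 * (t ^ a * t ^ b)" by (simp add: power_add power_mult_distrib)
    also have "\<dots> \<le> (t ^ a + t ^ b)\<^sup>2" using zero_le_power2[of "t ^ a - t ^ b"] by (simp add: power2_eq_square algebra_simps)
    finally show "(2 * t ^ n)\<^sup>2 \<le> (t ^ a + t ^ b)\<^sup>2" .
  qed (use t in auto)
  have s: "(\<Sum>i<n. t ^ i) * (\<Sum>j<Suc n. t ^ j) = (\<Sum>i<n. \<Sum>j<Suc n. t ^ (i + j))"
    by (simp only: sum_product power_add)
  have s': "(\<Sum>i<n. t ^ i) * (\<Sum>j<Suc n. t ^ j) = (\<Sum>i<n. \<Sum>j<Suc n. t ^ ((n - Suc i) + (Suc n - Suc j)))"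
    unfolding power_add sum_product[symmetric]
    by (simp only: sum.nat_diff_reindex[where g = "\<lambda>i. t ^ i"])
  have "2 * ((\<Sum>i<n. t ^ i) * (\<Sum>j<Suc n. t ^ j)) =
      (\<Sum>i<n. \<Sum>j<Suc n. t ^ (i + j) + t ^ ((n - Suc i) + (Suc n - Suc j)))"
    unfolding sum.distrib using s s' by linarith
  also have "\<dots> \<ge> (\<Sum>i<n. \<Sum>j<Suc n. 2 * t ^ n)" by (intro sum_mono pair) auto
  finally show ?thesis by (simp add: algebra_simps)
qed

text \<open>The difference between the leading approximation \<open>1 / (n * (1 - t))\<close> as
  \<open>t\<close> tends to 1 and the Lambert kernel itself. The approximation brings in the partial
  sums of \<open>L\<close> at 1; the defect is nonnegative and decreasing, so Abel summation applies
  to it.\<close>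

definition lambert_defect :: "real \<Rightarrow> nat \<Rightarrow> real" where
  "lambert_defect t n = 1 / (real n * (1 - t)) - t ^ n / (1 - t ^ n)"

lemma lambert_defect_eq:
  assumes "0 < t" "t < 1" "n \<ge> 1"
  shows "lambert_defect t n = (1 / real n - t ^ n / (\<Sum>i<n. t ^ i)) / (1 - t)"
proof -
  have "1 - t ^ n = (1 - t) * (\<Sum>i<n. t ^ i)" by (simp add: one_diff_power_eq)
  then show ?thesis using assms by (simp add: lambert_defect_def diff_divide_distrib mult.commute)
qed

lemma lambert_defect_nonneg:
  assumes t: "0 < t" "t < 1" and n: "n \<ge> 1"
  shows "lambert_defect t n \<ge> 0"
proof -
  have "(\<Sum>i<n. t ^ n) \<le> (\<Sum>i<n. t ^ i)" using t by (intro sum_mono power_decreasing) auto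
  then have "real n * t ^ n \<le> (\<Sum>i<n. t ^ i)" by simp
  moreover have "(\<Sum>i<n. t ^ i) > 0" using t n by (intro sum_pos) (auto simp: lessThan_empty_iff)
  ultimately have "t ^ n / (\<Sum>i<n. t ^ i) \<le> 1 / real n" using n by (simp add: field_simps)
  then show ?thesis using lambert_defect_eq[OF t n] t by simp
qed

text \<open>With \<open>s\<close> and \<open>s'\<close> the geometric sums of lengths
  \<open>n\<close> and \<open>n + 1\<close>, the claim reduces to comparing
  \<open>t ^ n / (s * s')\<close> with \<open>1 / (n * (n + 1))\<close>.\<close>

lemma lambert_defect_antimono:
  assumes t: "0 < t" "t < 1" and n: "n \<ge> 1"
  shows "lambert_defect t (Suc n) \<le> lambert_defect t n"
proof -
  define s where "s = (\<Sum>i<n. t ^ i)"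
  define s' where "s' = (\<Sum>i<Suc n. t ^ i)"
  have s: "s > 0" unfolding s_def using t n by (intro sum_pos) (auto simp: lessThan_empty_iff)
  have s's: "s' = 1 + t * s" unfolding s'_def s_def by (subst sum.lessThan_Suc_shift) (simp add: sum_distrib_left)
  have s': "s' > 0" using s t s's by (simp add: add_pos_pos)
  have "t ^ n / s - t ^ Suc n / s' = t ^ n * (s' - t * s) / (s * s')"
    using s s' by (simp add: field_simps)
  also have "\<dots> = t ^ n / (s * s')" using s's by simp
  also have "\<dots> \<le> 1 / (real n * real (Suc n))"
  proof -
    define c where "c = real n * real (Suc n)"
    have "c > 0" using n by (simp add: c_def)
    moreover have "c * t ^ n \<le> s * s'"
      using sum_powers_product_ge[OF t, of n] unfolding s_def s'_def c_def .
    ultimately show ?thesis using s s' unfolding c_def[symmetric] by (simp add: field_simps)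
  qed
  also have "\<dots> = 1 / real n - 1 / real (Suc n)" using n by (simp add: field_simps)
  finally have "1 / real (Suc n) - t ^ Suc n / s' \<le> 1 / real n - t ^ n / s" by simp
  then show ?thesis
    using lambert_defect_eq[OF t n] lambert_defect_eq[OF t, of "Suc n"] t
    unfolding s_def[symmetric] s'_def[symmetric] by (simp add: divide_right_mono)
qed

text \<open>Expanding each kernel as a geometric series exchanges the two sums. Cutting at
  \<open>N\<close> costs at most \<open>t ^ N / (1 - t)\<close> for every \<open>d\<close>, an error
  that vanishes as \<open>N\<close> grows with \<open>t\<close> fixed.\<close>

lemma truncated_lambert_series:
  fixes \<rho> :: "nat \<Rightarrow> real"
  assumes t: "0 < t" "t < (1::real)" and \<rho>: "\<And>n. \<bar>\<rho> n\<bar> \<le> 1"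
  shows "(\<Sum>n=1..N. (\<Sum>d | d dvd n. \<rho> d) * t ^ n) \<le> (\<Sum>d=1..N. \<rho> d * (t ^ d / (1 - t ^ d))) + real N * t ^ N / (1 - t)"
proof -
  have "(\<Sum>n=1..N. (\<Sum>d | d dvd n. \<rho> d) * t ^ n) = (\<Sum>n=1..N. \<Sum>d=1..N. if d dvd n then \<rho> d * t ^ n else 0)"
  proof (intro sum.cong refl)
    fix n assume n: "n \<in> {1..N}"
    have "d \<in> {1..N}" if "d dvd n" for d
      using dvd_imp_le[OF that] dvd_pos_nat[OF _ that] n by simp
    then have "{d. d dvd n} = {1..N} \<inter> {d. d dvd n}" by blast
    then have "(\<Sum>d | d dvd n. \<rho> d) * t ^ n = (\<Sum>d\<in>{1..N} \<inter> {d. d dvd n}. \<rho> d * t ^ n)"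
      by (simp add: sum_distrib_right)
    also have "\<dots> = (\<Sum>d=1..N. if d dvd n then \<rho> d * t ^ n else 0)" by (subst sum.inter_restrict) auto
    finally show "(\<Sum>d | d dvd n. \<rho> d) * t ^ n = (\<Sum>d=1..N. if d dvd n then \<rho> d * t ^ n else 0)" .
  qed
  also have "\<dots> = (\<Sum>d=1..N. \<Sum>n=1..N. if d dvd n then \<rho> d * t ^ n else 0)" by (rule sum.swap)
  also have "\<dots> \<le> (\<Sum>d=1..N. \<rho> d * (t ^ d / (1 - t ^ d)) + t ^ N / (1 - t))"
  proof (intro sum_mono)
    fix d assume d: "d \<in> {1..N}"
    define q where "q = N div d"
    have td: "0 < t ^ d" "t ^ d < 1" using t d by (auto simp: power_less_one_iff)
    have "(\<Sum>n=1..N. if d dvd n then \<rho> d * t ^ n else 0) = (\<Sum>n\<in>{n\<in>nats_upto (real N). d dvd n}. \<rho> d * t ^ n)"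
      using sum.inter_filter[of "{1..N}" "\<lambda>n. \<rho> d * t ^ n" "\<lambda>n. d dvd n"] by (simp add: nats_upto_def)
    also have "\<dots> = (\<Sum>k\<in>nats_upto (real N / real d). \<rho> d * t ^ (d * k))"
      using sum.reindex_bij_betw[OF bij_betw_multiples_upto, of d "\<lambda>n. \<rho> d * t ^ n" "real N"] d by simp
    also have "nats_upto (real N / real d) = {1..q}"
      by (simp add: nats_upto_def q_def floor_divide_of_nat_eq)
    also have "(\<Sum>k=1..q. \<rho> d * t ^ (d * k)) = \<rho> d * (\<Sum>k=1..q. (t ^ d) ^ k)"
      by (simp add: sum_distrib_left power_mult)
    also have "(\<Sum>k=1..q. (t ^ d) ^ k) = t ^ d / (1 - t ^ d) - (t ^ d) ^ Suc q / (1 - t ^ d)"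
    proof (induction q)
      case (Suc q)
      have "(t ^ d) ^ Suc q - (t ^ d) ^ Suc (Suc q) = (t ^ d) ^ Suc q * (1 - t ^ d)"
        by (simp add: right_diff_distrib)
      then have "(t ^ d) ^ Suc q = (t ^ d) ^ Suc q / (1 - t ^ d) - (t ^ d) ^ Suc (Suc q) / (1 - t ^ d)"
        using td unfolding diff_divide_distrib[symmetric] by simp
      then show ?case using Suc by simp
    qed simp
    also have "\<rho> d * (t ^ d / (1 - t ^ d) - (t ^ d) ^ Suc q / (1 - t ^ d)) \<le>
        \<rho> d * (t ^ d / (1 - t ^ d)) + \<bar>\<rho> d\<bar> * ((t ^ d) ^ Suc q / (1 - t ^ d))"
    proof -
      have "- \<rho> d * ((t ^ d) ^ Suc q / (1 - t ^ d)) \<le> \<bar>\<rho> d\<bar> * ((t ^ d) ^ Suc q / (1 - t ^ d))"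
        using td by (intro mult_right_mono) auto
      then show ?thesis by (simp add: right_diff_distrib)
    qed
    also have "\<bar>\<rho> d\<bar> * ((t ^ d) ^ Suc q / (1 - t ^ d)) \<le> 1 * (t ^ N / (1 - t))"
    proof (intro mult_mono frac_le)
      have "N < d * Suc q" using d dividend_less_times_div[of d N] by (simp add: q_def)
      then have "t ^ (d * Suc q) \<le> t ^ N" using t by (intro power_decreasing) auto
      then show "(t ^ d) ^ Suc q \<le> t ^ N" by (simp only: power_mult)
      have "t ^ d \<le> t ^ 1" using t d by (intro power_decreasing) auto
      then show "1 - t \<le> 1 - t ^ d" by simp
    qed (use \<rho> t td in auto)
    finally show "(\<Sum>n=1..N. if d dvd n then \<rho> d * t ^ n else 0) \<le> \<rho> d * (t ^ d / (1 - t ^ d)) + t ^ N / (1 - t)"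
      by simp
  qed
  also have "\<dots> = (\<Sum>d=1..N. \<rho> d * (t ^ d / (1 - t ^ d))) + real N * t ^ N / (1 - t)"
    by (simp add: sum.distrib)
  finally show ?thesis .
qed

context periodic_character
begin

text \<open>A partial sum differs from \<open>L \<sigma>\<close> by a tail of size at most
  \<open>2 * K / N\<close>, uniformly in \<open>\<sigma> > 1\<close>; letting
  \<open>\<sigma>\<close> decrease to 1 removes \<open>L\<close>. No value of \<open>L\<close> at 1
  has to be defined.\<close>

lemma norm_partial_sum_at_1:
  assumes "(L \<longlongrightarrow> 0) (at_right 1)" "N \<ge> 1"
  shows "norm (\<Sum>n=1..<N. ch n * of_real (1 / real n)) \<le> 2 * real K / real N"
proof -
  have 1: "norm (\<Sum>n=1..<N. dterm \<sigma> n) \<le> norm (L \<sigma>) + 2 * real K / real N" if \<sigma>: "\<sigma> > 1" for \<sigma>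
  proof (rule tendsto_lowerbound)
    show "(\<lambda>M. norm (\<Sum>n=1..<M. dterm \<sigma> n) + 2 * real K / real N) \<longlonglongrightarrow> norm (L \<sigma>) + 2 * real K / real N"
      by (intro tendsto_intros L_limit \<sigma>)
    have "\<forall>\<^sub>F M in sequentially. M \<ge> N" by (rule eventually_ge_at_top)
    then show "\<forall>\<^sub>F M in sequentially. norm (\<Sum>n=1..<N. dterm \<sigma> n) \<le> norm (\<Sum>n=1..<M. dterm \<sigma> n) + 2 * real K / real N"
    proof eventually_elim
      case (elim M)
      have "(\<Sum>n=1..<M. dterm \<sigma> n) = (\<Sum>n=1..<N. dterm \<sigma> n) + (\<Sum>n=N..<M. dterm \<sigma> n)"
        using elim assms by (simp add: sum.atLeastLessThan_concat)
      then have "norm (\<Sum>n=1..<N. dterm \<sigma> n) \<le> norm (\<Sum>n=1..<M. dterm \<sigma> n) + norm (\<Sum>n=N..<M. dterm \<sigma> n)"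
        by (metis add_diff_cancel_right' norm_triangle_ineq4)
      then show ?case using norm_dterm_tail_le[of \<sigma> N M] \<sigma> assms elim by linarith
    qed
  qed simp
  show ?thesis
  proof (rule tendsto_le)
    show "((\<lambda>\<sigma>. norm (L \<sigma>) + 2 * real K / real N) \<longlongrightarrow> 2 * real K / real N) (at_right 1)"
      using tendsto_add[OF tendsto_norm[OF assms(1)] tendsto_const[of "2 * real K / real N"]] by simp
    have "((\<lambda>\<sigma>. norm (\<Sum>n=1..<N. dterm \<sigma> n)) \<longlongrightarrow> norm (\<Sum>n=1..<N. ch n * of_real (real n powr - 1))) (at_right 1)"
      unfolding dterm_def by (intro tendsto_intros) auto
    also have "(\<Sum>n=1..<N. ch n * of_real (real n powr - 1)) = (\<Sum>n=1..<N. ch n * of_real (1 / real n))"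
      by (intro sum.cong refl) (simp add: powr_minus_divide)
    finally show "((\<lambda>\<sigma>. norm (\<Sum>n=1..<N. dterm \<sigma> n)) \<longlongrightarrow> norm (\<Sum>n=1..<N. ch n * of_real (1 / real n))) (at_right 1)" .
    have "\<forall>\<^sub>F \<sigma> in at_right (1::real). \<sigma> > 1" by (simp add: eventually_at_right_less)
    then show "\<forall>\<^sub>F \<sigma> in at_right 1. norm (\<Sum>n=1..<N. dterm \<sigma> n) \<le> norm (L \<sigma>) + 2 * real K / real N"
      by eventually_elim (rule 1)
  qed simp
qed

text \<open>Monsky's argument for real characters: if \<open>L\<close> vanished at \<open>1\<close>, then the Lambert series
  \<open>\<Sum> \<rho>(n) t\<^sup>n / (1 - t\<^sup>n)\<close> would stay bounded as \<open>t \<rightarrow> 1\<close>, but it dominates \<open>\<Sum> t\<^sup>m\<^sup>2\<close>.\<close>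

lemma real_character_L_nonvanishing:
  assumes real: "\<And>n. ch n = of_real (\<rho> n)" and vals: "\<And>n. \<rho> n \<in> {-1, 0, 1}"
  shows "\<not> (L \<longlongrightarrow> 0) (at_right 1)"
proof
  assume L0: "(L \<longlongrightarrow> 0) (at_right 1)"
  have \<rho>_mult: "\<rho> (m * n) = \<rho> m * \<rho> n" for m n
    using mult[of m n] unfolding real by (simp flip: of_real_mult)
  have \<rho>_one: "\<rho> 1 = 1" using one unfolding real by simp
  have abs: "\<bar>\<rho> n\<bar> \<le> 1" for n using vals[of n] by auto
  note f = divisor_sum_real_character[OF \<rho>_mult \<rho>_one vals]
  \<comment> \<open>The bound \<open>2 * K\<close> holds for every \<open>t < 1\<close>, whereas the
    sum over the first \<open>M\<close> squares tends to \<open>M\<close>; one square more than the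
    bound is enough.\<close>
  define M where "M = 2 * K + 1"
  have bound: "(\<Sum>m=1..M. t ^ (m\<^sup>2)) \<le> 2 * real K" if t: "0 < t" "t < 1" for t :: real
  proof (rule tendsto_lowerbound)
    have "(\<lambda>N. 2 * real K * inverse (real (Suc N)) / (1 - t) + 2 * real K + real N * t ^ N / (1 - t)) \<longlonglongrightarrow>
        2 * real K * 0 / (1 - t) + 2 * real K + 0 / (1 - t)"
      using t by (intro tendsto_intros LIMSEQ_inverse_real_of_nat powser_times_n_limit_0) auto
    then show "(\<lambda>N. 2 * real K * inverse (real (Suc N)) / (1 - t) + 2 * real K + real N * t ^ N / (1 - t)) \<longlonglongrightarrow> 2 * real K"
      by simp
    have "\<forall>\<^sub>F N in sequentially. N \<ge> M\<^sup>2" by (rule eventually_ge_at_top)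
    then show "\<forall>\<^sub>F N in sequentially. (\<Sum>m=1..M. t ^ (m\<^sup>2)) \<le>
        2 * real K * inverse (real (Suc N)) / (1 - t) + 2 * real K + real N * t ^ N / (1 - t)"
    proof eventually_elim
      case (elim N)
      let ?F = "\<lambda>n. \<Sum>d | d dvd n. \<rho> d"
      have inj: "inj_on (\<lambda>m::nat. m\<^sup>2) {1..M}" by (auto simp: inj_on_def)
      have sub: "(\<lambda>m::nat. m\<^sup>2) ` {1..M} \<subseteq> {1..N}"
      proof
        fix n assume "n \<in> (\<lambda>m::nat. m\<^sup>2) ` {1..M}"
        then obtain m where m: "n = m\<^sup>2" "1 \<le> m" "m \<le> M" by auto
        have "m\<^sup>2 \<le> M\<^sup>2" using m by (intro power_mono) auto
        then have "m\<^sup>2 \<le> N" using elim by (rule order_trans)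
        then show "n \<in> {1..N}" using m by (auto simp: Suc_le_eq)
      qed
      have "(\<Sum>m=1..M. t ^ (m\<^sup>2)) \<le> (\<Sum>m=1..M. ?F (m\<^sup>2) * t ^ (m\<^sup>2))"
      proof (intro sum_mono)
        fix m assume m: "m \<in> {1..M}"
        have "even (multiplicity p (m\<^sup>2))" if "prime p" for p
          using that m by (subst prime_elem_multiplicity_power_distrib) auto
        then have "?F (m\<^sup>2) \<ge> 1" using f[of "m\<^sup>2"] m by (auto simp: Suc_le_eq)
        then show "t ^ (m\<^sup>2) \<le> ?F (m\<^sup>2) * t ^ (m\<^sup>2)" using t by simp
      qed
      also have "\<dots> = (\<Sum>n\<in>(\<lambda>m. m\<^sup>2) ` {1..M}. ?F n * t ^ n)" using inj by (simp add: sum.reindex)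
      also have "\<dots> \<le> (\<Sum>n=1..N. ?F n * t ^ n)" using sub f t by (intro sum_mono2) auto
      also have "\<dots> \<le> (\<Sum>d=1..N. \<rho> d * (t ^ d / (1 - t ^ d))) + real N * t ^ N / (1 - t)"
        by (rule truncated_lambert_series[OF t abs])
      also have "(\<Sum>d=1..N. \<rho> d * (t ^ d / (1 - t ^ d))) \<le> 2 * real K * inverse (real (Suc N)) / (1 - t) + 2 * real K"
      proof -
        \<comment> \<open>The first part is small because \<open>L\<close> vanishes at 1. Abel
          summation bounds the second by \<open>2 * K\<close> times the defect at 1, which equals
          1.\<close>
        have "(\<Sum>d=1..N. \<rho> d * (t ^ d / (1 - t ^ d))) =
            (\<Sum>d=1..<Suc N. \<rho> d * (1 / real d)) / (1 - t) - (\<Sum>d=1..<Suc N. \<rho> d * lambert_defect t d)"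
          by (simp add: sum_divide_distrib lambert_defect_def atLeastLessThanSuc_atLeastAtMost right_diff_distrib
              flip: sum_subtractf)
        also have "\<dots> \<le> norm (\<Sum>n=1..<Suc N. ch n * of_real (1 / real n)) / (1 - t) +
            norm (\<Sum>n=1..<Suc N. ch n * of_real (lambert_defect t n))"
        proof -
          have eq: "norm (\<Sum>n=1..<Suc N. ch n * of_real (g n)) = \<bar>\<Sum>n=1..<Suc N. \<rho> n * g n\<bar>" for g :: "nat \<Rightarrow> real"
          proof -
            have "(\<Sum>n=1..<Suc N. ch n * of_real (g n)) = of_real (\<Sum>n=1..<Suc N. \<rho> n * g n)"
              unfolding real by simp
            then show ?thesis by (simp only: norm_of_real)
          qed
          have "(\<Sum>d=1..<Suc N. \<rho> d * (1 / real d)) / (1 - t) \<le> \<bar>\<Sum>d=1..<Suc N. \<rho> d * (1 / real d)\<bar> / (1 - t)"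
            using t by (intro divide_right_mono) auto
          then show ?thesis unfolding eq by linarith
        qed
        also have "\<dots> \<le> (2 * real K / real (Suc N)) / (1 - t) + 2 * real K * lambert_defect t 1"
        proof (intro add_mono divide_right_mono norm_partial_sum_at_1[OF L0] norm_sum_antimono_le)
          show "0 \<le> lambert_defect t n" if "1 \<le> n" for n using lambert_defect_nonneg[OF t that] .
          show "lambert_defect t (Suc n) \<le> lambert_defect t n" if "1 \<le> n" for n
            using lambert_defect_antimono[OF t that] .
        qed (use t in auto)
        also have "lambert_defect t 1 = 1" using t by (simp add: lambert_defect_def field_simps)
        finally show ?thesis by (simp add: divide_inverse)
      qed
      finally show ?case by simp
    qed
  qed simp
  have "((\<lambda>t::real. \<Sum>m=1..M. t ^ (m\<^sup>2)) \<longlongrightarrow> (\<Sum>m=1..M. 1 ^ (m\<^sup>2))) (at_left 1)"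
    by (intro tendsto_intros)
  then have "((\<lambda>t::real. \<Sum>m=1..M. t ^ (m\<^sup>2)) \<longlongrightarrow> real M) (at_left 1)" by simp
  moreover have "\<forall>\<^sub>F t in at_left (1::real). t \<in> {0<..<1}" by (rule eventually_at_leftI[of 0]) auto
  then have "\<forall>\<^sub>F t in at_left (1::real). (\<Sum>m=1..M. t ^ (m\<^sup>2)) \<le> 2 * real K"
    by eventually_elim (use bound in auto)
  ultimately have "real M \<le> 2 * real K" by (rule tendsto_upperbound) simp
  then show False by (simp add: M_def)
qed

end

section \<open>Shift invariance of the distribution of \<open>\<Omega>\<close> in residue classes\<close>

text \<open>If \<open>l\<close> divided the length of every rich product congruent to 1, the length
  modulo \<open>l\<close> would be a homomorphism on the unit classes. Composed with
  \<open>\<zeta>\<close> it is the character that takes the value \<open>\<zeta>\<close> at all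
  primes that are not poor.\<close>

lemma rich_product_lengths_coprime:
  assumes K: "K \<ge> 1" and l: "prime l"
  shows "\<exists>a. rich_product K a 1 \<and> \<not> l dvd a"
proof (rule ccontr)
  assume "\<not> ?thesis"
  then have dvd: "\<And>a. rich_product K a 1 \<Longrightarrow> l dvd a" by blast
  \<comment> \<open>For odd \<open>l\<close>, an \<open>l\<close>-th root of unity as near to -1 as
    possible. The case \<open>l = 2\<close> is separate because there the general formula would give
    a fourth root of unity.\<close>
  define \<zeta> where "\<zeta> = (if l = 2 then - 1 else - cis (pi / real l))"
  have l3: "odd l \<and> l \<ge> 3" if "l \<noteq> 2"
    using that l prime_ge_2_nat[OF l] prime_odd_nat[OF l] by auto
  have \<zeta>l: "\<zeta> ^ l = 1"
  proof (cases "l = 2")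
    case False
    then have "(- cis (pi / real l)) ^ l = - (cis (pi / real l) ^ l)" using l3 by (intro power_minus_odd) auto
    also have "cis (pi / real l) ^ l = cis (real l * (pi / real l))" by (rule Complex.DeMoivre)
    also have "real l * (pi / real l) = pi" using l3[OF False] by simp
    finally have "(- cis (pi / real l)) ^ l = 1" by simp
    then show ?thesis using False by (simp add: \<zeta>_def)
  qed (simp add: \<zeta>_def)
  have \<zeta>_norm: "norm \<zeta> = 1" by (simp add: \<zeta>_def)
  have \<zeta>_Re: "Re \<zeta> < 0"
  proof (cases "l = 2")
    case False
    have "real l \<ge> 3" using l3[OF False] by simp
    then have "pi / real l < pi / 2" by (intro divide_strict_left_mono) auto
    then have "cos (pi / real l) > 0" using pi_gt_zero \<open>real l \<ge> 3\<close> by (intro cos_gt_zero) auto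
    then show ?thesis using False by (simp add: \<zeta>_def)
  qed (simp add: \<zeta>_def)
  have pow_eq: "\<zeta> ^ a = \<zeta> ^ b" if ab: "rich_product K a n" "rich_product K b n" for a b n
  proof -
    have cop: "coprime n K" using rich_product_coprime ab by blast
    \<comment> \<open>The length of a rich product inverse to \<open>n\<close>, namely a power with
      exponent \<open>totient K - 1\<close>. It makes \<open>a + t\<close> and \<open>b + t\<close>
      lengths of products congruent to 1.\<close>
    define t where "t = b * (totient K - 1)"
    have "totient K > 0" using K by simp
    then have "n * n ^ (totient K - 1) = n ^ totient K" by (metis Suc_diff_1 power_Suc)
    moreover have "[n ^ totient K = 1] (mod K)" by (rule euler_theorem[OF cop])
    ultimately have one: "[n * n ^ (totient K - 1) = 1] (mod K)" by simp
    have "l dvd a + t" "l dvd b + t"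
      unfolding t_def using rich_product_cong[OF rich_product_mult[OF _ rich_product_power[OF ab(2)]] one] ab by (blast intro: dvd)+
    then obtain i j where ij: "a + t = l * i" "b + t = l * j" by blast
    have "\<zeta> ^ (a + t) = \<zeta> ^ (b + t)" unfolding ij power_mult \<zeta>l by simp
    then show ?thesis using \<zeta>_norm by (auto simp: power_add)
  qed
  define ch where "ch = (\<lambda>n. if coprime n K then \<zeta> ^ (SOME a. rich_product K a n) else 0)"
  have ch: "ch n = \<zeta> ^ a" if "rich_product K a n" for a n
  proof -
    have "rich_product K (SOME a. rich_product K a n) n" using that by (rule someI)
    then show ?thesis using pow_eq[OF _ that] rich_product_coprime[OF that] by (simp add: ch_def)
  qed
  have ch_0: "ch n = 0" if "\<not> coprime n K" for n using that by (simp add: ch_def)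
  have ch_mult: "ch (m * n) = ch m * ch n" for m n
  proof (cases "coprime m K \<and> coprime n K")
    case True
    then obtain a b where "rich_product K a m" "rich_product K b n" using rich_product_exists[OF K] by blast
    then show ?thesis using ch rich_product_mult by (metis power_add)
  qed (auto simp: ch_0)
  have ch_cong: "ch m = ch n" if "[m = n] (mod K)" for m n
  proof (cases "coprime m K")
    case True
    then obtain a where "rich_product K a m" using rich_product_exists[OF K] by blast
    then show ?thesis using ch rich_product_cong[OF _ that] by metis
  next
    case False
    then have "\<not> coprime n K" using cong_imp_coprime[OF cong_sym[OF that]] by blast
    then show ?thesis using False ch_0 by simp
  qed
  obtain B where B: "\<And>P. finite P \<Longrightarrow> P \<subseteq> poor_primes K \<Longrightarrow> (\<Sum>p\<in>P. 1 / real p) \<le> B"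
    using poor_primes_bounded[OF K] by blast
  have ch_good: "ch p = \<zeta>" if "prime p" "p \<notin> poor_primes K" for p
    using ch[OF rich_product_single, of p] that by (auto simp: poor_primes_def)
  \<comment> \<open>A good prime exists because the reciprocals of all primes diverge.
    Multiplication by it permutes the classes and multiplies \<open>ch\<close> by a number other
    than 1, so the sum over a period vanishes.\<close>
  obtain c where c: "coprime c K" "ch c = \<zeta>"
  proof -
    obtain P where P: "finite P" "\<forall>p\<in>P. prime p" "(\<Sum>p\<in>P. 1 / real p) \<ge> B + 1"
      using prime_reciprocals_unbounded[of "B + 1"] by blast
    then have "\<not> P \<subseteq> poor_primes K" using B[of P] by auto
    then obtain p where "prime p" "p \<notin> poor_primes K" using P by blast
    then show thesis using that[of p] ch_good by (auto simp: poor_primes_def)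
  qed
  have \<zeta>1: "\<zeta> \<noteq> 1" using \<zeta>_Re by auto
  interpret periodic_character ch K
  proof
    show "K \<ge> 1" by (rule K)
    show "ch 1 = 1" using ch[OF rich_product_0] by simp
    show "ch (m * n) = ch m * ch n" for m n by (rule ch_mult)
    show "ch (n + K) = ch n" for n by (rule ch_cong) (simp add: cong_def)
    show "norm (ch n) \<le> 1" for n using \<zeta>_norm by (simp add: ch_def norm_power)
    have inj: "inj_on (\<lambda>n. (c * n) mod K) {..<K}"
    proof (rule inj_onI)
      fix m n assume mn: "m \<in> {..<K}" "n \<in> {..<K}" "(c * m) mod K = (c * n) mod K"
      then have "[m = n] (mod K)" using cong_mult_lcancel_nat[OF c(1), of m n] by (simp add: cong_def)
      then show "m = n" using mn by (simp add: cong_def)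
    qed
    moreover have "(\<lambda>n. (c * n) mod K) ` {..<K} \<subseteq> {..<K}" using K by auto
    ultimately have "(\<lambda>n. (c * n) mod K) ` {..<K} = {..<K}" by (intro endo_inj_surj) auto
    then have "(\<Sum>n<K. ch n) = (\<Sum>n<K. ch ((c * n) mod K))"
      using sum.reindex[OF inj, of ch] by simp
    also have "\<dots> = (\<Sum>n<K. ch (c * n))" by (intro sum.cong refl ch_cong) (simp add: cong_def)
    also have "\<dots> = \<zeta> * (\<Sum>n<K. ch n)" by (simp add: ch_mult c(2) sum_distrib_left)
    finally have "(1 - \<zeta>) * (\<Sum>n<K. ch n) = 0" by (simp add: algebra_simps)
    then show "(\<Sum>n<K. ch n) = 0" using \<zeta>1 by simp
  qed
  note facts = ch_good B \<zeta>_norm \<zeta>_Re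
  have Re: "Re \<zeta> = - 1" by (rule Re_zeta_eq_minus_1[OF facts])
  have L0: "(L \<longlongrightarrow> 0) (at_right 1)" by (rule L_tendsto_0[OF facts])
  have "\<zeta> = - 1"
  proof -
    have "(Im \<zeta>)\<^sup>2 = 0" using \<zeta>_norm Re cmod_power2[of \<zeta>] by simp
    then show ?thesis using Re by (simp add: complex_eq_iff)
  qed
  have vals: "ch n \<in> {- 1, 0, 1}" for n
  proof -
    have "(- 1 :: complex) ^ a \<in> {- 1, 1}" for a by (induction a) auto
    then show ?thesis using \<open>\<zeta> = - 1\<close> by (auto simp: ch_def)
  qed
  have "\<not> (L \<longlongrightarrow> 0) (at_right 1)"
  proof (rule real_character_L_nonvanishing[of "\<lambda>n. Re (ch n)"])
    show "ch n = of_real (Re (ch n))" for n using vals[of n] by auto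
    show "Re (ch n) \<in> {- 1, 0, 1}" for n using vals[of n] by auto
  qed
  then show False using L0 by contradiction
qed

definition shift_invariant_class :: "nat \<Rightarrow> nat \<Rightarrow> bool" where
  "shift_invariant_class K r \<longleftrightarrow> (\<forall>e>0. \<forall>\<^sub>F x in at_top. \<forall>b. unit_seq b \<longrightarrow>
     \<bar>class_avg K r (shift_seq 1 b) x - class_avg K r b x\<bar> \<le> e)"

text \<open>Two consecutive lengths \<open>a\<close> and \<open>a + 1\<close> return the class to
  itself. The shift by \<open>a\<close> of \<open>shift_seq 1 b\<close> is the shift by
  \<open>a + 1\<close> of \<open>b\<close>, so both averages are close to the same third
  one.\<close>

lemma shift_invariant_unit_class:
  assumes K: "K \<ge> 1" and r: "r \<in> unit_classes K"
  shows "shift_invariant_class K r"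
proof -
  obtain k where k: "rich_product K k 1" "\<not> 2 dvd k"
    using rich_product_lengths_coprime[OF K two_is_prime_nat] by blast
  have "\<exists>a\<in>{a. rich_product K a 1}. Suc a \<in> {a. rich_product K a 1}"
  proof (rule numerical_semigroup_consecutive)
    show "a + b \<in> {a. rich_product K a 1}" if "a \<in> {a. rich_product K a 1}" "b \<in> {a. rich_product K a 1}" for a b
      using rich_product_mult[of K a 1 b 1] that by simp
    show "0 \<in> {a. rich_product K a 1}" using rich_product_0 by simp
    show "k \<in> {a. rich_product K a 1}" "k > 0" using k by (auto intro: gr0I)
    show "\<exists>a\<in>{a. rich_product K a 1}. \<not> l dvd a" if "prime l" for l
      using rich_product_lengths_coprime[OF K that] by blast
  qed
  then obtain a where a: "rich_product K a 1" "rich_product K (Suc a) 1" by blast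
  have eq: "asymp_eq K r a r" "asymp_eq K r (Suc a) r"
    using rich_product_asymp_eq[OF K a(1) r r] rich_product_asymp_eq[OF K a(2) r r] by simp_all
  show ?thesis unfolding shift_invariant_class_def
  proof (intro allI impI)
    fix e :: real assume e: "e > 0"
    have "\<forall>\<^sub>F x in at_top. \<forall>b. unit_seq b \<longrightarrow> \<bar>class_avg K r b x - class_avg K r (shift_seq a b) x\<bar> \<le> e / 2"
      "\<forall>\<^sub>F x in at_top. \<forall>b. unit_seq b \<longrightarrow> \<bar>class_avg K r b x - class_avg K r (shift_seq (Suc a) b) x\<bar> \<le> e / 2"
      using eq half_gt_zero[OF e] unfolding asymp_eq_def by blast+
    then show "\<forall>\<^sub>F x in at_top. \<forall>b. unit_seq b \<longrightarrow> \<bar>class_avg K r (shift_seq 1 b) x - class_avg K r b x\<bar> \<le> e"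
    proof eventually_elim
      case (elim x)
      show ?case
      proof (intro allI impI)
        fix b assume b: "unit_seq b"
        then have "unit_seq (shift_seq 1 b)" by simp
        then have "\<bar>class_avg K r (shift_seq 1 b) x - class_avg K r (shift_seq (Suc a) b) x\<bar> \<le> e / 2"
          using elim(1)[rule_format, of "shift_seq 1 b"] by simp
        then show "\<bar>class_avg K r (shift_seq 1 b) x - class_avg K r b x\<bar> \<le> e"
          using elim(2)[rule_format, OF b] by linarith
      qed
    qed
  qed
qed

lemma Omega_mult: "m \<ge> 1 \<Longrightarrow> n \<ge> 1 \<Longrightarrow> Omega (m * n) = Omega m + Omega n"
  by (simp add: Omega_def prime_factorization_mult)

lemma class_avg_common_factor:
  assumes "g \<ge> 1" "x > 0"
  shows "class_avg (g * K) (g * r) b x = class_avg K r (shift_seq (Omega g) b) (x / real g) / real g"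
proof -
  have "class_sum (g * K) (g * r) b x = (\<Sum>n\<in>{n\<in>nats_upto x. g dvd n}. if [n = g * r] (mod g * K) then b (Omega n) else 0)"
    unfolding class_sum_def
  proof (intro sum.mono_neutral_right ballI)
    fix n assume "n \<in> nats_upto x - {n \<in> nats_upto x. g dvd n}"
    then have "\<not> g dvd n" by simp
    moreover have "g dvd n" if "[n = g * r] (mod g * K)"
    proof -
      have "[n = g * r] (mod g)" using that by (rule cong_dvd_modulus_nat) simp
      then show ?thesis by (simp add: cong_def mod_eq_0_iff_dvd)
    qed
    ultimately show "(if [n = g * r] (mod g * K) then b (Omega n) else 0) = 0" by auto
  qed auto
  also have "\<dots> = (\<Sum>m\<in>nats_upto (x / real g). if [g * m = g * r] (mod g * K) then b (Omega (g * m)) else 0)"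
    by (rule sum.reindex_bij_betw[OF bij_betw_multiples_upto[OF assms(1)], symmetric])
  also have "\<dots> = class_sum K r (shift_seq (Omega g) b) (x / real g)"
    unfolding class_sum_def
  proof (intro sum.cong refl)
    fix m assume m: "m \<in> nats_upto (x / real g)"
    have "[g * m = g * r] (mod g * K) \<longleftrightarrow> [m = r] (mod K)"
      using assms(1) by (simp add: cong_def mult_mod_right[symmetric])
    then show "(if [g * m = g * r] (mod g * K) then b (Omega (g * m)) else 0) =
        (if [m = r] (mod K) then shift_seq (Omega g) b (Omega m) else 0)"
      using m assms(1) by (simp add: Omega_mult shift_seq_def add.commute)
  qed
  finally show ?thesis using assms by (simp add: class_avg_def)
qed

text \<open>A common divisor \<open>g\<close> of the class and the modulus is factored out of
  \<open>n\<close>. It translates \<open>Omega\<close> by the constant \<open>Omega g\<close>, and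
  what remains is a unit class modulo \<open>K div g\<close>.\<close>

theorem shift_invariance:
  assumes K: "K \<ge> 1"
  shows "shift_invariant_class K r"
proof -
  define g where "g = gcd r K"
  have g: "g \<ge> 1" using K by (simp add: g_def Suc_le_eq)
  obtain r' K' where rK: "r = g * r'" "K = g * K'" "coprime r' K'"
  proof -
    have "r = g * (r div g)" "K = g * (K div g)" by (simp_all add: g_def)
    moreover have "coprime (r div g) (K div g)" unfolding g_def using K by (intro div_gcd_coprime) auto
    ultimately show thesis using that by blast
  qed
  have K': "K' \<ge> 1" using K rK by (cases K') auto
  define s where "s = r' mod K'"
  have s: "s \<in> unit_classes K'" unfolding s_def by (rule mod_in_unit_classes[OF K' rK(3)])
  have rs: "[n = r'] (mod K') \<longleftrightarrow> [n = s] (mod K')" for n by (simp add: s_def cong_def)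
  have avg: "class_avg K r b x = class_avg K' s (shift_seq (Omega g) b) (x * (1 / real g)) / real g" if "x > 0" for b x
    unfolding rK class_avg_common_factor[OF g that] by (simp add: class_avg_def class_sum_def rs)
  show ?thesis unfolding shift_invariant_class_def
  proof (intro allI impI)
    fix e :: real assume e: "e > 0"
    have "\<forall>\<^sub>F x in at_top. \<forall>b. unit_seq b \<longrightarrow> \<bar>class_avg K' s (shift_seq 1 b) x - class_avg K' s b x\<bar> \<le> e"
      using shift_invariant_unit_class[OF K' s] e unfolding shift_invariant_class_def by blast
    from eventually_at_top_mult[OF this, of "1 / real g"] g
    have "\<forall>\<^sub>F x in at_top. \<forall>b. unit_seq b \<longrightarrow>
      \<bar>class_avg K' s (shift_seq 1 b) (x * (1 / real g)) - class_avg K' s b (x * (1 / real g))\<bar> \<le> e" by simp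
    moreover have "\<forall>\<^sub>F x in at_top. x > (0::real)" by (rule eventually_gt_at_top)
    ultimately show "\<forall>\<^sub>F x in at_top. \<forall>b. unit_seq b \<longrightarrow> \<bar>class_avg K r (shift_seq 1 b) x - class_avg K r b x\<bar> \<le> e"
    proof eventually_elim
      case (elim x)
      show ?case
      proof (intro allI impI)
        fix b assume b: "unit_seq b"
        define y where "y = x * (1 / real g)"
        have "\<bar>class_avg K r (shift_seq 1 b) x - class_avg K r b x\<bar> =
            \<bar>class_avg K' s (shift_seq 1 (shift_seq (Omega g) b)) y - class_avg K' s (shift_seq (Omega g) b) y\<bar> / real g"
          using g by (simp add: avg[OF elim(2)] y_def add.commute flip: diff_divide_distrib)
        also have "\<dots> \<le> e / real g"
          using elim(1)[rule_format, of "shift_seq (Omega g) b"] b unfolding y_def by (intro divide_right_mono) auto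
        also have "\<dots> \<le> e / 1" using e g by (intro divide_left_mono) auto
        finally show "\<bar>class_avg K r (shift_seq 1 b) x - class_avg K r b x\<bar> \<le> e" by simp
      qed
    qed
  qed
qed

section \<open>The mean ergodic theorem\<close>

locale mpt = prob_space M for M :: "'a measure" +
  fixes T :: "'a \<Rightarrow> 'a"
  assumes preserving: "measure_preserving_map M T"
begin

lemma T_measurable [measurable]: "T \<in> measurable M M"
  using preserving by (simp add: measure_preserving_map_def)

lemma T_space: "x \<in> space M \<Longrightarrow> T x \<in> space M"
  using measurable_space[OF T_measurable] .

lemma distr_T: "distr M M T = M"
proof (rule measure_eqI)
  fix A assume "A \<in> sets (distr M M T)"
  then show "emeasure (distr M M T) A = emeasure M A"
    using preserving by (simp add: emeasure_distr measure_preserving_map_def)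
qed simp

lemma integral_T:
  fixes f :: "'a \<Rightarrow> real"
  assumes "f \<in> borel_measurable M"
  shows "(\<integral>x. f (T x) \<partial>M) = (\<integral>x. f x \<partial>M)"
  using integral_distr[OF T_measurable assms] by (simp add: distr_T)

lemma funpow_space: "x \<in> space M \<Longrightarrow> (T ^^ n) x \<in> space M"
  by (induction n) (auto intro: T_space)

lemma funpow_mpt: "mpt M (T ^^ n)"
proof
  show "measure_preserving_map M (T ^^ n)"
  proof (induction n)
    case 0
    have "(\<lambda>x. x) -` A \<inter> space M = A" if "A \<in> sets M" for A using sets.sets_into_space[OF that] by auto
    then show ?case by (simp add: measure_preserving_map_def id_def)
  next
    case (Suc n)
    have "emeasure M ((T ^^ Suc n) -` A \<inter> space M) = emeasure M A" if A: "A \<in> sets M" for A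
    proof -
      have "(T ^^ Suc n) -` A \<inter> space M = (T ^^ n) -` (T -` A \<inter> space M) \<inter> space M"
        using funpow_space by auto
      moreover have "T -` A \<inter> space M \<in> sets M" using A by measurable
      then have "emeasure M ((T ^^ n) -` (T -` A \<inter> space M) \<inter> space M) = emeasure M (T -` A \<inter> space M)"
        using Suc unfolding measure_preserving_map_def by blast
      ultimately show ?thesis using preserving A by (simp add: measure_preserving_map_def)
    qed
    moreover have "T ^^ Suc n \<in> measurable M M"
      using Suc T_measurable unfolding measure_preserving_map_def funpow.simps by (intro measurable_comp[of _ _ M]) auto
    ultimately show ?case unfolding measure_preserving_map_def by blast
  qed
qed

lemma funpow_measurable [measurable]: "T ^^ n \<in> measurable M M"
  using mpt.T_measurable[OF funpow_mpt] .

lemma integrable_bounded: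
  fixes f :: "'a \<Rightarrow> real"
  assumes "f \<in> borel_measurable M" "\<And>x. x \<in> space M \<Longrightarrow> \<bar>f x\<bar> \<le> C"
  shows "integrable M f"
  using assms by (intro integrable_const_bound[where B = C]) (auto intro: AE_I2)

definition birkhoff_sum :: "nat \<Rightarrow> ('a \<Rightarrow> real) \<Rightarrow> 'a \<Rightarrow> real" where
  "birkhoff_sum n f x = (\<Sum>i<n. f ((T ^^ i) x))"

lemma birkhoff_sum_measurable [measurable]:
  assumes [measurable]: "f \<in> borel_measurable M"
  shows "birkhoff_sum n f \<in> borel_measurable M"
  unfolding birkhoff_sum_def by measurable

lemma birkhoff_sum_Suc: "birkhoff_sum (Suc n) f x = f x + birkhoff_sum n f (T x)"
  unfolding birkhoff_sum_def by (subst sum.lessThan_Suc_shift) (simp add: funpow_swap1)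

text \<open>The maximum of the Birkhoff sums of lengths 1 to \<open>n + 1\<close>, in the recursive
  form from which Garsia's difference is immediate.\<close>

primrec max_sum :: "('a \<Rightarrow> real) \<Rightarrow> nat \<Rightarrow> 'a \<Rightarrow> real" where
  "max_sum h 0 x = h x"
| "max_sum h (Suc n) x = h x + max 0 (max_sum h n (T x))"

lemma max_sum_mono: "max_sum h n x \<le> max_sum h (Suc n) x"
proof (induction n arbitrary: x)
  case (Suc n)
  have "max_sum h (Suc n) x = h x + max 0 (max_sum h n (T x))" by simp
  moreover have "max_sum h (Suc (Suc n)) x = h x + max 0 (max_sum h (Suc n) (T x))" by (rule max_sum.simps(2))
  ultimately show ?case using max.mono[OF order_refl Suc[of "T x"], of 0] by linarith
qed simp

lemma birkhoff_sum_le_max_sum: "birkhoff_sum (Suc n) h x \<le> max_sum h n x"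
proof (induction n arbitrary: x)
  case 0
  then show ?case by (simp add: birkhoff_sum_def)
next
  case (Suc n)
  have "birkhoff_sum (Suc (Suc n)) h x = h x + birkhoff_sum (Suc n) h (T x)" by (rule birkhoff_sum_Suc)
  then show ?case using Suc[of "T x"] by simp
qed

lemma max_sum_measurable [measurable]:
  assumes [measurable]: "h \<in> borel_measurable M"
  shows "max_sum h n \<in> borel_measurable M"
proof (induction n)
  case 0
  then show ?case by simp
next
  case (Suc n)
  note Suc [measurable]
  show ?case unfolding max_sum.simps by measurable
qed

lemma max_sum_bounds:
  assumes "\<And>x. x \<in> space M \<Longrightarrow> \<bar>h x\<bar> \<le> C" "x \<in> space M"
  shows "- C \<le> max_sum h n x" "max_sum h n x \<le> real (Suc n) * C"
proof -
  have "- C \<le> max_sum h n x \<and> max_sum h n x \<le> real (Suc n) * C" using assms(2)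
  proof (induction n arbitrary: x)
    case 0
    then show ?case using assms(1)[of x] by auto
  next
    case (Suc n)
    have "C \<ge> 0" using assms(1)[OF Suc.prems] by linarith
    then have "real (Suc n) * C \<ge> 0" by simp
    then have "max 0 (max_sum h n (T x)) \<le> real (Suc n) * C" using Suc.IH[OF T_space[OF Suc.prems]] by (intro max.boundedI) auto
    moreover have "real (Suc (Suc n)) * C = C + real (Suc n) * C" by (simp add: algebra_simps)
    moreover have "max_sum h (Suc n) x = h x + max 0 (max_sum h n (T x))" by simp
    ultimately show ?case using assms(1)[OF Suc.prems] by linarith
  qed
  then show "- C \<le> max_sum h n x" "max_sum h n x \<le> real (Suc n) * C" by auto
qed

lemma invariant_mem_iff: "T -` B \<inter> space M = B \<Longrightarrow> x \<in> space M \<Longrightarrow> T x \<in> B \<longleftrightarrow> x \<in> B"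
  by blast

text \<open>Garsia's trick: \<open>max_sum h (Suc n) - max_sum h n \<circ> T\<close> has nonnegative integral over an
  invariant set and decreases to \<open>h\<close> wherever the Birkhoff sums are unbounded above.\<close>

lemma maximal_ergodic:
  assumes h [measurable]: "h \<in> borel_measurable M" and C: "\<And>x. x \<in> space M \<Longrightarrow> \<bar>h x\<bar> \<le> C"
    and B [measurable]: "B \<in> sets M" and inv: "T -` B \<inter> space M = B"
    and unb: "\<And>x c. x \<in> B \<Longrightarrow> \<exists>n. birkhoff_sum n h x > (c::real)"
  shows "(\<integral>x. indicator B x * h x \<partial>M) \<ge> 0"
proof -
  let ?\<Phi> = "max_sum h"
  \<comment> \<open>Equal to \<open>max_sum h (Suc n) x - max_sum h n (T x)\<close> on
    \<open>B\<close>, since \<open>max 0 y - y = max (- y) 0\<close>.\<close>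
  let ?g = "\<lambda>n x. indicator B x * (h x + max (- ?\<Phi> n (T x)) 0)"
  have int: "integrable M (\<lambda>x. indicator B x * ?\<Phi> n x)" for n
  proof (rule integrable_bounded)
    fix x assume "x \<in> space M"
    then have "- C \<le> ?\<Phi> n x" "?\<Phi> n x \<le> real (Suc n) * C" using max_sum_bounds[OF C] by auto
    then show "\<bar>indicator B x * ?\<Phi> n x\<bar> \<le> \<bar>C\<bar> + \<bar>real (Suc n) * C\<bar>" by (auto simp: indicator_def)
  qed measurable
  have intT: "integrable M (\<lambda>x. indicator B x * ?\<Phi> n (T x))" for n
  proof (rule integrable_bounded)
    fix x assume "x \<in> space M"
    then have "- C \<le> ?\<Phi> n (T x)" "?\<Phi> n (T x) \<le> real (Suc n) * C" using max_sum_bounds[OF C T_space] by auto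
    then show "\<bar>indicator B x * ?\<Phi> n (T x)\<bar> \<le> \<bar>C\<bar> + \<bar>real (Suc n) * C\<bar>" by (auto simp: indicator_def)
  qed measurable
  have eqT: "(\<integral>x. indicator B x * ?\<Phi> n (T x) \<partial>M) = (\<integral>x. indicator B x * ?\<Phi> n x \<partial>M)" for n
  proof -
    have "(\<integral>x. indicator B x * ?\<Phi> n (T x) \<partial>M) = (\<integral>x. indicator B (T x) * ?\<Phi> n (T x) \<partial>M)"
      using inv by (intro Bochner_Integration.integral_cong refl) (auto simp: indicator_def invariant_mem_iff)
    also have "\<dots> = (\<integral>x. indicator B x * ?\<Phi> n x \<partial>M)"
      by (rule integral_T[where f = "\<lambda>x. indicator B x * ?\<Phi> n x"]) measurable
    finally show ?thesis .
  qed
  have "0 \<le> (\<integral>x. ?g n x \<partial>M)" for n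
  proof -
    have "(\<integral>x. indicator B x * ?\<Phi> n x \<partial>M) \<le> (\<integral>x. indicator B x * ?\<Phi> (Suc n) x \<partial>M)"
      using max_sum_mono by (intro integral_mono int mult_left_mono) auto
    then have "0 \<le> (\<integral>x. indicator B x * ?\<Phi> (Suc n) x \<partial>M) - (\<integral>x. indicator B x * ?\<Phi> n (T x) \<partial>M)"
      unfolding eqT by simp
    also have "\<dots> = (\<integral>x. indicator B x * ?\<Phi> (Suc n) x - indicator B x * ?\<Phi> n (T x) \<partial>M)"
      by (rule Bochner_Integration.integral_diff[symmetric]) (rule int intT)+
    also have "\<dots> = (\<integral>x. ?g n x \<partial>M)"
      by (intro Bochner_Integration.integral_cong refl) (auto simp: indicator_def max_def)
    finally show ?thesis .
  qed
  moreover have "(\<lambda>n. \<integral>x. ?g n x \<partial>M) \<longlonglongrightarrow> (\<integral>x. indicator B x * h x \<partial>M)"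
  proof (rule integral_dominated_convergence[where w = "\<lambda>_. 2 * \<bar>C\<bar>"])
    show "AE x in M. (\<lambda>n. ?g n x) \<longlonglongrightarrow> indicator B x * h x"
    proof (rule AE_I2)
      fix x assume x: "x \<in> space M"
      show "(\<lambda>n. ?g n x) \<longlonglongrightarrow> indicator B x * h x"
      proof (cases "x \<in> B")
        case True
        then have "T x \<in> B" using inv x by blast
        then obtain k where k: "birkhoff_sum k h (T x) > 0" using unb[of "T x" 0] by auto
        then obtain j where j: "k = Suc j" by (cases k) (auto simp: birkhoff_sum_def)
        have "?\<Phi> n (T x) \<ge> 0" if "n \<ge> j" for n
        proof -
          have "?\<Phi> j (T x) \<le> ?\<Phi> n (T x)" using that by (rule lift_Suc_mono_le[of "\<lambda>n. max_sum h n (T x)", OF max_sum_mono])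
          then show ?thesis using birkhoff_sum_le_max_sum[of j h "T x"] k j by simp
        qed
        then have "\<forall>\<^sub>F n in sequentially. ?g n x = indicator B x * h x"
          by (intro eventually_sequentiallyI[of j]) (auto simp: max_def)
        then show ?thesis by (rule tendsto_eventually)
      qed simp
    qed
    show "AE x in M. norm (?g n x) \<le> 2 * \<bar>C\<bar>" for n
    proof (rule AE_I2)
      fix x assume x: "x \<in> space M"
      show "norm (?g n x) \<le> 2 * \<bar>C\<bar>"
        using C[OF x] max_sum_bounds(1)[where h = h and n = n, OF C T_space[OF x]] by (auto simp: indicator_def)
    qed
    show "(\<lambda>x. indicator B x * h x) \<in> borel_measurable M" by measurable
    show "(\<lambda>x. ?g n x) \<in> borel_measurable M" for n by measurable
  qed simp
  ultimately show ?thesis by (intro LIMSEQ_le_const) auto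
qed

text \<open>The set of points with unbounded sums is invariant. The maximal inequality gives
  \<open>h\<close> a nonnegative integral over it, so by hypothesis it has measure 0.\<close>

lemma birkhoff_sum_upper:
  assumes h [measurable]: "h \<in> borel_measurable M" and C: "\<And>x. x \<in> space M \<Longrightarrow> \<bar>h x\<bar> \<le> C"
    and neg: "\<And>B. B \<in> sets M \<Longrightarrow> T -` B \<inter> space M = B \<Longrightarrow> measure M B > 0 \<Longrightarrow> (\<integral>x. indicator B x * h x \<partial>M) < 0"
  shows "AE x in M. \<exists>c. \<forall>n. birkhoff_sum n h x \<le> c"
proof -
  define B where "B = {x \<in> space M. \<forall>c::nat. \<exists>n. birkhoff_sum n h x > real c}"
  have [measurable]: "B \<in> sets M" unfolding B_def by measurable
  obtain b :: nat where b: "C \<le> real b" using real_arch_simple by blast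
  have hb: "\<bar>h x\<bar> \<le> real b" if "x \<in> space M" for x using C[OF that] b by simp
  have "T x \<in> B \<longleftrightarrow> x \<in> B" if x: "x \<in> space M" for x
  proof
    assume "T x \<in> B"
    have "\<exists>n. birkhoff_sum n h x > real c" for c :: nat
    proof -
      obtain n where "birkhoff_sum n h (T x) > real (c + b)" using \<open>T x \<in> B\<close> unfolding B_def by blast
      then have "birkhoff_sum (Suc n) h x > real c" using hb[OF x] by (simp add: birkhoff_sum_Suc)
      then show ?thesis ..
    qed
    then show "x \<in> B" using x by (simp add: B_def)
  next
    assume "x \<in> B"
    have "\<exists>n. birkhoff_sum n h (T x) > real c" for c :: nat
    proof -
      obtain n where n: "birkhoff_sum n h x > real (c + b)" using \<open>x \<in> B\<close> unfolding B_def by blast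
      then obtain m where "n = Suc m" by (cases n) (auto simp: birkhoff_sum_def)
      with n have "birkhoff_sum m h (T x) > real c" using hb[OF x] by (simp add: birkhoff_sum_Suc)
      then show ?thesis ..
    qed
    then show "T x \<in> B" using T_space[OF x] by (simp add: B_def)
  qed
  then have inv: "T -` B \<inter> space M = B" by (auto simp: B_def)
  have "(\<integral>x. indicator B x * h x \<partial>M) \<ge> 0"
  proof (rule maximal_ergodic[OF h C _ inv])
    fix x c assume "x \<in> B"
    obtain k :: nat where "c \<le> real k" using real_arch_simple by blast
    moreover obtain n where "birkhoff_sum n h x > real k" using \<open>x \<in> B\<close> unfolding B_def by blast
    ultimately show "\<exists>n. birkhoff_sum n h x > c" by (intro exI[of _ n]) simp
  qed auto
  then have "measure M B = 0" using neg[OF _ inv] zero_less_measure_iff[of M B] by fastforce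
  then have "AE x in M. x \<notin> B" by (intro AE_not_in) (auto simp: null_sets_def emeasure_eq_measure)
  moreover have "AE x in M. x \<in> space M" by simp
  ultimately show ?thesis
  proof eventually_elim
    case (elim x)
    then obtain c :: nat where "\<not> (\<exists>n. birkhoff_sum n h x > real c)" unfolding B_def by blast
    then show ?case by (intro exI[of _ "real c"]) (auto simp: not_less)
  qed
qed

lemma birkhoff_sum_invariant:
  assumes "\<And>x. x \<in> space M \<Longrightarrow> F (T x) = F x" "x \<in> space M"
  shows "F ((T ^^ i) x) = F x"
  using assms by (induction i) (auto simp: funpow_space)

text \<open>Both \<open>f - F - e\<close> and \<open>F - f - e\<close> have negative integral over
  invariant sets of positive measure, so their Birkhoff sums are bounded above almost everywhere.
  This gives pointwise convergence, and dominated convergence turns it into convergence in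
  mean.\<close>

lemma mean_ergodic:
  assumes f [measurable]: "f \<in> borel_measurable M" and F [measurable]: "F \<in> borel_measurable M"
    and fC: "\<And>x. x \<in> space M \<Longrightarrow> \<bar>f x\<bar> \<le> C" and FC: "\<And>x. x \<in> space M \<Longrightarrow> \<bar>F x\<bar> \<le> C"
    and Finv: "\<And>x. x \<in> space M \<Longrightarrow> F (T x) = F x"
    and eq: "\<And>B. B \<in> sets M \<Longrightarrow> T -` B \<inter> space M = B \<Longrightarrow>
      (\<integral>x. indicator B x * f x \<partial>M) = (\<integral>x. indicator B x * F x \<partial>M)"
  shows "(\<lambda>N. \<integral>x. \<bar>birkhoff_sum N f x / real N - F x\<bar> \<partial>M) \<longlonglongrightarrow> 0"
proof -
  have intf: "integrable M (\<lambda>x. indicator B x * f x)" if [measurable]: "B \<in> sets M" for B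
    by (intro integrable_bounded[where C = "\<bar>C\<bar>"]) (auto simp: indicator_def intro: order_trans[OF fC abs_ge_self])
  have intF: "integrable M (\<lambda>x. indicator B x * F x)" if [measurable]: "B \<in> sets M" for B
    by (intro integrable_bounded[where C = "\<bar>C\<bar>"]) (auto simp: indicator_def intro: order_trans[OF FC abs_ge_self])
  have upper: "AE x in M. \<exists>c. \<forall>n. birkhoff_sum n (\<lambda>x. s * (f x - F x) - e) x \<le> c"
    if s: "\<bar>s\<bar> = 1" and e: "e > 0" for s e :: real
  proof (rule birkhoff_sum_upper)
    fix x assume x: "x \<in> space M"
    have "\<bar>s * (f x - F x) - e\<bar> \<le> \<bar>s\<bar> * \<bar>f x - F x\<bar> + e" using e by (simp flip: abs_mult)
    also have "\<dots> \<le> 2 * C + e" using s fC[OF x] FC[OF x] by simp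
    finally show "\<bar>s * (f x - F x) - e\<bar> \<le> 2 * C + e" .
  next
    fix B assume B [measurable]: "B \<in> sets M" and inv: "T -` B \<inter> space M = B" and pos: "measure M B > 0"
    have "(\<integral>x. indicator B x * (s * (f x - F x) - e) \<partial>M) =
        (\<integral>x. s * (indicator B x * f x) - s * (indicator B x * F x) - e * indicator B x \<partial>M)"
      by (intro Bochner_Integration.integral_cong refl) (simp add: algebra_simps)
    also have "\<dots> = s * (\<integral>x. indicator B x * f x \<partial>M) - s * (\<integral>x. indicator B x * F x \<partial>M) - e * measure M B"
      using intf[OF B] intF[OF B] by (simp add: emeasure_eq_measure less_top[symmetric])
    also have "\<dots> < 0" using eq[OF B inv] e pos by simp
    finally show "(\<integral>x. indicator B x * (s * (f x - F x) - e) \<partial>M) < 0" .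
  qed measurable
  have sums: "birkhoff_sum n (\<lambda>x. s * (f x - F x) - e) x = s * (birkhoff_sum n f x - real n * F x) - real n * e"
    if "x \<in> space M" for s e n x
    unfolding birkhoff_sum_def using that birkhoff_sum_invariant[of F x, OF Finv]
    by (simp add: sum_subtractf sum_distrib_left right_diff_distrib)
  \<comment> \<open>Countably many \<open>e\<close> are used so that one null set serves for all of
    them.\<close>
  have "AE x in M. \<forall>k::nat. (\<exists>c. \<forall>n. birkhoff_sum n (\<lambda>x. 1 * (f x - F x) - 1 / real (Suc k)) x \<le> c) \<and>
      (\<exists>c. \<forall>n. birkhoff_sum n (\<lambda>x. (-1) * (f x - F x) - 1 / real (Suc k)) x \<le> c)"
    unfolding AE_all_countable by (intro allI AE_conjI upper) auto
  moreover have "AE x in M. x \<in> space M" by simp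
  ultimately have ae: "AE x in M. (\<lambda>N. \<bar>birkhoff_sum N f x / real N - F x\<bar>) \<longlonglongrightarrow> 0"
  proof eventually_elim
    case (elim x)
    have "(\<lambda>N. birkhoff_sum N f x / real N - F x) \<longlonglongrightarrow> 0"
    proof (rule LIMSEQ_I)
      fix r :: real assume r: "r > 0"
      obtain k :: nat where k: "1 / real (Suc k) < r / 2" using reals_Archimedean[of "r / 2"] r by (auto simp: inverse_eq_divide)
      define e where "e = 1 / real (Suc k)"
      obtain c1 where c1: "\<forall>n. birkhoff_sum n (\<lambda>x. 1 * (f x - F x) - e) x \<le> c1" using elim(1) unfolding e_def by blast
      obtain c2 where c2: "\<forall>n. birkhoff_sum n (\<lambda>x. (-1) * (f x - F x) - e) x \<le> c2" using elim(1) unfolding e_def by blast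
      define c where "c = max 0 (max c1 c2)"
      have c: "\<bar>birkhoff_sum n f x - real n * F x\<bar> \<le> c + real n * e" for n
      proof -
        define X where "X = birkhoff_sum n f x - real n * F x"
        have "X - real n * e \<le> c1" "- X - real n * e \<le> c2"
          using c1[unfolded sums[OF elim(2)], rule_format, of n] c2[unfolded sums[OF elim(2)], rule_format, of n]
          by (simp_all add: X_def)
        then show ?thesis unfolding c_def X_def[symmetric] by linarith
      qed
      obtain n0 :: nat where n0: "2 * c / r < real n0" using reals_Archimedean2 by blast
      show "\<exists>n0. \<forall>n\<ge>n0. norm (birkhoff_sum n f x / real n - F x - 0) < r"
      proof (intro exI allI impI)
        fix n assume n: "n \<ge> Suc n0"
        have "2 * c / r < real n" using n n0 by linarith
        then have "c < real n * (r / 2)" using r by (simp add: field_simps)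
        moreover have "real n * e \<le> real n * (r / 2)" using k by (intro mult_left_mono) (auto simp: e_def)
        ultimately have "\<bar>birkhoff_sum n f x - real n * F x\<bar> < real n * r" using c[of n] by linarith
        moreover have "birkhoff_sum n f x / real n - F x = (birkhoff_sum n f x - real n * F x) / real n"
          using n by (simp add: diff_divide_distrib)
        ultimately show "norm (birkhoff_sum n f x / real n - F x - 0) < r"
          using n by (simp add: abs_divide divide_less_eq mult.commute)
      qed
    qed
    then show ?case by (simp add: tendsto_rabs_zero_iff)
  qed
  have "(\<lambda>N. \<integral>x. \<bar>birkhoff_sum N f x / real N - F x\<bar> \<partial>M) \<longlonglongrightarrow> (\<integral>x. 0 \<partial>M)"
  proof (rule integral_dominated_convergence[where w = "\<lambda>_. 2 * C"])
    show "AE x in M. norm \<bar>birkhoff_sum N f x / real N - F x\<bar> \<le> 2 * C" for N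
    proof (rule AE_I2)
      fix x assume x: "x \<in> space M"
      have "\<bar>birkhoff_sum N f x\<bar> \<le> (\<Sum>i<N. C)"
        unfolding birkhoff_sum_def using fC funpow_space[OF x] by (intro order_trans[OF sum_abs] sum_mono) auto
      moreover have "C \<ge> 0" using fC[OF x] by linarith
      ultimately have "\<bar>birkhoff_sum N f x / real N\<bar> \<le> C" by (cases "N = 0") (auto simp: abs_divide field_simps)
      then show "norm \<bar>birkhoff_sum N f x / real N - F x\<bar> \<le> 2 * C" using FC[OF x] unfolding real_norm_def abs_abs by linarith
    qed
  qed (use ae in auto)
  then show ?thesis by simp
qed

section \<open>Projections to invariant functions\<close>

definition invariant_algebra :: "'a measure" where
  "invariant_algebra = sigma (space M) {B \<in> sets M. T -` B \<inter> space M = B}"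

lemma sets_invariant_algebra: "sets invariant_algebra = {B \<in> sets M. T -` B \<inter> space M = B}"
proof -
  have "sigma_algebra (space M) {B \<in> sets M. T -` B \<inter> space M = B}"
    unfolding sigma_algebra_iff2
  proof (intro conjI ballI allI impI)
    show "{B \<in> sets M. T -` B \<inter> space M = B} \<subseteq> Pow (space M)" using sets.sets_into_space by auto
    fix B assume "B \<in> {B \<in> sets M. T -` B \<inter> space M = B}"
    then show "space M - B \<in> {B \<in> sets M. T -` B \<inter> space M = B}" using T_space by auto
  next
    fix A :: "nat \<Rightarrow> 'a set" assume A: "range A \<subseteq> {B \<in> sets M. T -` B \<inter> space M = B}"
    then have "T -` (\<Union>i. A i) \<inter> space M = (\<Union>i. A i)" by (subst vimage_UN) blast
    moreover have "(\<Union>i. A i) \<in> sets M" using A by (intro sets.countable_UN) auto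
    ultimately show "(\<Union>i. A i) \<in> {B \<in> sets M. T -` B \<inter> space M = B}" by blast
  qed auto
  then show ?thesis unfolding invariant_algebra_def
    using sets.sets_into_space by (subst sets_measure_of) (auto simp: sigma_algebra.sigma_sets_eq)
qed

lemma space_invariant_algebra: "space invariant_algebra = space M"
  unfolding invariant_algebra_def by (rule space_measure_of) (auto dest: sets.sets_into_space)

text \<open>The conditional expectation on the invariant sets, clipped to \<open>[a, b]\<close> so
  that the bounds hold at every point. Invariance also holds at every point: the level set through
  \<open>x\<close> belongs to the invariant algebra and therefore contains
  \<open>T x\<close>.\<close>

lemma invariant_projection:
  fixes f :: "'a \<Rightarrow> real"
  assumes f [measurable]: "f \<in> borel_measurable M" and bnd: "\<And>x. x \<in> space M \<Longrightarrow> a \<le> f x \<and> f x \<le> b"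
  obtains F where "F \<in> borel_measurable M" "\<And>x. x \<in> space M \<Longrightarrow> a \<le> F x \<and> F x \<le> b"
    "\<And>x. x \<in> space M \<Longrightarrow> F (T x) = F x"
    "\<And>G C. G \<in> borel_measurable M \<Longrightarrow> (\<And>x. x \<in> space M \<Longrightarrow> \<bar>G x\<bar> \<le> C) \<Longrightarrow>
      (\<And>x. x \<in> space M \<Longrightarrow> G (T x) = G x) \<Longrightarrow> (\<integral>x. G x * f x \<partial>M) = (\<integral>x. G x * F x \<partial>M)"
proof -
  let ?I = invariant_algebra
  interpret I: finite_measure_subalgebra M ?I
    by unfold_locales (auto simp: subalgebra_def space_invariant_algebra sets_invariant_algebra)
  define E where "E = real_cond_exp M ?I f"
  define F where "F = (\<lambda>x. max a (min b (E x)))"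
  have intf: "integrable M f" using bnd by (intro integrable_bounded[where C = "\<bar>a\<bar> + \<bar>b\<bar>"]) (auto dest!: bnd)
  have EI [measurable]: "E \<in> borel_measurable ?I" unfolding E_def by simp
  have EM [measurable]: "E \<in> borel_measurable M" unfolding E_def by simp
  have ab: "a \<le> b"
  proof -
    obtain x where "x \<in> space M" using not_empty by blast
    then show ?thesis using bnd[of x] by linarith
  qed
  have "AE x in M. E x \<ge> a" unfolding E_def using bnd by (intro I.real_cond_exp_ge_c intf AE_I2) auto
  moreover have "AE x in M. E x \<le> b" unfolding E_def using bnd by (intro I.real_cond_exp_le_c intf AE_I2) auto
  ultimately have EF: "AE x in M. E x = F x" by eventually_elim (auto simp: F_def)
  have Einv: "E (T x) = E x" if x: "x \<in> space M" for x
  proof -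
    have "E -` {E x} \<inter> space ?I \<in> sets ?I" by (rule measurable_sets[OF EI]) simp
    then have inv: "T -` (E -` {E x} \<inter> space M) \<inter> space M = E -` {E x} \<inter> space M"
      by (simp add: sets_invariant_algebra space_invariant_algebra)
    have "x \<in> E -` {E x} \<inter> space M" using x by simp
    then have "x \<in> T -` (E -` {E x} \<inter> space M)" using inv by blast
    then show ?thesis by simp
  qed
  show thesis
  proof (rule that[of F])
    show "F \<in> borel_measurable M" unfolding F_def by measurable
    show "a \<le> F x \<and> F x \<le> b" for x using ab by (auto simp: F_def)
    show "F (T x) = F x" if "x \<in> space M" for x using Einv[OF that] by (simp add: F_def)
    fix G :: "'a \<Rightarrow> real" and C
    assume G [measurable]: "G \<in> borel_measurable M" and GC: "\<And>x. x \<in> space M \<Longrightarrow> \<bar>G x\<bar> \<le> C"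
      and Ginv: "\<And>x. x \<in> space M \<Longrightarrow> G (T x) = G x"
    have GI: "G \<in> borel_measurable ?I"
    proof (rule measurableI)
      fix S :: "real set" assume S: "S \<in> sets borel"
      have "G -` S \<inter> space M \<in> sets M" using S by measurable
      moreover have "T -` (G -` S \<inter> space M) \<inter> space M = G -` S \<inter> space M" using Ginv T_space by auto
      ultimately show "G -` S \<inter> space ?I \<in> sets ?I" by (simp add: sets_invariant_algebra space_invariant_algebra)
    qed auto
    have int: "integrable M (\<lambda>x. G x * f x)"
    proof (rule integrable_bounded)
      fix x assume x: "x \<in> space M"
      have "\<bar>G x * f x\<bar> \<le> C * (\<bar>a\<bar> + \<bar>b\<bar>)" unfolding abs_mult using GC[OF x] bnd[OF x] by (intro mult_mono) auto
      then show "\<bar>G x * f x\<bar> \<le> C * (\<bar>a\<bar> + \<bar>b\<bar>)" .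
    qed measurable
    have "(\<integral>x. G x * f x \<partial>M) = (\<integral>x. G x * E x \<partial>M)"
      unfolding E_def using I.real_cond_exp_intg(2)[OF int GI f] by simp
    also have "\<dots> = (\<integral>x. G x * F x \<partial>M)"
      using EF by (intro integral_cong_AE) (auto simp: F_def elim!: eventually_mono)
    finally show "(\<integral>x. G x * f x \<partial>M) = (\<integral>x. G x * F x \<partial>M)" .
  qed
qed

end

context mpt
begin

text \<open>Convergence in mean tested against \<open>h\<close>. The sum starts at 1, so the
  Birkhoff average is evaluated at \<open>T x\<close>; invariance of \<open>F\<close> and of the
  measure absorbs this.\<close>

lemma weak_mean_ergodic:
  assumes f [measurable]: "f \<in> borel_measurable M" and F [measurable]: "F \<in> borel_measurable M"
    and fC: "\<And>x. x \<in> space M \<Longrightarrow> \<bar>f x\<bar> \<le> C" and FC: "\<And>x. x \<in> space M \<Longrightarrow> \<bar>F x\<bar> \<le> C"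
    and Finv: "\<And>x. x \<in> space M \<Longrightarrow> F (T x) = F x"
    and eq: "\<And>B. B \<in> sets M \<Longrightarrow> T -` B \<inter> space M = B \<Longrightarrow>
      (\<integral>x. indicator B x * f x \<partial>M) = (\<integral>x. indicator B x * F x \<partial>M)"
    and h [measurable]: "h \<in> borel_measurable M" and h1: "\<And>x. x \<in> space M \<Longrightarrow> \<bar>h x\<bar> \<le> 1"
  shows "(\<lambda>N. (\<Sum>m=1..N. \<integral>x. h x * f ((T ^^ m) x) \<partial>M) / real N) \<longlonglongrightarrow> (\<integral>x. h x * F x \<partial>M)"
proof -
  let ?A = "\<lambda>N x. birkhoff_sum N f x / real N"
  have C0: "C \<ge> 0"
  proof -
    obtain x where "x \<in> space M" using not_empty by blast
    then show ?thesis using fC[of x] by linarith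
  qed
  have hf: "\<bar>h x * y\<bar> \<le> C" if "x \<in> space M" "\<bar>y\<bar> \<le> C" for x y
    using mult_mono[OF h1[OF that(1)] that(2)] by (simp add: abs_mult)
  have int1: "integrable M (\<lambda>x. h x * f ((T ^^ m) x))" for m
    using hf fC funpow_space by (intro integrable_bounded[where C = C]) auto
  have int2: "integrable M (\<lambda>x. h x * F x)"
    using hf FC by (intro integrable_bounded[where C = C]) auto
  have A: "\<bar>?A N x\<bar> \<le> C" if x: "x \<in> space M" for N x
  proof -
    have "\<bar>birkhoff_sum N f x\<bar> \<le> (\<Sum>i<N. C)"
      unfolding birkhoff_sum_def using fC funpow_space[OF x] by (intro order_trans[OF sum_abs] sum_mono) auto
    then show ?thesis using C0 by (cases "N = 0") (auto simp: abs_divide field_simps)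
  qed
  have int3: "integrable M (\<lambda>x. \<bar>?A N x - F x\<bar>)" for N
  proof (rule integrable_bounded[where C = "2 * C"])
    fix x assume x: "x \<in> space M"
    show "\<bar>\<bar>?A N x - F x\<bar>\<bar> \<le> 2 * C" using A[OF x, of N] FC[OF x] by linarith
  qed measurable
  have int4: "integrable M (\<lambda>x. h x * ?A N (T x))" for N
  proof (rule integrable_bounded[where C = C])
    show "\<bar>h x * ?A N (T x)\<bar> \<le> C" if x: "x \<in> space M" for x using hf[OF x A[OF T_space[OF x]]] .
  qed measurable
  have bound: "\<bar>(\<Sum>m=1..N. \<integral>x. h x * f ((T ^^ m) x) \<partial>M) / real N - (\<integral>x. h x * F x \<partial>M)\<bar>
      \<le> (\<integral>x. \<bar>?A N x - F x\<bar> \<partial>M)" for N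
  proof -
    have "(\<Sum>m=1..N. \<integral>x. h x * f ((T ^^ m) x) \<partial>M) / real N = (\<integral>x. h x * ?A N (T x) \<partial>M)"
    proof -
      have "(\<Sum>m=1..N. \<integral>x. h x * f ((T ^^ m) x) \<partial>M) = (\<integral>x. (\<Sum>m=1..N. h x * f ((T ^^ m) x)) \<partial>M)"
        by (rule Bochner_Integration.integral_sum[symmetric]) (rule int1)
      also have "\<dots> = (\<integral>x. h x * birkhoff_sum N f (T x) \<partial>M)"
      proof (intro Bochner_Integration.integral_cong refl)
        fix x
        have "(\<Sum>m=1..N. h x * f ((T ^^ m) x)) = (\<Sum>i<N. h x * f ((T ^^ Suc i) x))"
          by (rule sum.reindex_bij_witness[of _ Suc "\<lambda>m. m - 1"]) auto
        then show "(\<Sum>m=1..N. h x * f ((T ^^ m) x)) = h x * birkhoff_sum N f (T x)"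
          by (simp add: birkhoff_sum_def sum_distrib_left funpow_swap1)
      qed
      finally show ?thesis by simp
    qed
    then have "(\<Sum>m=1..N. \<integral>x. h x * f ((T ^^ m) x) \<partial>M) / real N - (\<integral>x. h x * F x \<partial>M) =
        (\<integral>x. h x * ?A N (T x) - h x * F x \<partial>M)"
      using int4 int2 by simp
    also have "\<bar>\<dots>\<bar> \<le> (\<integral>x. \<bar>?A N (T x) - F (T x)\<bar> \<partial>M)"
    proof (rule order_trans[OF integral_abs_bound], rule integral_mono)
      show "integrable M (\<lambda>x. \<bar>h x * ?A N (T x) - h x * F x\<bar>)" using int4 int2 by simp
      show "integrable M (\<lambda>x. \<bar>?A N (T x) - F (T x)\<bar>)"
      proof (rule integrable_bounded[where C = "2 * C"])
        fix x assume x: "x \<in> space M"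
        show "\<bar>\<bar>?A N (T x) - F (T x)\<bar>\<bar> \<le> 2 * C" using A[OF T_space[OF x], of N] FC[OF T_space[OF x]] by linarith
      qed measurable
      fix x assume x: "x \<in> space M"
      have "\<bar>h x * ?A N (T x) - h x * F x\<bar> = \<bar>h x\<bar> * \<bar>?A N (T x) - F (T x)\<bar>"
        unfolding Finv[OF x] right_diff_distrib[symmetric] by (rule abs_mult)
      then show "\<bar>h x * ?A N (T x) - h x * F x\<bar> \<le> \<bar>?A N (T x) - F (T x)\<bar>"
        using mult_right_mono[OF h1[OF x], of "\<bar>?A N (T x) - F (T x)\<bar>"] by simp
    qed
    also have "\<dots> = (\<integral>x. \<bar>?A N x - F x\<bar> \<partial>M)"
      by (rule integral_T[where f = "\<lambda>x. \<bar>?A N x - F x\<bar>"]) measurable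
    finally show ?thesis .
  qed
  have "(\<lambda>N. (\<Sum>m=1..N. \<integral>x. h x * f ((T ^^ m) x) \<partial>M) / real N - (\<integral>x. h x * F x \<partial>M)) \<longlonglongrightarrow> 0"
    by (rule Lim_null_comparison[OF always_eventually mean_ergodic[OF f F fC FC Finv eq]])
       (use bound in \<open>auto simp: real_norm_def\<close>)
  then show ?thesis by (simp add: LIM_zero_iff)
qed

lemma ergodic_invariant_integral:
  fixes f :: "'a \<Rightarrow> real"
  assumes "ergodic_map M T" and [measurable]: "f \<in> borel_measurable M" "B \<in> sets M"
    and inv: "T -` B \<inter> space M = B"
  shows "(\<integral>x. indicator B x * f x \<partial>M) = (\<integral>x. indicator B x * (\<integral>x. f x \<partial>M) \<partial>M)"
proof -
  consider "measure M B = 0" | "measure M B = 1" using assms(1,3) inv unfolding ergodic_map_def by blast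
  then show ?thesis
  proof cases
    case 1
    then have "AE x in M. x \<notin> B" by (intro AE_not_in) (auto simp: null_sets_def emeasure_eq_measure)
    then have "(\<integral>x. indicator B x * f x \<partial>M) = (\<integral>x. 0 \<partial>M)"
      by (intro integral_cong_AE) (auto elim!: eventually_mono)
    then show ?thesis using 1 by simp
  next
    case 2
    then have "AE x in M. x \<in> B" by (subst (asm) prob_eq_1) auto
    then have "(\<integral>x. indicator B x * f x \<partial>M) = (\<integral>x. f x \<partial>M)"
      by (intro integral_cong_AE) (auto elim!: eventually_mono)
    then show ?thesis using 2 by simp
  qed
qed

text \<open>An energy argument: let \<open>q k\<close> be the squared norm of the projection
  \<open>Pr k\<close> of \<open>a\<close> to the functions invariant under \<open>T ^^ k\<close>,
  and let \<open>q K\<close> be within \<open>\<epsilon>\<close> of the supremum. Whatever invariant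
  part \<open>a - Pr K\<close> still has under some \<open>T ^^ k\<close> would also show in
  \<open>Pr (k * K)\<close>, so its squared norm is at most \<open>q (k * K) - q K\<close>.\<close>

lemma rational_decomposition:
  fixes a :: "'a \<Rightarrow> real"
  assumes a [measurable]: "a \<in> borel_measurable M" and a01: "\<And>x. x \<in> space M \<Longrightarrow> 0 \<le> a x \<and> a x \<le> 1"
    and "\<epsilon> > 0"
  obtains K F where "K \<ge> 1" "F \<in> borel_measurable M" "\<And>x. x \<in> space M \<Longrightarrow> 0 \<le> F x \<and> F x \<le> 1"
    "\<And>x. x \<in> space M \<Longrightarrow> F ((T ^^ K) x) = F x"
    "\<And>k. k \<ge> 1 \<Longrightarrow> \<exists>c\<le>\<epsilon>. (\<lambda>N. (\<Sum>m=1..N. \<integral>x. (a x - F x) * (a ((T ^^ (k * m)) x) - F ((T ^^ (k * m)) x)) \<partial>M) / real N) \<longlonglongrightarrow> c"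
proof -
  define proj where "proj k F \<longleftrightarrow> F \<in> borel_measurable M \<and> (\<forall>x\<in>space M. 0 \<le> F x \<and> F x \<le> 1) \<and>
    (\<forall>x\<in>space M. F ((T ^^ k) x) = F x) \<and>
    (\<forall>G C. G \<in> borel_measurable M \<longrightarrow> (\<forall>x\<in>space M. \<bar>G x\<bar> \<le> C) \<longrightarrow> (\<forall>x\<in>space M. G ((T ^^ k) x) = G x) \<longrightarrow>
       (\<integral>x. G x * a x \<partial>M) = (\<integral>x. G x * F x \<partial>M))" for k F
  have "\<exists>F. proj k F" for k
  proof -
    interpret Tk: mpt M "T ^^ k" by (rule funpow_mpt)
    show ?thesis
    proof (rule Tk.invariant_projection[OF a a01])
      fix F assume F: "F \<in> borel_measurable M" "\<And>x. x \<in> space M \<Longrightarrow> 0 \<le> F x \<and> F x \<le> 1"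
        "\<And>x. x \<in> space M \<Longrightarrow> F ((T ^^ k) x) = F x"
        "\<And>G C. G \<in> borel_measurable M \<Longrightarrow> (\<And>x. x \<in> space M \<Longrightarrow> \<bar>G x\<bar> \<le> C) \<Longrightarrow>
          (\<And>x. x \<in> space M \<Longrightarrow> G ((T ^^ k) x) = G x) \<Longrightarrow> (\<integral>x. G x * a x \<partial>M) = (\<integral>x. G x * F x \<partial>M)"
      have "proj k F" unfolding proj_def
      proof (intro conjI allI impI)
        fix G :: "'a \<Rightarrow> real" and C :: real assume "G \<in> borel_measurable M" "\<forall>x\<in>space M. \<bar>G x\<bar> \<le> C" "\<forall>x\<in>space M. G ((T ^^ k) x) = G x"
        then show "(\<integral>x. G x * a x \<partial>M) = (\<integral>x. G x * F x \<partial>M)" by (intro F(4)[of G C]) auto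
      qed (use F(1-3) in auto)
      then show ?thesis by blast
    qed
  qed
  then obtain Pr where "\<And>k. proj k (Pr k)" by metis
  then have Pr: "\<And>k. Pr k \<in> borel_measurable M" "\<And>k x. x \<in> space M \<Longrightarrow> 0 \<le> Pr k x \<and> Pr k x \<le> 1"
    "\<And>k x. x \<in> space M \<Longrightarrow> Pr k ((T ^^ k) x) = Pr k x"
    "\<And>k G C. G \<in> borel_measurable M \<Longrightarrow> \<forall>x\<in>space M. \<bar>G x\<bar> \<le> C \<Longrightarrow> \<forall>x\<in>space M. G ((T ^^ k) x) = G x \<Longrightarrow>
       (\<integral>x. G x * a x \<partial>M) = (\<integral>x. G x * Pr k x \<partial>M)"
    unfolding proj_def by blast+
  note Pr(1) [measurable]
  have int: "integrable M (\<lambda>x. f x * g x)"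
    if [measurable]: "f \<in> borel_measurable M" "g \<in> borel_measurable M"
      and "\<And>x. x \<in> space M \<Longrightarrow> \<bar>f x\<bar> \<le> 1" "\<And>x. x \<in> space M \<Longrightarrow> \<bar>g x\<bar> \<le> 1" for f g :: "'a \<Rightarrow> real"
    using that(3,4) by (intro integrable_bounded[where C = 1]) (auto simp: abs_mult intro!: mult_le_one)
  have Pr1: "\<bar>Pr k x\<bar> \<le> 1" if "x \<in> space M" for k x using Pr(2)[OF that, of k] by simp
  have a1: "\<bar>a x\<bar> \<le> 1" if "x \<in> space M" for x using a01[OF that] by simp
  have inv_mult: "G ((T ^^ (k * j)) x) = G x" if "\<And>x. x \<in> space M \<Longrightarrow> G ((T ^^ k) x) = G x" "x \<in> space M" for G :: "'a \<Rightarrow> real" and k j x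
  proof -
    interpret Tk: mpt M "T ^^ k" by (rule funpow_mpt)
    show ?thesis using Tk.birkhoff_sum_invariant[of G x j] that unfolding funpow_mult by blast
  qed
  define q where "q = (\<lambda>k. \<integral>x. Pr k x * Pr k x \<partial>M)"
  have "q k \<le> 1" for k
  proof -
    have "q k \<le> (\<integral>x. 1 \<partial>M)" unfolding q_def
      using Pr(2) by (intro integral_mono int) (auto simp: abs_le_iff intro!: mult_le_one order_trans[of "- _" 0])
    then show ?thesis using prob_space by simp
  qed
  then have bdd: "bdd_above (q ` {1..})" by (intro bdd_aboveI[of _ 1]) auto
  obtain K where K: "K \<ge> 1" "q K > Sup (q ` {1..}) - \<epsilon>"
  proof -
    have "\<exists>y\<in>q ` {1..}. Sup (q ` {1..}) - \<epsilon> < y" using \<open>\<epsilon> > 0\<close> by (intro less_cSupD) auto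
    then show thesis using that by auto
  qed
  have qK: "q k - q K \<le> \<epsilon>" if "k \<ge> 1" for k
  proof -
    have "q k \<le> Sup (q ` {1..})" using that by (intro cSup_upper bdd) auto
    then show ?thesis using K(2) by linarith
  qed
  let ?F = "Pr K"
  let ?f = "\<lambda>x. a x - ?F x"
  have f1: "-1 \<le> ?f x \<and> ?f x \<le> 1" if "x \<in> space M" for x using a01[OF that] Pr(2)[OF that, of K] by linarith
  have fabs: "\<bar>?f x\<bar> \<le> 1" if "x \<in> space M" for x using f1[OF that] by linarith
  show thesis
  proof (rule that[OF K(1) Pr(1) Pr(2) Pr(3)])
    fix k :: nat assume k: "k \<ge> 1"
    interpret Tk: mpt M "T ^^ k" by (rule funpow_mpt)
    obtain G where G [measurable]: "G \<in> borel_measurable M" and G1: "\<And>x. x \<in> space M \<Longrightarrow> -1 \<le> G x \<and> G x \<le> 1"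
      and Ginv: "\<And>x. x \<in> space M \<Longrightarrow> G ((T ^^ k) x) = G x"
      and Gp: "\<And>H C. H \<in> borel_measurable M \<Longrightarrow> (\<And>x. x \<in> space M \<Longrightarrow> \<bar>H x\<bar> \<le> C) \<Longrightarrow>
        (\<And>x. x \<in> space M \<Longrightarrow> H ((T ^^ k) x) = H x) \<Longrightarrow> (\<integral>x. H x * ?f x \<partial>M) = (\<integral>x. H x * G x \<partial>M)"
      by (rule Tk.invariant_projection[of ?f "-1" 1]) (use f1 in auto)
    have Gabs: "\<bar>G x\<bar> \<le> 1" if "x \<in> space M" for x using G1[OF that] by linarith
    \<comment> \<open>Functions invariant under \<open>T ^^ k\<close> or \<open>T ^^ K\<close> are
      invariant under \<open>T ^^ (k * K)\<close>, so \<open>P\<close> replaces \<open>a\<close> in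
      all inner products with \<open>G\<close> and \<open>Pr K\<close>. Expanding the squared norm
      of \<open>G - (P - Pr K)\<close> then bounds that of \<open>G\<close>.\<close>
    define P where "P = Pr (k * K)"
    have [measurable]: "P \<in> borel_measurable M" by (simp add: P_def)
    have P1: "\<bar>P x\<bar> \<le> 1" if "x \<in> space M" for x using Pr1[OF that] by (simp add: P_def)
    have 1: "(\<integral>x. G x * ?f x \<partial>M) = (\<integral>x. G x * G x \<partial>M)" using Gp[OF G Gabs Ginv] .
    have 2: "(\<integral>x. G x * a x \<partial>M) = (\<integral>x. G x * P x \<partial>M)"
      unfolding P_def using Gabs inv_mult[of G k, OF Ginv] by (intro Pr(4)[of _ 1]) auto
    have 3: "(\<integral>x. ?F x * a x \<partial>M) = (\<integral>x. ?F x * P x \<partial>M)"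
      unfolding P_def using Pr1 inv_mult[of ?F K _ k, OF Pr(3)] by (intro Pr(4)[of _ 1]) (auto simp: mult.commute)
    have 4: "(\<integral>x. ?F x * a x \<partial>M) = (\<integral>x. ?F x * ?F x \<partial>M)"
      using Pr1 Pr(3) by (intro Pr(4)[of _ 1]) auto
    note ints = int[OF G G Gabs Gabs] int[OF G a Gabs a1] int[OF G Pr(1) Gabs Pr1] int[of G P, OF G _ Gabs P1]
      int[of P P, OF _ _ P1 P1] int[of ?F P, OF _ _ Pr1 P1] int[of ?F ?F, OF _ _ Pr1 Pr1]
    have G2: "(\<integral>x. G x * G x \<partial>M) = (\<integral>x. G x * P x \<partial>M) - (\<integral>x. G x * ?F x \<partial>M)"
      using 1 2 ints by (simp add: right_diff_distrib)
    have nonneg: "0 \<le> (\<integral>x. (G x - (P x - ?F x)) * (G x - (P x - ?F x)) \<partial>M)" by (intro Bochner_Integration.integral_nonneg) auto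
    also have "\<dots> = (\<integral>x. G x * G x + P x * P x + ?F x * ?F x - 2 * (G x * P x) + 2 * (G x * ?F x) - 2 * (?F x * P x) \<partial>M)"
      by (intro Bochner_Integration.integral_cong refl) (simp add: algebra_simps)
    also have "\<dots> = (\<integral>x. G x * G x \<partial>M) + (\<integral>x. P x * P x \<partial>M) + (\<integral>x. ?F x * ?F x \<partial>M)
        - 2 * (\<integral>x. G x * P x \<partial>M) + 2 * (\<integral>x. G x * ?F x \<partial>M) - 2 * (\<integral>x. ?F x * P x \<partial>M)"
      using ints by simp
    also have "\<dots> = q (k * K) - q K - (\<integral>x. G x * G x \<partial>M)"
      using G2 3 4 unfolding q_def P_def[symmetric] by simp
    finally have "(\<integral>x. G x * G x \<partial>M) \<le> q (k * K) - q K" by simp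
    also have "\<dots> \<le> \<epsilon>" using k K by (intro qK) (simp add: Suc_le_eq)
    finally have c: "(\<integral>x. ?f x * G x \<partial>M) \<le> \<epsilon>" using 1 by (simp add: mult.commute)
    have "(\<lambda>N. (\<Sum>m=1..N. \<integral>x. ?f x * ?f (((T ^^ k) ^^ m) x) \<partial>M) / real N) \<longlonglongrightarrow> (\<integral>x. ?f x * G x \<partial>M)"
    proof (rule Tk.weak_mean_ergodic[where C = 1])
      fix B assume B: "B \<in> sets M" "(T ^^ k) -` B \<inter> space M = B"
      show "(\<integral>x. indicator B x * ?f x \<partial>M) = (\<integral>x. indicator B x * G x \<partial>M)"
        using B Tk.invariant_mem_iff[OF B(2)] by (intro Gp[of _ 1]) (auto simp: indicator_def)
    qed (use fabs Gabs Ginv in auto)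
    then show "\<exists>c\<le>\<epsilon>. (\<lambda>N. (\<Sum>m=1..N. \<integral>x. ?f x * (a ((T ^^ (k * m)) x) - ?F ((T ^^ (k * m)) x)) \<partial>M) / real N) \<longlonglongrightarrow> c"
      using c by (auto simp: funpow_mult mult.commute)
  qed auto
qed

end

section \<open>Averages along multiplicative sequences\<close>

lemma turan_kubilius_weights:
  assumes "\<eta> > 0"
  obtains P and w :: "nat \<Rightarrow> real" where "finite P" "\<And>p. p \<in> P \<Longrightarrow> prime p" "\<And>p. w p \<ge> 0" "sum w P = 1"
    "(\<Sum>p\<in>P. (w p)\<^sup>2 * real p) < \<eta>\<^sup>2"
proof -
  obtain P where P: "finite P" "\<forall>p\<in>P. prime p" "(\<Sum>p\<in>P. 1 / real p) \<ge> 2 / \<eta>\<^sup>2"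
    using prime_reciprocals_unbounded[of "2 / \<eta>\<^sup>2"] by blast
  define B where "B = (\<Sum>p\<in>P. 1 / real p)"
  have "2 / \<eta>\<^sup>2 > 0" using assms by simp
  then have Bpos: "B > 0" using P(3) unfolding B_def by linarith
  have "2 \<le> B * \<eta>\<^sup>2" using P(3) assms by (simp add: B_def field_simps)
  then have B2: "1 / B < \<eta>\<^sup>2" using Bpos by (simp add: field_simps)
  define w where "w = (\<lambda>p. 1 / real p / B)"
  have w1: "sum w P = 1" using Bpos unfolding w_def sum_divide_distrib[symmetric] B_def[symmetric] by simp
  have "(\<Sum>p\<in>P. (w p)\<^sup>2 * real p) = (\<Sum>p\<in>P. 1 / B * w p)"
    using P(2) Bpos by (intro sum.cong refl) (auto simp: w_def power2_eq_square field_simps prime_gt_0_nat)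
  also have "\<dots> = 1 / B" using w1 unfolding sum_distrib_left[symmetric] by simp
  finally show thesis using that[of P w] P w1 B2 Bpos by (auto simp: w_def)
qed

context mpt
begin

text \<open>Shift invariance allows \<open>b\<close> to be replaced by the mean of its first
  \<open>J\<close> shifts, which is the Birkhoff average of \<open>g\<close> at the point moved by
  \<open>Omega n\<close>. Uniformity in \<open>b\<close> makes the threshold for \<open>N\<close>
  independent of \<open>x\<close>. That average has small norm by ergodicity, and the motion by
  \<open>Omega n\<close> preserves the norm.\<close>

lemma class_avg_tendsto_0:
  fixes g :: "'a \<Rightarrow> real"
  assumes erg: "ergodic_map M T" and g [measurable]: "g \<in> borel_measurable M"
    and g1: "\<And>x. x \<in> space M \<Longrightarrow> \<bar>g x\<bar> \<le> 1" and g0: "(\<integral>x. g x \<partial>M) = 0" and K: "K \<ge> 1"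
  shows "(\<lambda>N. \<integral>x. \<bar>class_avg K r (\<lambda>m. g ((T ^^ m) x)) (real N)\<bar> \<partial>M) \<longlonglongrightarrow> 0"
proof (rule LIMSEQ_I)
  fix e :: real assume e: "e > 0"
  have "(\<lambda>J. \<integral>x. \<bar>birkhoff_sum J g x / real J - 0\<bar> \<partial>M) \<longlonglongrightarrow> 0"
  proof (rule mean_ergodic[where C = 1 and F = "\<lambda>_. 0"])
    fix B assume B: "B \<in> sets M" "T -` B \<inter> space M = B"
    show "(\<integral>x. indicator B x * g x \<partial>M) = (\<integral>x. indicator B x * 0 \<partial>M)"
      using ergodic_invariant_integral[OF erg g B] g0 by simp
  qed (use g1 in auto)
  then have "\<forall>\<^sub>F J in sequentially. (\<integral>x. \<bar>birkhoff_sum J g x / real J - 0\<bar> \<partial>M) < e / 4"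
    using e by (intro order_tendstoD) auto
  moreover have "\<forall>\<^sub>F J in sequentially. J \<ge> (1::nat)" by (rule eventually_ge_at_top)
  ultimately have "\<forall>\<^sub>F J in sequentially. J \<ge> 1 \<and> (\<integral>x. \<bar>birkhoff_sum J g x / real J\<bar> \<partial>M) < e / 4"
    by eventually_elim simp
  then obtain J :: nat where J: "J \<ge> 1" "(\<integral>x. \<bar>birkhoff_sum J g x / real J\<bar> \<partial>M) < e / 4"
    unfolding eventually_sequentially by blast
  \<comment> \<open>Shifting by \<open>i < J\<close> costs at most
    \<open>J * \<eta> = e / 4\<close>.\<close>
  define \<eta> where "\<eta> = e / (4 * real J)"
  have \<eta>: "\<eta> > 0" using e J by (simp add: \<eta>_def)
  have "\<forall>\<^sub>F x in at_top. \<forall>b. unit_seq b \<longrightarrow> \<bar>class_avg K r (shift_seq 1 b) x - class_avg K r b x\<bar> \<le> \<eta>"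
    using shift_invariance[OF K, of r] \<eta> unfolding shift_invariant_class_def by blast
  then have "\<forall>\<^sub>F N in sequentially. \<forall>b. unit_seq b \<longrightarrow>
      \<bar>class_avg K r (shift_seq 1 b) (real N) - class_avg K r b (real N)\<bar> \<le> \<eta>"
    using filterlim_real_sequentially unfolding filterlim_iff by blast
  moreover have "\<forall>\<^sub>F N in sequentially. N \<ge> (1::nat)" by (rule eventually_ge_at_top)
  ultimately have "\<forall>\<^sub>F N in sequentially. norm ((\<integral>x. \<bar>class_avg K r (\<lambda>m. g ((T ^^ m) x)) (real N)\<bar> \<partial>M) - 0) < e"
  proof eventually_elim
    case (elim N)
    let ?h = "\<lambda>x. birkhoff_sum J g x / real J"
    have hint: "integrable M (\<lambda>x. \<bar>?h ((T ^^ k) x)\<bar>)" for k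
    proof (rule integrable_bounded[where C = 1])
      fix x assume x: "x \<in> space M"
      have "\<bar>birkhoff_sum J g ((T ^^ k) x)\<bar> \<le> (\<Sum>i<J. 1)"
        unfolding birkhoff_sum_def using g1 funpow_space[OF funpow_space[OF x]]
        by (intro order_trans[OF sum_abs] sum_mono) auto
      then show "\<bar>\<bar>?h ((T ^^ k) x)\<bar>\<bar> \<le> 1" using J by (simp add: abs_divide)
    qed measurable
    have pt: "\<bar>class_avg K r (\<lambda>m. g ((T ^^ m) x)) (real N)\<bar> \<le>
        e / 4 + (\<Sum>n\<in>nats_upto (real N). \<bar>?h ((T ^^ Omega n) x)\<bar>) / real N" if x: "x \<in> space M" for x
    proof -
      define b where "b = (\<lambda>m. g ((T ^^ m) x))"
      have b: "unit_seq b" using g1 funpow_space[OF x] by (simp add: unit_seq_def b_def)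
      have shift: "\<bar>class_avg K r (shift_seq i b) (real N) - class_avg K r b (real N)\<bar> \<le> real i * \<eta>" for i
      proof (induction i)
        case (Suc i)
        have "\<bar>class_avg K r (shift_seq 1 (shift_seq i b)) (real N) - class_avg K r (shift_seq i b) (real N)\<bar> \<le> \<eta>"
          using elim(1)[rule_format, of "shift_seq i b"] b by simp
        then show ?case using Suc by (simp add: algebra_simps)
      qed simp
      have "real J * class_avg K r b (real N) = (\<Sum>i<J. class_avg K r b (real N))" by simp
      also have "\<dots> = (\<Sum>i<J. class_avg K r (shift_seq i b) (real N)) -
          (\<Sum>i<J. class_avg K r (shift_seq i b) (real N) - class_avg K r b (real N))"
        by (simp add: sum_subtractf)
      finally have eq: "real J * class_avg K r b (real N) = (\<Sum>i<J. class_avg K r (shift_seq i b) (real N)) -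
          (\<Sum>i<J. class_avg K r (shift_seq i b) (real N) - class_avg K r b (real N))" .
      have total: "\<bar>real J * class_avg K r b (real N)\<bar> \<le> \<bar>\<Sum>i<J. class_avg K r (shift_seq i b) (real N)\<bar> +
          (\<Sum>i<J. real J * \<eta>)"
        unfolding eq
      proof (rule order_trans[OF abs_triangle_ineq4], rule add_left_mono, rule order_trans[OF sum_abs], rule sum_mono)
        fix i assume "i \<in> {..<J}"
        then have "real i * \<eta> \<le> real J * \<eta>" using \<eta> by (intro mult_right_mono) auto
        then show "\<bar>class_avg K r (shift_seq i b) (real N) - class_avg K r b (real N)\<bar> \<le> real J * \<eta>"
          using shift[of i] by linarith
      qed
      have "(\<Sum>i<J. class_avg K r (shift_seq i b) (real N)) =
          real J * ((\<Sum>n\<in>nats_upto (real N). if [n = r] (mod K) then ?h ((T ^^ Omega n) x) else 0) / real N)"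
      proof -
        have "(\<Sum>i<J. class_sum K r (shift_seq i b) (real N)) =
            (\<Sum>n\<in>nats_upto (real N). \<Sum>i<J. if [n = r] (mod K) then shift_seq i b (Omega n) else 0)"
          unfolding class_sum_def by (rule sum.swap)
        also have "\<dots> = (\<Sum>n\<in>nats_upto (real N). real J * (if [n = r] (mod K) then ?h ((T ^^ Omega n) x) else 0))"
        proof (intro sum.cong refl)
          fix n
          have "(\<Sum>i<J. shift_seq i b (Omega n)) = birkhoff_sum J g ((T ^^ Omega n) x)"
            unfolding birkhoff_sum_def shift_seq_def b_def by (simp add: add.commute funpow_add)
          then show "(\<Sum>i<J. if [n = r] (mod K) then shift_seq i b (Omega n) else 0) =
              real J * (if [n = r] (mod K) then ?h ((T ^^ Omega n) x) else 0)" using J by simp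
        qed
        finally show ?thesis
          unfolding class_avg_def sum_divide_distrib[symmetric] sum_distrib_left[symmetric] by simp
      qed
      then have "\<bar>\<Sum>i<J. class_avg K r (shift_seq i b) (real N)\<bar> = \<bar>real J * ((\<Sum>n\<in>nats_upto (real N). if [n = r] (mod K) then ?h ((T ^^ Omega n) x) else 0) / real N)\<bar>"
        by (rule arg_cong)
      also have "\<dots> \<le> real J * ((\<Sum>n\<in>nats_upto (real N). \<bar>?h ((T ^^ Omega n) x)\<bar>) / real N)"
        unfolding abs_mult abs_divide abs_of_nat
        by (intro mult_left_mono divide_right_mono order_trans[OF sum_abs] sum_mono) auto
      finally have "\<bar>\<Sum>i<J. class_avg K r (shift_seq i b) (real N)\<bar> \<le>
          real J * ((\<Sum>n\<in>nats_upto (real N). \<bar>?h ((T ^^ Omega n) x)\<bar>) / real N)" .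
      moreover have "(\<Sum>i<J. real J * \<eta>) = real J * (e / 4)" using J by (simp add: \<eta>_def)
      ultimately have "real J * \<bar>class_avg K r b (real N)\<bar> \<le>
          real J * (e / 4 + (\<Sum>n\<in>nats_upto (real N). \<bar>?h ((T ^^ Omega n) x)\<bar>) / real N)"
        using total unfolding abs_mult abs_of_nat distrib_left by linarith
      then show ?thesis using J unfolding b_def by simp
    qed
    have meas [measurable]: "(\<lambda>x. class_avg K r (\<lambda>m. g ((T ^^ m) x)) (real N)) \<in> borel_measurable M"
      unfolding class_avg_def class_sum_def by measurable
    have "(\<integral>x. \<bar>class_avg K r (\<lambda>m. g ((T ^^ m) x)) (real N)\<bar> \<partial>M) \<le>
        (\<integral>x. e / 4 + (\<Sum>n\<in>nats_upto (real N). \<bar>?h ((T ^^ Omega n) x)\<bar>) / real N \<partial>M)"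
    proof (rule integral_mono')
      show "integrable M (\<lambda>x. e / 4 + (\<Sum>n\<in>nats_upto (real N). \<bar>?h ((T ^^ Omega n) x)\<bar>) / real N)"
        using hint by simp
      show "0 \<le> e / 4 + (\<Sum>n\<in>nats_upto (real N). \<bar>?h ((T ^^ Omega n) x)\<bar>) / real N" for x
        using e by (intro add_nonneg_nonneg divide_nonneg_nonneg sum_nonneg) auto
    qed (use pt in auto)
    also have "\<dots> = e / 4 + (\<Sum>n\<in>nats_upto (real N). \<integral>x. \<bar>?h ((T ^^ Omega n) x)\<bar> \<partial>M) / real N"
      using hint prob_space by simp
    also have "(\<Sum>n\<in>nats_upto (real N). \<integral>x. \<bar>?h ((T ^^ Omega n) x)\<bar> \<partial>M) \<le> (\<Sum>n\<in>nats_upto (real N). e / 4)"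
    proof (intro sum_mono)
      fix n
      have "(\<integral>x. \<bar>?h ((T ^^ Omega n) x)\<bar> \<partial>M) = (\<integral>x. \<bar>?h x\<bar> \<partial>M)"
        by (rule mpt.integral_T[OF funpow_mpt, where f = "\<lambda>x. \<bar>?h x\<bar>"]) measurable
      then show "(\<integral>x. \<bar>?h ((T ^^ Omega n) x)\<bar> \<partial>M) \<le> e / 4" using J(2) by linarith
    qed
    also have "\<dots> = real N * (e / 4)" by (simp add: nats_upto_def)
    finally have "(\<integral>x. \<bar>class_avg K r (\<lambda>m. g ((T ^^ m) x)) (real N)\<bar> \<partial>M) \<le> e / 4 + e / 4"
      using elim(2) by (simp add: divide_right_mono)
    moreover have "(\<integral>x. \<bar>class_avg K r (\<lambda>m. g ((T ^^ m) x)) (real N)\<bar> \<partial>M) \<ge> 0" by simp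
    ultimately show ?case using e by simp
  qed
  then show "\<exists>N0. \<forall>N\<ge>N0. norm ((\<integral>x. \<bar>class_avg K r (\<lambda>m. g ((T ^^ m) x)) (real N)\<bar> \<partial>M) - 0) < e"
    by (simp add: eventually_sequentially)
qed

text \<open>If \<open>f\<close> is almost orthogonal to all functions invariant under a power of \<open>T\<close>, then the
  Turan-Kubilius inequality replaces \<open>f \<circ> T\<^sup>n\<close> by a combination of the functions \<open>f \<circ> T\<^sup>p\<^sup>m\<close> with
  coefficients not depending on \<open>p\<close>, and these are almost uncorrelated for distinct primes \<open>p\<close>.\<close>

lemma multiplicative_orthogonality:
  fixes f :: "'a \<Rightarrow> real" and u :: "nat \<Rightarrow> 'a \<Rightarrow> real"
  assumes f [measurable]: "f \<in> borel_measurable M" and f1: "\<And>x. x \<in> space M \<Longrightarrow> \<bar>f x\<bar> \<le> 1"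
    and u [measurable]: "\<And>n. u n \<in> borel_measurable M" and u1: "\<And>n x. x \<in> space M \<Longrightarrow> \<bar>u n x\<bar> \<le> 1"
    and P: "finite P" "\<And>p. p \<in> P \<Longrightarrow> prime p" and w: "\<And>p. w p \<ge> 0" "sum w P = 1"
      "(\<Sum>p\<in>P. (w p)\<^sup>2 * real p) < \<eta>\<^sup>2" and \<eta>: "\<eta> > 0"
    and \<epsilon>: "\<epsilon> > 0" "\<epsilon> * (\<Sum>p\<in>P. \<Sum>q\<in>P. w p * real p * (w q * real q)) \<le> \<eta>\<^sup>2"
    and conv: "\<And>k. k \<ge> 1 \<Longrightarrow> \<exists>c\<le>\<epsilon>. (\<lambda>N. (\<Sum>m=1..N. \<integral>x. f x * f ((T ^^ (k * m)) x) \<partial>M) / real N) \<longlonglongrightarrow> c"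
  shows "\<forall>\<^sub>F N in sequentially. \<bar>\<Sum>n=1..N. \<integral>x. u (Omega n) x * f ((T ^^ n) x) \<partial>M\<bar> \<le> 3 * \<eta> * real N"
proof -
  define c where "c = (\<lambda>j. \<integral>x. f x * f ((T ^^ j) x) \<partial>M)"
  define W where "W = (\<lambda>n. \<integral>x. u (Omega n) x * f ((T ^^ n) x) \<partial>M)"
  have prod1: "\<bar>y * z\<bar> \<le> 1" if "\<bar>y\<bar> \<le> 1" "\<bar>z\<bar> \<le> 1" for y z :: real
    using that by (simp add: abs_mult mult_le_one)
  have intff: "integrable M (\<lambda>x. f ((T ^^ i) x) * f ((T ^^ j) x))" for i j
    using f1 funpow_space by (intro integrable_bounded[where C = 1] prod1) auto
  have intuf: "integrable M (\<lambda>x. u n x * f ((T ^^ i) x))" for n i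
    using f1 u1 funpow_space by (intro integrable_bounded[where C = 1] prod1) auto
  have integral_le_1: "\<bar>\<integral>x. h x \<partial>M\<bar> \<le> 1" if "integrable M h" "\<And>x. x \<in> space M \<Longrightarrow> \<bar>h x\<bar> \<le> 1" for h :: "'a \<Rightarrow> real"
  proof -
    have "\<bar>\<integral>x. h x \<partial>M\<bar> \<le> (\<integral>x. \<bar>h x\<bar> \<partial>M)" by (rule integral_abs_bound)
    also have "\<dots> \<le> (\<integral>x. 1 \<partial>M)" using that by (intro integral_mono) auto
    finally show ?thesis using prob_space by simp
  qed
  have W1: "\<bar>W n\<bar> \<le> 1" for n
    unfolding W_def using f1 u1 funpow_space by (intro integral_le_1 intuf prod1) auto
  have corr: "(\<integral>x. f ((T ^^ (q + d)) x) * f ((T ^^ q) x) \<partial>M) = c d" for q d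
  proof -
    have "(\<integral>x. f ((T ^^ d) ((T ^^ q) x)) * f ((T ^^ q) x) \<partial>M) = (\<integral>x. f ((T ^^ d) x) * f x \<partial>M)"
      by (rule mpt.integral_T[OF funpow_mpt, where f = "\<lambda>x. f ((T ^^ d) x) * f x"]) measurable
    then show ?thesis by (simp add: c_def funpow_add add.commute[of q] mult.commute)
  qed
  have corr': "(\<integral>x. f ((T ^^ (p * m)) x) * f ((T ^^ (q * m)) x) \<partial>M) = c ((max p q - min p q) * m)" for p q m
  proof (cases "q \<le> p")
    case True
    then have "p * m = q * m + (p - q) * m" by (simp flip: distrib_right)
    then show ?thesis using True corr[of "q * m" "(p - q) * m"] by (simp add: max_def min_def)
  next
    case False
    then have "q * m = p * m + (q - p) * m" by (simp flip: distrib_right)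
    then show ?thesis using False corr[of "p * m" "(q - p) * m"] by (simp add: max_def min_def mult.commute)
  qed
  define D where "D = (\<Sum>p\<in>P. \<Sum>q\<in>P. w p * real p * (w q * real q))"
  have tk: "\<forall>\<^sub>F N in sequentially. \<forall>f. (\<forall>n. \<bar>f n\<bar> \<le> 1) \<longrightarrow>
    \<bar>(\<Sum>n\<in>nats_upto (real N). f n) - (\<Sum>p\<in>P. w p * real p * (\<Sum>m\<in>nats_upto (real N / real p). f (p * m)))\<bar> \<le> \<eta> * real N"
    using turan_kubilius[OF P w \<eta>] filterlim_real_sequentially unfolding filterlim_iff by blast
  \<comment> \<open>An upper bound alone suffices, since the correlations are later multiplied by
    nonnegative weights. The factor 2 is the room between the limit, which is at most
    \<open>\<epsilon>\<close>, and the averages.\<close>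
  have off: "\<forall>\<^sub>F N in sequentially. \<forall>p\<in>P. \<forall>q\<in>P. p \<noteq> q \<longrightarrow>
      (\<Sum>m=1..N div max p q. c ((max p q - min p q) * m)) \<le> 2 * \<epsilon> * real N"
  proof (intro eventually_ball_finite P ballI)
    fix p q assume pq: "p \<in> P" "q \<in> P"
    show "\<forall>\<^sub>F N in sequentially. p \<noteq> q \<longrightarrow> (\<Sum>m=1..N div max p q. c ((max p q - min p q) * m)) \<le> 2 * \<epsilon> * real N"
    proof (cases "p = q")
      case False
      define k where "k = max p q - min p q"
      define l where "l = max p q"
      have k: "k \<ge> 1" using False by (auto simp: k_def max_def min_def)
      have l: "l \<ge> 1" using P(2)[OF pq(1)] P(2)[OF pq(2)] by (auto simp: l_def prime_gt_0_nat Suc_le_eq max_def)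
      obtain c0 where c0: "c0 \<le> \<epsilon>" "(\<lambda>N. (\<Sum>m=1..N. c (k * m)) / real N) \<longlonglongrightarrow> c0"
        using conv[OF k] unfolding c_def by blast
      have "\<forall>\<^sub>F N in sequentially. (\<Sum>m=1..N. c (k * m)) / real N < 2 * \<epsilon>"
        using c0 \<epsilon>(1) by (intro order_tendstoD(2)[OF c0(2)]) simp
      then obtain N0 where N0: "\<And>N. N \<ge> N0 \<Longrightarrow> (\<Sum>m=1..N. c (k * m)) / real N < 2 * \<epsilon>"
        unfolding eventually_sequentially by blast
      have "\<forall>\<^sub>F N in sequentially. N \<ge> l * Suc N0" by (rule eventually_ge_at_top)
      then show ?thesis
      proof eventually_elim
        case (elim N)
        define N' where "N' = N div l"
        have "l * Suc N0 div l \<le> N'" unfolding N'_def using elim by (rule div_le_mono)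
        then have N': "N' \<ge> Suc N0" using l by simp
        have "(\<Sum>m=1..N'. c (k * m)) \<le> 2 * \<epsilon> * real N'" using N0[of N'] N' by (simp add: field_simps)
        also have "\<dots> \<le> 2 * \<epsilon> * real N" using \<epsilon>(1) by (intro mult_left_mono) (auto simp: N'_def)
        finally show ?case by (simp add: k_def l_def N'_def)
      qed
    qed simp
  qed
  from tk off show ?thesis
  proof eventually_elim
    case (elim N)
    \<comment> \<open>Since \<open>Omega (p * m)\<close> is the same for all primes
      \<open>p\<close>, the factor with \<open>u\<close> leaves the sum over \<open>p\<close>, and
      what is left is \<open>V m\<close>. In its mean square the diagonal is the Turan-Kubilius
      variance.\<close>
    define V where "V = (\<lambda>m x. \<Sum>p\<in>P. if p * m \<le> N then w p * real p * f ((T ^^ (p * m)) x) else 0)"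
    have V_meas [measurable]: "V m \<in> borel_measurable M" for m unfolding V_def by measurable
    have V_bound: "\<bar>V m x\<bar> \<le> (\<Sum>p\<in>P. w p * real p)" if "x \<in> space M" for m x
      unfolding V_def
    proof (intro order_trans[OF sum_abs] sum_mono)
      fix p
      have "w p * real p * \<bar>f ((T ^^ (p * m)) x)\<bar> \<le> w p * real p * 1"
        using w(1) f1[OF funpow_space[OF that]] by (intro mult_left_mono) auto
      then show "\<bar>if p * m \<le> N then w p * real p * f ((T ^^ (p * m)) x) else 0\<bar> \<le> w p * real p"
        using w(1)[of p] by (simp add: abs_mult)
    qed
    have intV: "integrable M (V m)" for m using V_bound by (intro integrable_bounded) auto
    have intV2: "integrable M (\<lambda>x. (V m x)\<^sup>2)" for m
    proof (rule integrable_bounded)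
      fix x assume "x \<in> space M"
      then have "\<bar>V m x\<bar> \<le> (\<Sum>p\<in>P. w p * real p)" by (rule V_bound)
      then have "\<bar>V m x\<bar>\<^sup>2 \<le> (\<Sum>p\<in>P. w p * real p)\<^sup>2" by (intro power_mono) auto
      then show "\<bar>(V m x)\<^sup>2\<bar> \<le> (\<Sum>p\<in>P. w p * real p)\<^sup>2" by simp
    qed measurable
    have set_eq: "nats_upto (real N / real p) = {m\<in>{1..N}. p * m \<le> N}" if "p \<in> P" for p
    proof -
      have p: "p \<ge> 1" using P(2)[OF that] by (simp add: prime_gt_0_nat Suc_le_eq)
      have "m \<le> N" if "p * m \<le> N" for m
      proof -
        have "m \<le> p * m" using p by simp
        then show ?thesis using that by (rule order_trans)
      qed
      moreover have "real m \<le> real N / real p \<longleftrightarrow> p * m \<le> N" for m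
      proof -
        have "real m \<le> real N / real p \<longleftrightarrow> real (p * m) \<le> real N" using p by (simp add: field_simps)
        then show ?thesis by (simp only: of_nat_le_iff)
      qed
      ultimately show ?thesis by auto
    qed
    have sumW: "(\<Sum>p\<in>P. w p * real p * (\<Sum>m\<in>nats_upto (real N / real p). W (p * m))) =
        (\<Sum>m=1..N. \<integral>x. u (Suc (Omega m)) x * V m x \<partial>M)"
    proof -
      have "(\<Sum>p\<in>P. w p * real p * (\<Sum>m\<in>nats_upto (real N / real p). W (p * m))) =
          (\<Sum>p\<in>P. \<Sum>m=1..N. if p * m \<le> N then w p * real p * W (p * m) else 0)"
        using set_eq by (intro sum.cong refl) (simp add: sum_distrib_left flip: sum.inter_filter)
      also have "\<dots> = (\<Sum>m=1..N. \<Sum>p\<in>P. if p * m \<le> N then w p * real p * W (p * m) else 0)" by (rule sum.swap)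
      also have "\<dots> = (\<Sum>m=1..N. \<integral>x. u (Suc (Omega m)) x * V m x \<partial>M)"
      proof (intro sum.cong refl)
        fix m assume m: "m \<in> {1..N}"
        have "(\<integral>x. u (Suc (Omega m)) x * V m x \<partial>M) =
            (\<integral>x. (\<Sum>p\<in>P. (if p * m \<le> N then w p * real p else 0) * (u (Suc (Omega m)) x * f ((T ^^ (p * m)) x))) \<partial>M)"
          unfolding V_def sum_distrib_left
          by (intro Bochner_Integration.integral_cong refl sum.cong) (auto simp: mult_ac)
        also have "\<dots> = (\<Sum>p\<in>P. (if p * m \<le> N then w p * real p else 0) * (\<integral>x. u (Suc (Omega m)) x * f ((T ^^ (p * m)) x) \<partial>M))"
          using intuf by (subst Bochner_Integration.integral_sum) auto
        also have "\<dots> = (\<Sum>p\<in>P. if p * m \<le> N then w p * real p * W (p * m) else 0)"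
          using P(2) m by (intro sum.cong refl) (auto simp: W_def Omega_prime_mult)
        finally show "(\<Sum>p\<in>P. if p * m \<le> N then w p * real p * W (p * m) else 0) = (\<integral>x. u (Suc (Omega m)) x * V m x \<partial>M)" ..
      qed
      finally show ?thesis .
    qed
    have V2: "(\<Sum>m=1..N. \<integral>x. (V m x)\<^sup>2 \<partial>M) \<le> 4 * \<eta>\<^sup>2 * real N"
    proof -
      have "(\<integral>x. (V m x)\<^sup>2 \<partial>M) = (\<Sum>p\<in>P. \<Sum>q\<in>P. if p * m \<le> N \<and> q * m \<le> N then
          w p * real p * (w q * real q) * c ((max p q - min p q) * m) else 0)" for m
      proof -
        have "(\<integral>x. (V m x)\<^sup>2 \<partial>M) = (\<integral>x. (\<Sum>p\<in>P. \<Sum>q\<in>P. (if p * m \<le> N \<and> q * m \<le> N then w p * real p * (w q * real q) else 0) *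
            (f ((T ^^ (p * m)) x) * f ((T ^^ (q * m)) x))) \<partial>M)"
          unfolding V_def power2_eq_square sum_product
          by (intro Bochner_Integration.integral_cong refl sum.cong) (auto simp: mult_ac)
        also have "\<dots> = (\<Sum>p\<in>P. \<Sum>q\<in>P. (if p * m \<le> N \<and> q * m \<le> N then w p * real p * (w q * real q) else 0) *
            c ((max p q - min p q) * m))"
          using intff by (simp add: Bochner_Integration.integral_sum corr')
        also have "\<dots> = (\<Sum>p\<in>P. \<Sum>q\<in>P. if p * m \<le> N \<and> q * m \<le> N then
          w p * real p * (w q * real q) * c ((max p q - min p q) * m) else 0)"
          by (intro sum.cong refl) simp
        finally show ?thesis .
      qed
      then have "(\<Sum>m=1..N. \<integral>x. (V m x)\<^sup>2 \<partial>M) = (\<Sum>m=1..N. \<Sum>p\<in>P. \<Sum>q\<in>P. if p * m \<le> N \<and> q * m \<le> N then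
          w p * real p * (w q * real q) * c ((max p q - min p q) * m) else 0)" by simp
      also have "\<dots> = (\<Sum>p\<in>P. \<Sum>m=1..N. \<Sum>q\<in>P. if p * m \<le> N \<and> q * m \<le> N then
          w p * real p * (w q * real q) * c ((max p q - min p q) * m) else 0)" by (rule sum.swap)
      also have "\<dots> = (\<Sum>p\<in>P. \<Sum>q\<in>P. \<Sum>m=1..N. if p * m \<le> N \<and> q * m \<le> N then
          w p * real p * (w q * real q) * c ((max p q - min p q) * m) else 0)" by (rule sum.cong[OF refl], rule sum.swap)
      also have "\<dots> \<le> (\<Sum>p\<in>P. \<Sum>q\<in>P. (if p = q then (w p)\<^sup>2 * real p * real N else 0) + w p * real p * (w q * real q) * (2 * \<epsilon> * real N))"
      proof (intro sum_mono)
        fix p q assume pq: "p \<in> P" "q \<in> P"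
        have p: "p \<ge> 1" "q \<ge> 1" using P(2) pq by (auto simp: prime_gt_0_nat Suc_le_eq)
        have "{m\<in>{1..N}. p * m \<le> N \<and> q * m \<le> N} = {1..N div max p q}"
        proof -
          have "m \<in> {1..N} \<and> p * m \<le> N \<and> q * m \<le> N \<longleftrightarrow> m \<in> {1..N div max p q}" for m
          proof -
            have "p * m \<le> N \<and> q * m \<le> N \<longleftrightarrow> m * max p q \<le> N" 
            proof
              assume "m * max p q \<le> N"
              moreover have "p * m \<le> m * max p q" "q * m \<le> m * max p q" by (simp_all add: mult.commute[of m])
              ultimately show "p * m \<le> N \<and> q * m \<le> N" by linarith
            qed (auto simp: max_def mult.commute)
            also have "\<dots> \<longleftrightarrow> m \<le> N div max p q" using p by (simp add: less_eq_div_iff_mult_less_eq)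
            finally have iff: "p * m \<le> N \<and> q * m \<le> N \<longleftrightarrow> m \<le> N div max p q" .
            have "m \<le> N" if "m \<le> N div max p q" using that div_le_dividend by (rule order_trans)
            then show ?thesis unfolding iff by auto
          qed
          then show ?thesis by blast
        qed
        then have eq: "(\<Sum>m=1..N. if p * m \<le> N \<and> q * m \<le> N then w p * real p * (w q * real q) * c ((max p q - min p q) * m) else 0)
          = w p * real p * (w q * real q) * (\<Sum>m=1..N div max p q. c ((max p q - min p q) * m))"
          using sum.inter_filter[of "{1..N}" "\<lambda>m. w p * real p * (w q * real q) * c ((max p q - min p q) * m)" "\<lambda>m. p * m \<le> N \<and> q * m \<le> N"]
          by (simp add: sum_distrib_left)
        show "(\<Sum>m=1..N. if p * m \<le> N \<and> q * m \<le> N then w p * real p * (w q * real q) * c ((max p q - min p q) * m) else 0)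
          \<le> (if p = q then (w p)\<^sup>2 * real p * real N else 0) + w p * real p * (w q * real q) * (2 * \<epsilon> * real N)"
        proof (cases "p = q")
          case False
          then have "(\<Sum>m=1..N div max p q. c ((max p q - min p q) * m)) \<le> 2 * \<epsilon> * real N" using elim(2) pq by blast
          then show ?thesis unfolding eq using False w(1) by (simp add: mult_left_mono)
        next
          case True
          have "\<bar>\<integral>x. f ((T ^^ 0) x) * f ((T ^^ 0) x) \<partial>M\<bar> \<le> 1"
            by (intro integral_le_1 intff prod1 f1 funpow_space)
          then have "c 0 \<le> 1" by (simp add: c_def)
          then have "(\<Sum>m=1..N div p. c 0) \<le> real (N div p)" by (simp add: mult_left_le)
          also have "\<dots> \<le> real N / real p" by (rule of_nat_div_le_of_nat)
          finally have "w p * real p * (w p * real p) * (\<Sum>m=1..N div p. c 0) \<le> w p * real p * (w p * real p) * (real N / real p)"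
            using w(1) by (intro mult_left_mono) auto
          also have "\<dots> = (w p)\<^sup>2 * real p * real N" using p by (simp add: power2_eq_square)
          finally have "w p * real p * (w p * real p) * (\<Sum>m=1..N div p. c 0) \<le> (w p)\<^sup>2 * real p * real N" .
          moreover have "w p * real p * (w p * real p) * (2 * \<epsilon> * real N) \<ge> 0" using w(1) \<epsilon>(1) by simp
          ultimately have "w p * real p * (w p * real p) * (\<Sum>m=1..N div p. c 0) \<le>
              (w p)\<^sup>2 * real p * real N + w p * real p * (w p * real p) * (2 * \<epsilon> * real N)" by linarith
          then show ?thesis unfolding eq using True by simp
        qed
      qed
      also have "\<dots> = (\<Sum>p\<in>P. (w p)\<^sup>2 * real p) * real N + 2 * (\<epsilon> * D) * real N"
        using P(1) unfolding D_def by (simp add: sum.distrib sum_distrib_left sum_distrib_right mult_ac)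
      also have "\<dots> \<le> \<eta>\<^sup>2 * real N + 2 * \<eta>\<^sup>2 * real N"
        using w(3) \<epsilon>(2) unfolding D_def[symmetric] by (intro add_mono mult_right_mono mult_left_mono) auto
      also have "\<dots> \<le> 4 * \<eta>\<^sup>2 * real N" by simp
      finally show ?thesis .
    qed
    have "\<bar>\<Sum>m=1..N. \<integral>x. u (Suc (Omega m)) x * V m x \<partial>M\<bar> \<le> (\<Sum>m=1..N. (\<integral>x. (V m x)\<^sup>2 \<partial>M) / (4 * \<eta>) + \<eta>)"
    proof (intro order_trans[OF sum_abs] sum_mono)
      fix m
      have "\<bar>\<integral>x. u (Suc (Omega m)) x * V m x \<partial>M\<bar> \<le> (\<integral>x. \<bar>u (Suc (Omega m)) x * V m x\<bar> \<partial>M)" by (rule integral_abs_bound)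
      also have "\<dots> \<le> (\<integral>x. (V m x)\<^sup>2 / (4 * \<eta>) + \<eta> \<partial>M)"
      proof (rule integral_mono')
        show "integrable M (\<lambda>x. (V m x)\<^sup>2 / (4 * \<eta>) + \<eta>)" using intV2 by simp
        fix x assume x: "x \<in> space M"
        have "\<bar>u (Suc (Omega m)) x * V m x\<bar> \<le> 1 * \<bar>V m x\<bar>" unfolding abs_mult using u1[OF x] by (intro mult_right_mono) auto
        also have "1 * \<bar>V m x\<bar> \<le> (V m x)\<^sup>2 / (4 * \<eta>) + \<eta>"
          \<comment> \<open>AM-GM\<close>
        proof -
          have "0 \<le> (\<bar>V m x\<bar> - 2 * \<eta>)\<^sup>2" by simp
          then have "4 * \<eta> * \<bar>V m x\<bar> \<le> (V m x)\<^sup>2 + 4 * \<eta> * \<eta>" by (simp add: power2_eq_square algebra_simps)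
          then show ?thesis using \<eta> by (simp add: field_simps)
        qed
        finally show "\<bar>u (Suc (Omega m)) x * V m x\<bar> \<le> (V m x)\<^sup>2 / (4 * \<eta>) + \<eta>" .
      qed (use \<eta> in simp)
      also have "\<dots> = (\<integral>x. (V m x)\<^sup>2 \<partial>M) / (4 * \<eta>) + \<eta>" using intV2 prob_space by simp
      finally show "\<bar>\<integral>x. u (Suc (Omega m)) x * V m x \<partial>M\<bar> \<le> (\<integral>x. (V m x)\<^sup>2 \<partial>M) / (4 * \<eta>) + \<eta>" .
    qed
    also have "\<dots> = (\<Sum>m=1..N. \<integral>x. (V m x)\<^sup>2 \<partial>M) / (4 * \<eta>) + \<eta> * real N"
      by (simp add: sum.distrib sum_divide_distrib mult.commute)
    also have "\<dots> \<le> (4 * \<eta>\<^sup>2 * real N) / (4 * \<eta>) + \<eta> * real N"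
      using V2 \<eta> by (intro add_right_mono divide_right_mono) auto
    also have "\<dots> = 2 * \<eta> * real N" using \<eta> by (simp add: power2_eq_square)
    finally have "\<bar>\<Sum>m=1..N. \<integral>x. u (Suc (Omega m)) x * V m x \<partial>M\<bar> \<le> 2 * \<eta> * real N" .
    moreover have "\<bar>(\<Sum>n\<in>nats_upto (real N). W n) - (\<Sum>m=1..N. \<integral>x. u (Suc (Omega m)) x * V m x \<partial>M)\<bar> \<le> \<eta> * real N"
      using elim(1)[rule_format, of W] W1 unfolding sumW by blast
    ultimately have "\<bar>\<Sum>n\<in>nats_upto (real N). W n\<bar> \<le> 3 * \<eta> * real N" by linarith
    then show ?case by (simp add: nats_upto_def W_def)
  qed
qed

end

lemma triple_correlation_limit:
  fixes M :: "'a measure" and T1 T2 :: "'a \<Rightarrow> 'a"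
  assumes "mpt M T1" "ergodic_map M T1" "mpt M T2" "ergodic_map M T2" and A [measurable]: "A \<in> sets M"
  shows "(\<lambda>N. (\<Sum>n=1..N. measure M (A \<inter> preimage_pow M T1 n A \<inter> preimage_pow M T2 (Omega n) A)) / real N)
    \<longlonglongrightarrow> measure M A ^ 3"
proof -
  interpret T1: mpt M T1 by fact
  interpret T2: mpt M T2 by fact
  note T1.funpow_measurable [measurable] T2.funpow_measurable [measurable]
  define a :: "'a \<Rightarrow> real" where "a = indicator A"
  define \<mu> where "\<mu> = measure M A"
  define g where "g = (\<lambda>x. a x - \<mu>)"
  define u where "u = (\<lambda>n x. a x * g ((T2 ^^ n) x))"
  have [measurable]: "a \<in> borel_measurable M" unfolding a_def by measurable
  have [measurable]: "g \<in> borel_measurable M" unfolding g_def by measurable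
  have u_meas [measurable]: "u n \<in> borel_measurable M" for n unfolding u_def by measurable
  have a01: "0 \<le> a x \<and> a x \<le> 1" for x by (simp add: a_def indicator_def)
  have a1: "\<bar>a x\<bar> \<le> 1" for x using a01[of x] by linarith
  have \<mu>01: "0 \<le> \<mu>" "\<mu> \<le> 1" by (simp_all add: \<mu>_def)
  have g1: "\<bar>g x\<bar> \<le> 1" for x using a01[of x] \<mu>01 by (simp add: g_def abs_le_iff)
  have prod1: "\<bar>y * z\<bar> \<le> 1" if "\<bar>y\<bar> \<le> 1" "\<bar>z\<bar> \<le> 1" for y z :: real
    using that by (simp add: abs_mult mult_le_one)
  have u1: "\<bar>u n x\<bar> \<le> 1" for n x unfolding u_def by (intro prod1 a1 g1)
  have inta: "(\<integral>x. a x \<partial>M) = \<mu>" using sets.sets_into_space[OF A] by (simp add: a_def \<mu>_def Int_absorb2)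
  have ia: "integrable M a" by (rule T1.integrable_bounded[where C = 1]) (use a1 in auto)
  have g0: "(\<integral>x. g x \<partial>M) = 0" using ia inta T1.prob_space by (simp add: g_def)
  define w where "w = (\<lambda>n. \<integral>x. u (Omega n) x * a ((T1 ^^ n) x) \<partial>M)"
  have split: "measure M (A \<inter> preimage_pow M T1 n A \<inter> preimage_pow M T2 (Omega n) A) =
      \<mu> * (\<integral>x. a x * a ((T1 ^^ n) x) \<partial>M) + w n" for n
  proof -
    let ?S = "A \<inter> preimage_pow M T1 n A \<inter> preimage_pow M T2 (Omega n) A"
    have "measure M ?S = (\<integral>x. indicator ?S x \<partial>M)" using sets.sets_into_space[OF A] by (simp add: Int_absorb2 le_infI1)
    also have "\<dots> = (\<integral>x. \<mu> * (a x * a ((T1 ^^ n) x)) + u (Omega n) x * a ((T1 ^^ n) x) \<partial>M)"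
      by (intro Bochner_Integration.integral_cong refl)
         (auto simp: u_def g_def a_def preimage_pow_def indicator_def algebra_simps)
    also have "\<dots> = \<mu> * (\<integral>x. a x * a ((T1 ^^ n) x) \<partial>M) + w n"
    proof -
      have "integrable M (\<lambda>x. a x * a ((T1 ^^ n) x))" "integrable M (\<lambda>x. u (Omega n) x * a ((T1 ^^ n) x))"
        by (rule T1.integrable_bounded[where C = 1], measurable, intro prod1 a1 u1)+
      then show ?thesis by (simp add: w_def)
    qed
    finally show ?thesis .
  qed
  have main: "(\<lambda>N. (\<Sum>n=1..N. \<integral>x. a x * a ((T1 ^^ n) x) \<partial>M) / real N) \<longlonglongrightarrow> (\<integral>x. a x * \<mu> \<partial>M)"
  proof (rule T1.weak_mean_ergodic[where C = 1])
    fix B assume B: "B \<in> sets M" "T1 -` B \<inter> space M = B"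
    show "(\<integral>x. indicator B x * a x \<partial>M) = (\<integral>x. indicator B x * \<mu> \<partial>M)"
      using T1.ergodic_invariant_integral[OF assms(2) _ B, of a] inta by simp
  qed (use a1 \<mu>01 in auto)
  have error: "(\<lambda>N. (\<Sum>n=1..N. w n) / real N) \<longlonglongrightarrow> 0"
  proof (rule LIMSEQ_I)
    fix e :: real assume e: "e > 0"
    define \<eta> where "\<eta> = e / 8"
    have \<eta>: "\<eta> > 0" using e by (simp add: \<eta>_def)
    obtain P and W :: "nat \<Rightarrow> real" where P: "finite P" "\<And>p. p \<in> P \<Longrightarrow> prime p"
      and W: "\<And>p. W p \<ge> 0" "sum W P = 1" "(\<Sum>p\<in>P. (W p)\<^sup>2 * real p) < \<eta>\<^sup>2"
      using turan_kubilius_weights[OF \<eta>] by blast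
    define D where "D = (\<Sum>p\<in>P. \<Sum>q\<in>P. W p * real p * (W q * real q))"
    have D: "D \<ge> 0" unfolding D_def using W(1) by (intro sum_nonneg mult_nonneg_nonneg) auto
    \<comment> \<open>The order of choices matters: \<open>\<eta>\<close> determines the primes and
      weights, these determine \<open>D\<close> and \<open>\<epsilon>\<close>, and only then is
      \<open>K\<close> obtained.\<close>
    define \<epsilon> where "\<epsilon> = \<eta>\<^sup>2 / (D + 1)"
    have \<epsilon>: "\<epsilon> > 0" using \<eta> D by (simp add: \<epsilon>_def)
    have "\<epsilon> * D \<le> \<eta>\<^sup>2" using \<eta> D by (simp add: \<epsilon>_def field_simps)
    obtain K F where K: "K \<ge> 1" and F [measurable]: "F \<in> borel_measurable M"
      and F01: "\<And>x. x \<in> space M \<Longrightarrow> 0 \<le> F x \<and> F x \<le> 1" and Finv: "\<And>x. x \<in> space M \<Longrightarrow> F ((T1 ^^ K) x) = F x"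
      and corr: "\<And>k. k \<ge> 1 \<Longrightarrow> \<exists>c\<le>\<epsilon>. (\<lambda>N. (\<Sum>m=1..N. \<integral>x. (a x - F x) * (a ((T1 ^^ (k * m)) x) - F ((T1 ^^ (k * m)) x)) \<partial>M) / real N) \<longlonglongrightarrow> c"
      by (rule T1.rational_decomposition[of a \<epsilon>]) (use a01 \<epsilon> in auto)
    have F1: "\<bar>F x\<bar> \<le> 1" if "x \<in> space M" for x using F01[OF that] by linarith
    have f1: "\<bar>a x - F x\<bar> \<le> 1" if "x \<in> space M" for x using F01[OF that] a01[of x] by linarith
    have ev1: "\<forall>\<^sub>F N in sequentially. \<bar>\<Sum>n=1..N. \<integral>x. u (Omega n) x * (a ((T1 ^^ n) x) - F ((T1 ^^ n) x)) \<partial>M\<bar> \<le> 3 * \<eta> * real N"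
      by (rule T1.multiplicative_orthogonality[where f = "\<lambda>x. a x - F x", OF _ f1 u_meas u1 P W \<eta> \<epsilon> \<open>\<epsilon> * D \<le> \<eta>\<^sup>2\<close>[unfolded D_def] corr]) auto
    let ?G = "\<lambda>r N x. class_avg K r (\<lambda>m. g ((T2 ^^ m) x)) (real N)"
    have "(\<lambda>N. \<Sum>r<K. \<integral>x. \<bar>?G r N x\<bar> \<partial>M) \<longlonglongrightarrow> (\<Sum>r<K. 0)"
      by (intro tendsto_sum T2.class_avg_tendsto_0[OF assms(4)] g1 g0 K) measurable
    then have ev2: "\<forall>\<^sub>F N in sequentially. (\<Sum>r<K. \<integral>x. \<bar>?G r N x\<bar> \<partial>M) < \<eta>" using \<eta> by (intro order_tendstoD) auto
    have "\<forall>\<^sub>F N in sequentially. N \<ge> (1::nat)" by (rule eventually_ge_at_top)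
    with ev1 ev2 have "\<forall>\<^sub>F N in sequentially. norm ((\<Sum>n=1..N. w n) / real N - 0) < e"
    proof eventually_elim
      case (elim N)
      have intF: "integrable M (\<lambda>x. u (Omega n) x * F ((T1 ^^ n) x))" for n
        using T1.funpow_space by (intro T1.integrable_bounded[where C = 1] prod1 u1 F1) auto
      have intf: "integrable M (\<lambda>x. u (Omega n) x * (a ((T1 ^^ n) x) - F ((T1 ^^ n) x)))" for n
        using T1.funpow_space by (intro T1.integrable_bounded[where C = 1] prod1 u1 f1) auto
      have [measurable]: "?G r N \<in> borel_measurable M" for r unfolding class_avg_def class_sum_def by measurable
      have intG: "integrable M (\<lambda>x. \<bar>?G r N x\<bar>)" for r
      proof (rule T1.integrable_bounded[where C = 1])
        fix x
        have "\<bar>class_sum K r (\<lambda>m. g ((T2 ^^ m) x)) (real N)\<bar> \<le> (\<Sum>n\<in>nats_upto (real N). 1)"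
          unfolding class_sum_def using g1 by (intro order_trans[OF sum_abs] sum_mono) auto
        also have "\<dots> = real N" by (simp add: nats_upto_def)
        finally show "\<bar>\<bar>?G r N x\<bar>\<bar> \<le> 1" using elim(3) by (simp add: class_avg_def)
      qed measurable
      have "w n = (\<integral>x. u (Omega n) x * (a ((T1 ^^ n) x) - F ((T1 ^^ n) x)) \<partial>M) + (\<integral>x. u (Omega n) x * F ((T1 ^^ n) x) \<partial>M)" for n
        unfolding w_def Bochner_Integration.integral_add[OF intf intF, symmetric]
        by (intro Bochner_Integration.integral_cong refl) (simp add: algebra_simps)
      then have "(\<Sum>n=1..N. w n) = (\<Sum>n=1..N. \<integral>x. u (Omega n) x * (a ((T1 ^^ n) x) - F ((T1 ^^ n) x)) \<partial>M)
          + (\<Sum>n=1..N. \<integral>x. u (Omega n) x * F ((T1 ^^ n) x) \<partial>M)" by (simp add: sum.distrib)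
      moreover have "\<bar>\<Sum>n=1..N. \<integral>x. u (Omega n) x * F ((T1 ^^ n) x) \<partial>M\<bar> \<le> real N * \<eta>"
      proof -
        have "(\<Sum>n=1..N. \<integral>x. u (Omega n) x * F ((T1 ^^ n) x) \<partial>M) = (\<integral>x. (\<Sum>n=1..N. u (Omega n) x * F ((T1 ^^ n) x)) \<partial>M)"
          by (rule Bochner_Integration.integral_sum[symmetric]) (rule intF)
        also have "\<bar>\<dots>\<bar> \<le> (\<integral>x. \<bar>\<Sum>n=1..N. u (Omega n) x * F ((T1 ^^ n) x)\<bar> \<partial>M)" by (rule integral_abs_bound)
        also have "\<dots> \<le> (\<integral>x. real N * (\<Sum>r<K. \<bar>?G r N x\<bar>) \<partial>M)"
        proof (rule integral_mono')
          show "integrable M (\<lambda>x. real N * (\<Sum>r<K. \<bar>?G r N x\<bar>))" using intG by simp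
          fix x assume x: "x \<in> space M"
          \<comment> \<open>Only \<open>K\<close> values \<open>F ((T1 ^^ r) x)\<close> occur along
            the orbit. They act as bounded coefficients, and what they multiply are averages of
            \<open>g\<close> along \<open>Omega n\<close> in the class of \<open>r\<close>.\<close>
          have Fmod: "F ((T1 ^^ n) x) = F ((T1 ^^ (n mod K)) x)" for n
          proof -
            interpret TK: mpt M "T1 ^^ K" by (rule T1.funpow_mpt)
            have "(T1 ^^ n) x = (T1 ^^ (K * (n div K) + n mod K)) x" by simp
            also have "\<dots> = ((T1 ^^ K) ^^ (n div K)) ((T1 ^^ (n mod K)) x)" by (simp only: funpow_add o_apply funpow_mult)
            finally show ?thesis using TK.birkhoff_sum_invariant[of F "(T1 ^^ (n mod K)) x", OF Finv T1.funpow_space[OF x]] by simp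
          qed
          have "(\<Sum>n=1..N. u (Omega n) x * F ((T1 ^^ n) x)) =
              (\<Sum>n\<in>nats_upto (real N). \<Sum>r<K. a x * F ((T1 ^^ r) x) * (if [n = r] (mod K) then g ((T2 ^^ Omega n) x) else 0))"
          proof -
            have "(\<Sum>r<K. a x * F ((T1 ^^ r) x) * (if [n = r] (mod K) then g ((T2 ^^ Omega n) x) else 0)) = u (Omega n) x * F ((T1 ^^ n) x)" for n
            proof -
              have "(\<Sum>r<K. a x * F ((T1 ^^ r) x) * (if [n = r] (mod K) then g ((T2 ^^ Omega n) x) else 0)) =
                (\<Sum>r<K. if r = n mod K then a x * F ((T1 ^^ r) x) * g ((T2 ^^ Omega n) x) else 0)"
                by (intro sum.cong refl) (auto simp: cong_def)
              then show ?thesis using K Fmod[of n] by (simp add: u_def mult_ac)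
            qed
            then show ?thesis by (simp add: nats_upto_def)
          qed
          also have "\<dots> = (\<Sum>r<K. a x * F ((T1 ^^ r) x) * class_sum K r (\<lambda>m. g ((T2 ^^ m) x)) (real N))"
            unfolding class_sum_def sum_distrib_left by (rule sum.swap)
          also have "\<bar>\<dots>\<bar> \<le> (\<Sum>r<K. real N * \<bar>?G r N x\<bar>)"
          proof (intro order_trans[OF sum_abs] sum_mono)
            fix r
            have "\<bar>a x * F ((T1 ^^ r) x) * class_sum K r (\<lambda>m. g ((T2 ^^ m) x)) (real N)\<bar> \<le> 1 * \<bar>class_sum K r (\<lambda>m. g ((T2 ^^ m) x)) (real N)\<bar>"
              unfolding abs_mult[of "a x * F ((T1 ^^ r) x)"]
              by (intro mult_right_mono prod1 a1 F1 T1.funpow_space x) auto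
            then show "\<bar>a x * F ((T1 ^^ r) x) * class_sum K r (\<lambda>m. g ((T2 ^^ m) x)) (real N)\<bar> \<le> real N * \<bar>?G r N x\<bar>"
              using elim(3) by (simp add: class_avg_def abs_divide)
          qed
          also have "\<dots> = real N * (\<Sum>r<K. \<bar>?G r N x\<bar>)" by (simp add: sum_distrib_left)
          finally show "\<bar>\<Sum>n=1..N. u (Omega n) x * F ((T1 ^^ n) x)\<bar> \<le> real N * (\<Sum>r<K. \<bar>?G r N x\<bar>)" .
        qed (auto intro!: mult_nonneg_nonneg sum_nonneg)
        also have "\<dots> = real N * (\<Sum>r<K. \<integral>x. \<bar>?G r N x\<bar> \<partial>M)"
          using intG by (simp add: Bochner_Integration.integral_sum)
        also have "\<dots> \<le> real N * \<eta>" using elim(2) by (intro mult_left_mono) auto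
        finally show ?thesis .
      qed
      ultimately have "\<bar>\<Sum>n=1..N. w n\<bar> \<le> 3 * \<eta> * real N + real N * \<eta>" using elim(1) by linarith
      also have "\<dots> < e * real N" using e elim(3) by (simp add: \<eta>_def)
      finally show ?case using elim(3) by (simp add: abs_divide divide_less_eq)
    qed
    then show "\<exists>N0. \<forall>N\<ge>N0. norm ((\<Sum>n=1..N. w n) / real N - 0) < e" by (simp add: eventually_sequentially)
  qed
  have "(\<lambda>N. \<mu> * ((\<Sum>n=1..N. \<integral>x. a x * a ((T1 ^^ n) x) \<partial>M) / real N) + (\<Sum>n=1..N. w n) / real N) \<longlonglongrightarrow> \<mu> * (\<integral>x. a x * \<mu> \<partial>M) + 0"
    by (intro tendsto_intros main error)
  moreover have "\<mu> * (\<integral>x. a x * \<mu> \<partial>M) + 0 = measure M A ^ 3"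
    using inta by (simp add: \<mu>_def power3_eq_cube)
  ultimately show ?thesis
    unfolding split by (simp add: sum.distrib add_divide_distrib sum_distrib_left)
qed

text \<open>Outside the set the values stay below \<open>l - \<epsilon>\<close>, inside they are at
  most 1, so the mean is bounded by the proportion of the set plus a constant below
  \<open>l\<close>.\<close>

lemma upper_density_pos:
  fixes v :: "nat \<Rightarrow> real"
  assumes lim: "(\<lambda>N. (\<Sum>n=1..N. v n) / real N) \<longlonglongrightarrow> l" and "l > 0" "\<epsilon> > 0" and v: "\<And>n. v n \<le> 1"
  shows "upper_density {n. n \<ge> 1 \<and> v n \<ge> l - \<epsilon>} > 0"
proof -
  define E where "E = {n. n \<ge> 1 \<and> v n \<ge> l - \<epsilon>}"
  \<comment> \<open>The maximum with 0 covers \<open>\<epsilon> > l\<close>: the constant must be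
    nonnegative for the indices in \<open>E\<close>, and it stays below \<open>l\<close> because
    \<open>l\<close> is positive.\<close>
  define c where "c = max 0 (l - \<epsilon>)"
  define d where "d = (l - c) / 2"
  have "c < l" using assms by (simp add: c_def)
  then have d: "d > 0" "c + d < l" by (simp_all add: d_def field_simps)
  have "\<forall>\<^sub>F N in sequentially. (\<Sum>n=1..N. v n) / real N > c + d" using lim d(2) by (rule order_tendstoD)
  moreover have "\<forall>\<^sub>F N in sequentially. N \<ge> (1::nat)" by (rule eventually_ge_at_top)
  ultimately have "\<forall>\<^sub>F N in sequentially. ereal d \<le> ereal (real (card (E \<inter> {1..N})) / real N)"
  proof eventually_elim
    case (elim N)
    have "(\<Sum>n=1..N. v n) \<le> (\<Sum>n=1..N. (if n \<in> E then 1 else 0) + c)"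
    proof (rule sum_mono)
      fix n assume "n \<in> {1..N}"
      then show "v n \<le> (if n \<in> E then 1 else 0) + c" using v[of n] by (auto simp: E_def c_def)
    qed
    also have "\<dots> = real (card (E \<inter> {1..N})) + c * real N"
      by (simp add: sum.distrib Int_commute flip: sum.inter_restrict)
    finally have "(\<Sum>n=1..N. v n) / real N \<le> real (card (E \<inter> {1..N})) / real N + c"
      using elim(2) by (simp add: field_simps)
    then show ?case using elim(1) by simp
  qed
  then have "ereal d \<le> upper_density E" unfolding upper_density_def by (intro le_Limsup) auto
  then show ?thesis unfolding E_def[symmetric] using d(1) by (meson ereal_less(2) less_le_trans)
qed

theorem corollary1p35:
  fixes M :: "'a::metric_space measure"
    and T1 T2 :: "'a \<Rightarrow> 'a"
    and A :: "'a set"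
  assumes "regular_prob_space M"
    and "invertible_mpt M T1" and "ergodic_map M T1"
    and "invertible_mpt M T2" and "ergodic_map M T2"
    and "A \<in> sets M" and "measure M A > 0"
  defines "avg \<equiv> (\<lambda>N::nat. (1 / real N) *
      (\<Sum>n=1..N. measure M (A \<inter> preimage_pow M T1 n A \<inter> preimage_pow M T2 (Omega n) A)))"
  shows "(convergent avg \<and> lim avg \<ge> measure M A ^ 3) \<and>
    (\<forall>\<epsilon>>0. upper_density {n. n \<ge> 1 \<and>
        measure M (A \<inter> preimage_pow M T1 n A \<inter> preimage_pow M T2 (Omega n) A)
          \<ge> measure M A ^ 3 - \<epsilon>} > 0)"
proof -
  define v where "v = (\<lambda>n. measure M (A \<inter> preimage_pow M T1 n A \<inter> preimage_pow M T2 (Omega n) A))"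
  have prob: "prob_space M" using assms(1) by (simp add: regular_prob_space_def)
  have T1: "mpt M T1" and T2: "mpt M T2"
    using prob assms(2,4) by (auto simp: mpt_def mpt_axioms_def invertible_mpt_def)
  have lim: "(\<lambda>N. (\<Sum>n=1..N. v n) / real N) \<longlonglongrightarrow> measure M A ^ 3"
    unfolding v_def by (rule triple_correlation_limit[OF T1 assms(3) T2 assms(5,6)])
  moreover have "avg = (\<lambda>N. (\<Sum>n=1..N. v n) / real N)" by (simp add: avg_def v_def)
  ultimately have avg: "avg \<longlonglongrightarrow> measure M A ^ 3" by simp
  have "v n \<le> 1" for n unfolding v_def using prob by (rule prob_space.prob_le_1)
  then have "\<forall>\<epsilon>>0. upper_density {n. n \<ge> 1 \<and> v n \<ge> measure M A ^ 3 - \<epsilon>} > 0"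
    using assms(7) by (intro allI impI upper_density_pos[OF lim]) auto
  then show ?thesis using avg limI[OF avg] by (auto simp: convergent_def v_def)
qed

end
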